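(* Let $G$ be a locally compact (Hausdorff) abelian group which is countable at infinity, with dual group $\hat G$ and Haar measures $\mu$ on $G$ and $\nu$ on $\hat G$ normalized so that the Fourier transform is an isometry $L^2(G,\mu)\to L^2(\hat G,\nu)$. Let $\Lambda$ be a discrete co-compact subgroup of $\hat G$, let $D\subset\hat G$ be a compact subset which is a fundamental domain of $\Lambda$, and put $V=\nu(D)$. Let $$L=\{x\in G:\ \chi(x)=1\ \text{for all }\chi\in\Lambda\}.$$ Let $\mathcal{H}_D$ be the reproducing kernel Hilbert space of functions in $L^2(G)$ whose Fourier transform is supported on $D$, let $g_D$ be the inverse Fourier transform of the indicator function $1_D$, and for $\lambda\in L$ let $\phi_\lambda(x)=g_D(x-\lambda)$ (group law of $G$ written additively). Then the functions $V^{-1/2}\phi_\lambda$, $\lambda\in L$, form an orthonormal basis of $\mathcal{H}_D$, and for every $f\in\mathcal{H}_D$ we have $$f(x)=V^{-1}\sum_{\lambda\in L}g_D(x-\lambda)\,f(\lambda)\qquad(x\in G),$$ where the series converges uniformly on $G$.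
   Context: "Countable at infinity" means $\sigma$-compact. $\hat G$ is the group of continuous unitary characters $\chi:G\to\{z\in\mathbb{C}:|z|=1\}$ with the topology of uniform convergence on compact sets. The Fourier transform is $\hat f(\chi)=\int_G f(x)\overline{\chi(x)}\,d\mu(x)$ for $f\in L^1\cap L^2$, extended to $L^2(G)$, and its inverse sends $F$ to $x\mapsto\int_{\hat G}\chi(x)F(\chi)\,d\nu(\chi)$; in particular $g_D(x)=\int_D\chi(x)\,d\nu(\chi)$. $D$ being a fundamental domain of $\Lambda$ means that the $\Lambda$-translates of $D$ cover $\hat G$ up to a null set and distinct translates intersect in null sets. $\mathcal{H}_D$ is the space of $f\in L^2(G)$ with $\hat f=0$ almost everywhere outside $D$; each such $f$ is identified with its continuous representative $x\mapsto\int_D\hat f(\chi)\chi(x)\,d\nu(\chi)$. The reproducing kernel is $K(x,y)=g_D(x-y)$. *)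

theory Defs
  imports "HOL-Analysis.Analysis"
begin

text \<open>
  The dual group: continuous unitary characters under pointwise multiplication, which is written
  additively so that the classes of topological abelian groups apply.
\<close>

typedef (overloaded) 'a dual =
  "{\<xi> :: 'a::topological_ab_group_add \<Rightarrow> complex.
      continuous_on UNIV \<xi> \<and> (\<forall>x. cmod (\<xi> x) = 1) \<and> (\<forall>x y. \<xi> (x + y) = \<xi> x * \<xi> y)}"
  morphisms eval_char Abs_dual
  by (rule exI[of _ "\<lambda>_. 1"]) auto

setup_lifting type_definition_dual

lemma eval_char_cont: "continuous_on UNIV (eval_char \<xi>)"
  and eval_char_norm [simp]: "cmod (eval_char \<xi> x) = 1"
  and eval_char_add: "eval_char \<xi> (x + y) = eval_char \<xi> x * eval_char \<xi> y"
  using eval_char[of \<xi>] by auto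

instantiation dual :: (topological_ab_group_add) ab_group_add
begin

lift_definition zero_dual :: "'a dual" is "\<lambda>_. 1" by auto

lift_definition plus_dual :: "'a dual \<Rightarrow> 'a dual \<Rightarrow> 'a dual" is "\<lambda>\<xi> \<psi> x. \<xi> x * \<psi> x"
  by (auto simp: norm_mult intro!: continuous_intros)

lift_definition uminus_dual :: "'a dual \<Rightarrow> 'a dual" is "\<lambda>\<xi> x. cnj (\<xi> x)"
  by (auto intro!: continuous_intros)

definition minus_dual :: "'a dual \<Rightarrow> 'a dual \<Rightarrow> 'a dual" where
  "\<xi> - \<psi> = \<xi> + - (\<psi> :: 'a dual)"

instance
proof
  fix \<xi> \<psi> \<rho> :: "'a dual"
  show "\<xi> + \<psi> + \<rho> = \<xi> + (\<psi> + \<rho>)" by transfer (simp add: mult.assoc)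
  show "\<xi> + \<psi> = \<psi> + \<xi>" by transfer (simp add: mult.commute)
  show "0 + \<xi> = \<xi>" by transfer simp
  show "- \<xi> + \<xi> = 0"
    by transfer (auto simp: fun_eq_iff mult.commute[of "cnj _"] complex_norm_square[symmetric])
  show "\<xi> - \<psi> = \<xi> + - \<psi>" by (simp add: minus_dual_def)
qed

end

definition dual_ball :: "'a::topological_ab_group_add dual \<Rightarrow> 'a set \<Rightarrow> real \<Rightarrow> 'a dual set" where
  "dual_ball \<xi> K e = {\<psi>. \<forall>x\<in>K. cmod (eval_char \<psi> x - eval_char \<xi> x) < e}"

lemma dual_ball_mono: "K \<subseteq> K' \<Longrightarrow> e' \<le> e \<Longrightarrow> dual_ball \<xi> K' e' \<subseteq> dual_ball \<xi> K e"
  by (force simp: dual_ball_def)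

text \<open>The topology of uniform convergence on compact sets.\<close>

instantiation dual :: (topological_ab_group_add) topological_space
begin

definition open_dual :: "'a dual set \<Rightarrow> bool" where
  "open U \<longleftrightarrow> (\<forall>\<xi>\<in>U. \<exists>K e. compact K \<and> 0 < e \<and> dual_ball \<xi> K e \<subseteq> U)"

instance
proof
  show "open (UNIV :: 'a dual set)"
    unfolding open_dual_def by (metis compact_empty subset_UNIV zero_less_one)
next
  fix S T :: "'a dual set" assume S: "open S" and T: "open T"
  show "open (S \<inter> T)" unfolding open_dual_def
  proof
    fix \<xi> assume "\<xi> \<in> S \<inter> T"
    with S T obtain K e K' e' where *: "compact K" "0 < e" "dual_ball \<xi> K e \<subseteq> S"
      "compact K'" "0 < e'" "dual_ball \<xi> K' e' \<subseteq> T"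
      unfolding open_dual_def by (metis IntD1 IntD2)
    have "dual_ball \<xi> (K \<union> K') (min e e') \<subseteq> S \<inter> T"
      using * dual_ball_mono[of K "K \<union> K'" "min e e'" e \<xi>]
        dual_ball_mono[of K' "K \<union> K'" "min e e'" e' \<xi>] by auto
    with * show "\<exists>K e. compact K \<and> 0 < e \<and> dual_ball \<xi> K e \<subseteq> S \<inter> T"
      by (metis compact_Un min_less_iff_conj)
  qed
next
  fix \<K> :: "'a dual set set" assume "\<forall>S\<in>\<K>. open S"
  then show "open (\<Union>\<K>)" unfolding open_dual_def by (meson UnionE Union_upper subset_trans)
qed

end

lemma open_dual_ball:
  assumes K: "compact K" shows "open (dual_ball \<xi> K e)"
  unfolding open_dual_def
proof
  fix \<psi> assume \<psi>: "\<psi> \<in> dual_ball \<xi> K e"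
  show "\<exists>K' e'. compact K' \<and> 0 < e' \<and> dual_ball \<psi> K' e' \<subseteq> dual_ball \<xi> K e"
  proof (cases "K = {}")
    case True
    then show ?thesis by (auto simp: dual_ball_def intro: exI[of _ "{}"] exI[of _ 1])
  next
    case False
    have "continuous_on K (\<lambda>x. cmod (eval_char \<psi> x - eval_char \<xi> x))"
      by (intro continuous_intros continuous_on_subset[OF eval_char_cont]) auto
    from continuous_attains_sup[OF K False this] obtain m where m: "m \<in> K"
      "\<And>x. x \<in> K \<Longrightarrow> cmod (eval_char \<psi> x - eval_char \<xi> x) \<le> cmod (eval_char \<psi> m - eval_char \<xi> m)"
      by blast
    define d where "d = e - cmod (eval_char \<psi> m - eval_char \<xi> m)"
    have "0 < d" using \<psi> m(1) by (auto simp: d_def dual_ball_def)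
    moreover have "dual_ball \<psi> K d \<subseteq> dual_ball \<xi> K e"
    proof
      fix \<rho> assume "\<rho> \<in> dual_ball \<psi> K d"
      then have *: "cmod (eval_char \<rho> x - eval_char \<psi> x) < d" if "x \<in> K" for x
        using that by (simp add: dual_ball_def)
      have "cmod (eval_char \<rho> x - eval_char \<xi> x) < e" if "x \<in> K" for x
      proof -
        have "cmod (eval_char \<rho> x - eval_char \<xi> x)
            \<le> cmod (eval_char \<rho> x - eval_char \<psi> x) + cmod (eval_char \<psi> x - eval_char \<xi> x)"
          by (metis diff_add_cancel add_diff_eq norm_triangle_ineq)
        with *[OF that] m(2)[OF that] show ?thesis by (simp add: d_def)
      qed
      then show "\<rho> \<in> dual_ball \<xi> K e" by (simp add: dual_ball_def)
    qed
    ultimately show ?thesis using K by blast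
  qed
qed

lemma eventually_nhds_dual:
  "eventually P (nhds \<xi>) \<longleftrightarrow> (\<exists>K e. compact K \<and> 0 < e \<and> (\<forall>\<psi>\<in>dual_ball \<xi> K e. P \<psi>))"
proof
  assume "eventually P (nhds \<xi>)"
  then obtain S where "open S" "\<xi> \<in> S" "\<forall>x\<in>S. P x" by (auto simp: eventually_nhds)
  moreover from this obtain K e where "compact K" "0 < e" "dual_ball \<xi> K e \<subseteq> S"
    unfolding open_dual_def by blast
  ultimately show "\<exists>K e. compact K \<and> 0 < e \<and> (\<forall>\<psi>\<in>dual_ball \<xi> K e. P \<psi>)"
    by blast
next
  assume "\<exists>K e. compact K \<and> 0 < e \<and> (\<forall>\<psi>\<in>dual_ball \<xi> K e. P \<psi>)"
  then obtain K e where "compact K" "0 < e" "\<forall>\<psi>\<in>dual_ball \<xi> K e. P \<psi>" by blast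
  moreover have "\<xi> \<in> dual_ball \<xi> K e" using \<open>0 < e\<close> by (simp add: dual_ball_def)
  ultimately show "eventually P (nhds \<xi>)"
    unfolding eventually_nhds using open_dual_ball by blast
qed

lemma tendsto_dual_iff:
  "(f \<longlongrightarrow> \<xi>) F \<longleftrightarrow>
     (\<forall>K e. compact K \<longrightarrow> 0 < e \<longrightarrow> (\<forall>\<^sub>F y in F. f y \<in> dual_ball \<xi> K e))"
proof
  assume L: "(f \<longlongrightarrow> \<xi>) F"
  show "\<forall>K e. compact K \<longrightarrow> 0 < e \<longrightarrow> (\<forall>\<^sub>F y in F. f y \<in> dual_ball \<xi> K e)"
  proof (intro allI impI)
    fix K :: "'b set" and e :: real assume "compact K" "0 < e"
    then show "\<forall>\<^sub>F y in F. f y \<in> dual_ball \<xi> K e"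
      by (intro topological_tendstoD[OF L] open_dual_ball) (auto simp: dual_ball_def)
  qed
next
  assume R: "\<forall>K e. compact K \<longrightarrow> 0 < e \<longrightarrow> (\<forall>\<^sub>F y in F. f y \<in> dual_ball \<xi> K e)"
  show "(f \<longlongrightarrow> \<xi>) F"
  proof (rule topological_tendstoI)
    fix S assume "open S" "\<xi> \<in> S"
    then obtain K e where "compact K" "0 < e" "dual_ball \<xi> K e \<subseteq> S"
      unfolding open_dual_def by blast
    moreover from this R have "\<forall>\<^sub>F y in F. f y \<in> dual_ball \<xi> K e" by blast
    ultimately show "\<forall>\<^sub>F y in F. f y \<in> S" by (auto elim: eventually_mono)
  qed
qed

instance dual :: (topological_ab_group_add) topological_ab_group_add
proof
  fix \<xi> \<psi> :: "'a dual"
  show "LIM p (nhds \<xi> \<times>\<^sub>F nhds \<psi>). fst p + snd p :> nhds (\<xi> + \<psi>)"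
    unfolding tendsto_dual_iff
  proof (intro allI impI)
    fix K :: "'a set" and e :: real assume K: "compact K" and e: "0 < e"
    have A: "\<forall>\<^sub>F a in nhds \<xi>. a \<in> dual_ball \<xi> K (e/2)"
      and B: "\<forall>\<^sub>F b in nhds \<psi>. b \<in> dual_ball \<psi> K (e/2)"
      using K e by (auto simp: eventually_nhds_dual intro!: exI[of _ K] exI[of _ "e/2"])
    show "\<forall>\<^sub>F p in nhds \<xi> \<times>\<^sub>F nhds \<psi>. fst p + snd p \<in> dual_ball (\<xi> + \<psi>) K e"
      using eventually_prodI[OF A B]
    proof eventually_elim
      case (elim p)
      show ?case unfolding dual_ball_def
      proof safe
        fix x assume x: "x \<in> K"
        let ?a = "eval_char (fst p) x" and ?b = "eval_char (snd p) x"
        let ?c = "eval_char \<xi> x" and ?d = "eval_char \<psi> x"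
        have "cmod (?a * ?b - ?c * ?d) = cmod ((?a - ?c) * ?b + ?c * (?b - ?d))"
          by (simp add: algebra_simps)
        also have "\<dots> \<le> cmod ((?a - ?c) * ?b) + cmod (?c * (?b - ?d))" by (rule norm_triangle_ineq)
        also have "\<dots> < e" using elim x by (simp add: norm_mult dual_ball_def) (smt (verit) field_sum_of_halves)
        finally show "cmod (eval_char (fst p + snd p) x - eval_char (\<xi> + \<psi>) x) < e"
          by (simp add: plus_dual.rep_eq)
      qed
    qed
  qed
next
  fix \<xi> :: "'a dual"
  have *: "cmod (cnj a - cnj b) = cmod (a - b)" for a b
    by (metis complex_cnj_diff complex_mod_cnj)
  show "(uminus \<longlongrightarrow> - \<xi>) (nhds \<xi>)"
    unfolding tendsto_dual_iff eventually_nhds_dual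
    by (auto simp: dual_ball_def uminus_dual.rep_eq *)
qed

instance dual :: (topological_ab_group_add) t2_space
proof
  fix \<xi> \<psi> :: "'a dual" assume "\<xi> \<noteq> \<psi>"
  then obtain x where x: "eval_char \<xi> x \<noteq> eval_char \<psi> x" by (metis eval_char_inject ext)
  define e where "e = cmod (eval_char \<xi> x - eval_char \<psi> x) / 2"
  have e: "0 < e" using x by (simp add: e_def)
  have "dual_ball \<xi> {x} e \<inter> dual_ball \<psi> {x} e = {}"
  proof (safe, simp)
    fix \<rho> assume "\<rho> \<in> dual_ball \<xi> {x} e" "\<rho> \<in> dual_ball \<psi> {x} e"
    then have "dist (eval_char \<rho> x) (eval_char \<xi> x) < e" "dist (eval_char \<rho> x) (eval_char \<psi> x) < e"
      by (auto simp: dual_ball_def dist_norm)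
    then show False
      using dist_triangle3[of "eval_char \<xi> x" "eval_char \<psi> x" "eval_char \<rho> x"]
      by (simp add: e_def dist_norm)
  qed
  moreover have "open (dual_ball \<xi> {x} e)" "open (dual_ball \<psi> {x} e)"
    by (simp_all add: open_dual_ball)
  moreover have "\<xi> \<in> dual_ball \<xi> {x} e" "\<psi> \<in> dual_ball \<psi> {x} e"
    using e by (simp_all add: dual_ball_def)
  ultimately show "\<exists>U V. open U \<and> open V \<and> \<xi> \<in> U \<and> \<psi> \<in> V \<and> U \<inter> V = {}"
    by blast
qed

definition sigma_compact :: "'a::topological_space set \<Rightarrow> bool" where
  "sigma_compact S \<longleftrightarrow> (\<exists>K :: nat \<Rightarrow> 'a set. (\<forall>n. compact (K n)) \<and> (\<Union>n. K n) = S)"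

text \<open>
  The regularity conditions are part of the notion because the group need not be second countable;
  inner regularity is only required on open sets because the dual group need not be
  \<open>\<sigma>\<close>-compact.
\<close>

definition haar_measure :: "'a::topological_ab_group_add measure \<Rightarrow> bool" where
  "haar_measure M \<longleftrightarrow>
     sets M = sets borel \<and>
     emeasure M UNIV \<noteq> 0 \<and>
     (\<forall>K. compact K \<longrightarrow> emeasure M K < \<infinity>) \<and>
     (\<forall>a. \<forall>A\<in>sets borel. emeasure M ((+) a ` A) = emeasure M A) \<and>
     (\<forall>A\<in>sets borel. emeasure M A = (INF U\<in>{U. open U \<and> A \<subseteq> U}. emeasure M U)) \<and>
     (\<forall>U. open U \<longrightarrow> emeasure M U = (SUP K\<in>{K. compact K \<and> K \<subseteq> U}. emeasure M K))"

definition L2 :: "'a measure \<Rightarrow> ('a \<Rightarrow> complex) set" where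
  "L2 M = {f \<in> borel_measurable M. integrable M (\<lambda>x. (cmod (f x))\<^sup>2)}"

definition L2_inner :: "'a measure \<Rightarrow> ('a \<Rightarrow> complex) \<Rightarrow> ('a \<Rightarrow> complex) \<Rightarrow> complex" where
  "L2_inner M f g = (LINT x|M. f x * cnj (g x))"

definition L2_norm :: "'a measure \<Rightarrow> ('a \<Rightarrow> complex) \<Rightarrow> real" where
  "L2_norm M f = sqrt (LINT x|M. (cmod (f x))\<^sup>2)"

definition fourier :: "'a::topological_ab_group_add measure \<Rightarrow> ('a \<Rightarrow> complex) \<Rightarrow> 'a dual \<Rightarrow> complex" where
  "fourier \<mu> f \<xi> = (LINT x|\<mu>. f x * cnj (eval_char \<xi> x))"

text \<open>
  The isometry condition is imposed on the dense subspace \<open>L\<^sup>1 \<inter> L\<^sup>2\<close>, where the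
  transform is given by the integral. Surjectivity of the extension is not assumed.
\<close>

definition fourier_isometry ::
    "'a::topological_ab_group_add measure \<Rightarrow> 'a dual measure \<Rightarrow> bool" where
  "fourier_isometry \<mu> \<nu> \<longleftrightarrow>
     (\<forall>f \<in> L2 \<mu>. integrable \<mu> f \<longrightarrow>
        fourier \<mu> f \<in> L2 \<nu> \<and> L2_norm \<nu> (fourier \<mu> f) = L2_norm \<mu> f)"

text \<open>
  \<open>has_fourier_L2 \<mu> \<nu> f F\<close> says that \<open>F\<close> represents the transform of \<open>f\<close> under the extension
  by continuity to all of \<open>L\<^sup>2\<close>; it determines \<open>F\<close> up to a null set.
\<close>

definition has_fourier_L2 ::
    "'a::topological_ab_group_add measure \<Rightarrow> 'a dual measure \<Rightarrow> ('a \<Rightarrow> complex) \<Rightarrow> ('a dual \<Rightarrow> complex) \<Rightarrow> bool" where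
  "has_fourier_L2 \<mu> \<nu> f F \<longleftrightarrow>
     f \<in> L2 \<mu> \<and> F \<in> L2 \<nu> \<and>
     (\<exists>h :: nat \<Rightarrow> 'a \<Rightarrow> complex.
        (\<forall>n. h n \<in> L2 \<mu> \<and> integrable \<mu> (h n) \<and> fourier \<mu> (h n) \<in> L2 \<nu>) \<and>
        (\<lambda>n. L2_norm \<mu> (\<lambda>x. h n x - f x)) \<longlonglongrightarrow> 0 \<and>
        (\<lambda>n. L2_norm \<nu> (\<lambda>\<xi>. fourier \<mu> (h n) \<xi> - F \<xi>)) \<longlonglongrightarrow> 0)"

definition add_subgroup :: "'a::ab_group_add set \<Rightarrow> bool" where
  "add_subgroup S \<longleftrightarrow> 0 \<in> S \<and> (\<forall>x\<in>S. \<forall>y\<in>S. x + y \<in> S) \<and> (\<forall>x\<in>S. - x \<in> S)"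

definition coset_of :: "'a::ab_group_add set \<Rightarrow> 'a \<Rightarrow> 'a set" where
  "coset_of S x = (+) x ` S"

definition quotient_group_topology :: "'a::topological_ab_group_add set \<Rightarrow> 'a set topology" where
  "quotient_group_topology S = topology (\<lambda>U. U \<subseteq> range (coset_of S) \<and> open (coset_of S -` U))"

lemma openin_quotient_group_topology:
  "openin (quotient_group_topology S) U \<longleftrightarrow> U \<subseteq> range (coset_of S) \<and> open (coset_of S -` U)"
proof -
  have "istopology (\<lambda>U. U \<subseteq> range (coset_of S) \<and> open (coset_of S -` U))"
    unfolding istopology_def by (auto simp: vimage_Union)
  then show ?thesis by (simp add: quotient_group_topology_def)
qed

lemma topspace_quotient_group_topology [simp]:
  "topspace (quotient_group_topology S) = range (coset_of S)"
proof (rule antisym)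
  have "coset_of S -` range (coset_of S) = UNIV" by auto
  then have "openin (quotient_group_topology S) (range (coset_of S))"
    by (simp add: openin_quotient_group_topology)
  then show "range (coset_of S) \<subseteq> topspace (quotient_group_topology S)"
    by (rule openin_subset)
  show "topspace (quotient_group_topology S) \<subseteq> range (coset_of S)"
    unfolding topspace_def openin_quotient_group_topology by blast
qed

lemma quotient_map_coset_of: "quotient_map euclidean (quotient_group_topology S) (coset_of S)"
  by (auto simp: quotient_map_def openin_quotient_group_topology vimage_def)

definition cocompact :: "'a::topological_ab_group_add set \<Rightarrow> bool" where
  "cocompact S \<longleftrightarrow> compact_space (quotient_group_topology S)"

definition fundamental_domain :: "'a::ab_group_add measure \<Rightarrow> 'a set \<Rightarrow> 'a set \<Rightarrow> bool" where
  "fundamental_domain \<nu> \<Lambda> D \<longleftrightarrow>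
     (AE \<xi> in \<nu>. \<xi> \<in> (\<Union>l\<in>\<Lambda>. (+) l ` D)) \<and>
     (\<forall>l\<in>\<Lambda>. \<forall>m\<in>\<Lambda>. l \<noteq> m \<longrightarrow> (+) l ` D \<inter> (+) m ` D \<in> null_sets \<nu>)"

definition annihilator :: "'a::topological_ab_group_add dual set \<Rightarrow> 'a set" where
  "annihilator \<Lambda> = {x. \<forall>\<xi>\<in>\<Lambda>. eval_char \<xi> x = 1}"

text \<open>Functions, not classes modulo null sets: each element is the continuous representative.\<close>

definition band_space ::
    "'a::topological_ab_group_add measure \<Rightarrow> 'a dual measure \<Rightarrow> 'a dual set \<Rightarrow> ('a \<Rightarrow> complex) set" where
  "band_space \<mu> \<nu> D =
     {f. \<exists>F. has_fourier_L2 \<mu> \<nu> f F \<and> (AE \<xi> in \<nu>. \<xi> \<notin> D \<longrightarrow> F \<xi> = 0) \<and>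
             (\<forall>x. f x = (LINT \<xi>:D|\<nu>. F \<xi> * eval_char \<xi> x))}"

definition band_kernel ::
    "'a::topological_ab_group_add dual measure \<Rightarrow> 'a dual set \<Rightarrow> 'a \<Rightarrow> complex" where
  "band_kernel \<nu> D x = (LINT \<xi>:D|\<nu>. eval_char \<xi> x)"

definition is_orthonormal_basis ::
    "'a measure \<Rightarrow> ('a \<Rightarrow> complex) set \<Rightarrow> 'i set \<Rightarrow> ('i \<Rightarrow> 'a \<Rightarrow> complex) \<Rightarrow> bool" where
  "is_orthonormal_basis M H I e \<longleftrightarrow>
     (\<forall>i\<in>I. e i \<in> H) \<and>
     (\<forall>i\<in>I. \<forall>j\<in>I. L2_inner M (e i) (e j) = (if i = j then 1 else 0)) \<and>
     (\<forall>f\<in>H. \<forall>\<epsilon>>0. \<exists>S c. finite S \<and> S \<subseteq> I \<and>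
         L2_norm M (\<lambda>x. f x - (\<Sum>i\<in>S. c i * e i x)) < \<epsilon>)"

end

theory Submission
  imports Defs
begin

text \<open>
  On the transform side translation by \<open>l\<close> becomes multiplication by a character, so the functions
  \<open>\<phi>\<^sub>l\<close> correspond to \<open>1\<^sub>D\<close> times the characters of the quotient of the dual by \<open>\<Lambda>\<close> that come from
  \<open>L\<close>, and the sampling series is the Fourier expansion of \<open>f\<close> on \<open>D\<close>, whose coefficients are the
  values \<open>f l\<close>. Convergence in \<open>L\<^sup>2\<close> on the compact set \<open>D\<close> gives uniform convergence of the series.

  Only the isometry on \<open>L\<^sup>1 \<inter> L\<^sup>2\<close> is given, so three facts from duality theory are needed: functions
  supported on a compact set are transforms, characters separate points, and \<open>L\<close> has annihilator \<open>\<Lambda>\<close>.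
  Surjectivity, the double annihilator and completeness in \<open>L\<^sup>2\<close> of \<open>D\<close> all come from one principle:
  for \<open>\<phi>\<close> in \<open>L\<^sup>2\<close>, a set that is saturated for the equivalence relation defined by a group of
  characters has an indicator which, times \<open>\<phi>\<close>, is a limit of trigonometric polynomials times \<open>\<phi>\<close>.
\<close>

subsection \<open>Square-integrable functions\<close>

text \<open>Neither group is assumed second countable, and \<Lambda> may be uncountable. Overlaps of
  translates of \<open>D\<close> are null only pair by pair, so no union over all pairs may be
  formed. Compactness of \<open>D\<close> and discreteness of \<Lambda> leave finitely many relevant
  translates near a compact set, and every sum over \<Lambda> is cut down to these. The duality
  facts build on each other. Separation of points of \<open>G\<close> is injectivity of the
  isometry: a translation that no character notices would not change any transform. The image of the
  transform is stable under trigonometric polynomials, hence in the limit under restriction to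
  measurable sets, and this produces functions with prescribed compactly supported transform. Such a
  function is the \<phi> in the proof of the double annihilator, and the double annihilator is what
  separates points of \<open>D\<close> in the proof of completeness. In its three uses the
  approximation principle therefore reads: points of \<open>G\<close> separate all characters, so
  every measurable set is saturated; \<Lambda> separates cosets of \<open>L\<close>; and
  \<open>L\<close> separates cosets of \<Lambda>, of which \<open>D\<close> contains two distinct
  representatives only on a null set.\<close>

lemma borel_measurable_cnj [measurable]:
  "f \<in> borel_measurable M \<Longrightarrow> (\<lambda>x. cnj (f x)) \<in> borel_measurable M"
  by (rule measurable_compose[of f _ borel])
    (auto intro!: borel_measurable_continuous_onI continuous_intros)

lemma L2_measurable: "f \<in> L2 M \<Longrightarrow> f \<in> borel_measurable M"
  and L2_integrable: "f \<in> L2 M \<Longrightarrow> integrable M (\<lambda>x. (cmod (f x))\<^sup>2)"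
  by (simp_all add: L2_def)

lemma L2_I:
  "f \<in> borel_measurable M \<Longrightarrow> integrable M (\<lambda>x. (cmod (f x))\<^sup>2) \<Longrightarrow> f \<in> L2 M"
  by (simp add: L2_def)

lemma L2_dominated:
  assumes "f \<in> L2 M" "g \<in> borel_measurable M" "AE x in M. cmod (g x) \<le> C * cmod (f x)"
  shows "g \<in> L2 M"
proof (rule L2_I)
  note [measurable] = assms(2)
  show "integrable M (\<lambda>x. (cmod (g x))\<^sup>2)"
  proof (rule Bochner_Integration.integrable_bound)
    show "integrable M (\<lambda>x. C\<^sup>2 * (cmod (f x))\<^sup>2)" using L2_integrable[OF assms(1)] by simp
    show "AE x in M. norm ((cmod (g x))\<^sup>2) \<le> norm (C\<^sup>2 * (cmod (f x))\<^sup>2)"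
      using assms(3)
    proof eventually_elim
      case (elim x)
      then have "(cmod (g x))\<^sup>2 \<le> (C * cmod (f x))\<^sup>2" by (intro power_mono) auto
      then show ?case by (simp add: power_mult_distrib)
    qed
  qed measurable
qed fact

lemma L2_mult_bounded:
  assumes "f \<in> L2 M" "b \<in> borel_measurable M" "\<And>x. cmod (b x) \<le> C"
  shows "(\<lambda>x. b x * f x) \<in> L2 M"
proof (rule L2_dominated[OF assms(1)])
  note [measurable] = L2_measurable[OF assms(1)] assms(2)
  show "(\<lambda>x. b x * f x) \<in> borel_measurable M" by measurable
  show "AE x in M. cmod (b x * f x) \<le> C * cmod (f x)"
    using assms(3) by (simp add: norm_mult mult_right_mono)
qed

lemma L2_mult_integrable:
  assumes "f \<in> L2 M" "g \<in> L2 M"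
  shows "integrable M (\<lambda>x. f x * cnj (g x))"
proof (rule Bochner_Integration.integrable_bound)
  note [measurable] = assms[THEN L2_measurable]
  show "integrable M (\<lambda>x. (cmod (f x))\<^sup>2 + (cmod (g x))\<^sup>2)"
    using assms[THEN L2_integrable] by simp
  have "a * b \<le> a\<^sup>2 + b\<^sup>2" for a b :: real
    using zero_le_power2[of "a - b"] zero_le_power2[of a] zero_le_power2[of b]
    unfolding power2_diff by linarith
  then show "AE x in M. norm (f x * cnj (g x)) \<le> norm ((cmod (f x))\<^sup>2 + (cmod (g x))\<^sup>2)"
    by (auto simp: norm_mult)
  show "(\<lambda>x. f x * cnj (g x)) \<in> borel_measurable M" by measurable
qed

lemma L2_zero [simp]: "(\<lambda>x. 0) \<in> L2 M"
  by (simp add: L2_def)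

lemma L2_add:
  assumes "f \<in> L2 M" "g \<in> L2 M"
  shows "(\<lambda>x. f x + g x) \<in> L2 M"
proof (rule L2_I)
  note [measurable] = assms[THEN L2_measurable]
  show "(\<lambda>x. f x + g x) \<in> borel_measurable M" by measurable
  show "integrable M (\<lambda>x. (cmod (f x + g x))\<^sup>2)"
  proof (rule Bochner_Integration.integrable_bound)
    show "integrable M (\<lambda>x. 2 * (cmod (f x))\<^sup>2 + 2 * (cmod (g x))\<^sup>2)"
      using assms[THEN L2_integrable] by simp
    have "(cmod (a + b))\<^sup>2 \<le> 2 * (cmod a)\<^sup>2 + 2 * (cmod b)\<^sup>2" for a b
    proof -
      have "(cmod (a + b))\<^sup>2 \<le> (cmod a + cmod b)\<^sup>2" by (intro power_mono norm_triangle_ineq) auto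
      then show ?thesis using zero_le_power2[of "cmod a - cmod b"]
        unfolding power2_diff power2_sum by linarith
    qed
    then show "AE x in M. norm ((cmod (f x + g x))\<^sup>2) \<le> norm (2 * (cmod (f x))\<^sup>2 + 2 * (cmod (g x))\<^sup>2)"
      by (auto)
  qed measurable
qed

lemma L2_scale: "f \<in> L2 M \<Longrightarrow> (\<lambda>x. c * f x) \<in> L2 M"
  by (auto simp: L2_def norm_mult power_mult_distrib)

lemma L2_diff: "f \<in> L2 M \<Longrightarrow> g \<in> L2 M \<Longrightarrow> (\<lambda>x. f x - g x) \<in> L2 M"
  using L2_add[of f M "\<lambda>x. (-1) * g x"] L2_scale[of g M "-1"] by simp

lemma L2_sum: "(\<And>i. i \<in> S \<Longrightarrow> f i \<in> L2 M) \<Longrightarrow> (\<lambda>x. \<Sum>i\<in>S. f i x) \<in> L2 M"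
  by (induction S rule: infinite_finite_induct) (simp_all add: L2_add)

lemma L2_indicator:
  assumes "A \<in> sets M" "emeasure M A < \<infinity>"
  shows "(indicator A :: 'a \<Rightarrow> complex) \<in> L2 M"
proof (rule L2_I)
  have "(\<lambda>x. (cmod (indicator A x))\<^sup>2) = (indicator A :: 'a \<Rightarrow> real)"
    by (auto simp: indicator_def)
  then show "integrable M (\<lambda>x. (cmod (indicator A x))\<^sup>2)"
    using assms by simp
qed (use assms in auto)

lemma L2_norm_nonneg [simp]: "0 \<le> L2_norm M f"
  by (simp add: L2_norm_def)

lemma L2_norm_square: "(L2_norm M f)\<^sup>2 = (LINT x|M. (cmod (f x))\<^sup>2)"
  by (simp add: L2_norm_def)

lemma L2_inner_self: "L2_inner M f f = complex_of_real ((L2_norm M f)\<^sup>2)"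
  unfolding L2_norm_square L2_inner_def integral_complex_of_real[symmetric]
  by (simp only: complex_norm_square)

lemma L2_norm_mono:
  assumes "g \<in> L2 M" "f \<in> borel_measurable M" "AE x in M. cmod (f x) \<le> cmod (g x)"
  shows "L2_norm M f \<le> L2_norm M g"
proof -
  have f: "f \<in> L2 M" using L2_dominated[of g M f 1] assms by simp
  have "AE x in M. (cmod (f x))\<^sup>2 \<le> (cmod (g x))\<^sup>2"
    using assms(3) by eventually_elim (simp add: power_mono)
  then show ?thesis unfolding L2_norm_def
    by (intro real_sqrt_le_mono integral_mono_AE L2_integrable f assms)
qed

lemma L2_norm_scale: "L2_norm M (\<lambda>x. c * f x) = cmod c * L2_norm M f"
  by (simp add: L2_norm_def norm_mult power_mult_distrib real_sqrt_mult)

lemma L2_norm_minus_commute: "L2_norm M (\<lambda>x. f x - g x) = L2_norm M (\<lambda>x. g x - f x)"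
  by (simp add: L2_norm_def norm_minus_commute)

lemma L2_inner_add_left:
  "f \<in> L2 M \<Longrightarrow> g \<in> L2 M \<Longrightarrow> h \<in> L2 M \<Longrightarrow>
    L2_inner M (\<lambda>x. f x + g x) h = L2_inner M f h + L2_inner M g h"
  by (simp add: L2_inner_def distrib_right L2_mult_integrable)

lemma L2_inner_diff_left:
  "f \<in> L2 M \<Longrightarrow> g \<in> L2 M \<Longrightarrow> h \<in> L2 M \<Longrightarrow>
    L2_inner M (\<lambda>x. f x - g x) h = L2_inner M f h - L2_inner M g h"
  by (simp add: L2_inner_def left_diff_distrib L2_mult_integrable)

lemma L2_inner_scale_left: "L2_inner M (\<lambda>x. c * f x) h = c * L2_inner M f h"
  by (simp add: L2_inner_def mult.assoc)

lemma L2_inner_commute: "L2_inner M g f = cnj (L2_inner M f g)"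
  unfolding L2_inner_def
  by (subst Bochner_Integration.integral_cnj[symmetric]) (simp only: complex_cnj_mult complex_cnj_cnj mult.commute)

lemma L2_inner_scale_right: "L2_inner M f (\<lambda>x. c * g x) = cnj c * L2_inner M f g"
  using L2_inner_commute[of M f "\<lambda>x. c * g x"] L2_inner_commute[of M f g]
  by (simp add: L2_inner_scale_left)

lemma L2_inner_sum_left:
  assumes "\<And>i. i \<in> S \<Longrightarrow> f i \<in> L2 M" "h \<in> L2 M"
  shows "L2_inner M (\<lambda>x. \<Sum>i\<in>S. f i x) h = (\<Sum>i\<in>S. L2_inner M (f i) h)"
  using assms
proof (induction S rule: infinite_finite_induct)
  case (insert i S)
  then show ?case using L2_inner_add_left[of "f i" M "\<lambda>x. \<Sum>i\<in>S. f i x" h] L2_sum[of S f M] by simp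
qed (simp_all add: L2_inner_def)

lemma L2_norm_add_square:
  assumes "f \<in> L2 M" "g \<in> L2 M"
  shows "(L2_norm M (\<lambda>x. f x + g x))\<^sup>2 = (L2_norm M f)\<^sup>2 + (L2_norm M g)\<^sup>2 + 2 * Re (L2_inner M f g)"
proof -
  define r where "r x = Re (f x * cnj (g x))" for x
  have "(cmod (f x + g x))\<^sup>2 = (cmod (f x))\<^sup>2 + (cmod (g x))\<^sup>2 + 2 * r x" for x
    by (simp add: r_def cmod_power2 power2_sum algebra_simps)
  moreover have "integrable M r"
    unfolding r_def using L2_mult_integrable[OF assms] by (rule integrable_Re)
  moreover have "Re (L2_inner M f g) = (LINT x|M. r x)"
    unfolding L2_inner_def r_def by (rule integral_Re[symmetric, OF L2_mult_integrable[OF assms]])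
  ultimately show ?thesis
    using assms[THEN L2_integrable] by (simp only: L2_norm_square) simp
qed

lemma L2_Cauchy_Schwarz:
  assumes f: "f \<in> L2 M" and g: "g \<in> L2 M"
  shows "cmod (L2_inner M f g) \<le> L2_norm M f * L2_norm M g"
proof -
  define a where "a = (L2_norm M g)\<^sup>2"
  define z where "z = L2_inner M f g"
  have eq: "(L2_norm M (\<lambda>x. f x + c * g x))\<^sup>2 =
      (L2_norm M f)\<^sup>2 + (cmod c)\<^sup>2 * a + 2 * Re (cnj c * z)" for c
    using L2_norm_add_square[OF f L2_scale[OF g, of c]]
    by (simp add: L2_norm_scale L2_inner_scale_right power_mult_distrib a_def z_def)
  have "(cmod z)\<^sup>2 \<le> (L2_norm M f)\<^sup>2 * a"
  proof (cases "a = 0")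
    case True
    have "z = 0"
    proof (rule ccontr)
      assume z: "z \<noteq> 0"
      \<comment> \<open>With \<open>a = 0\<close> the square of the norm is affine in
        \<open>t\<close>; this value makes it -1. The case has to be treated because elements of
        \<open>L2\<close> are functions, so norm zero does not mean zero.\<close>
      define t where "t = ((L2_norm M f)\<^sup>2 + 1) / (2 * (cmod z)\<^sup>2)"
      have "Re (cnj (- complex_of_real t * z) * z) = - t * (cmod z)\<^sup>2"
        by (simp add: cmod_power2) (simp add: power2_eq_square algebra_simps)
      then have "(L2_norm M (\<lambda>x. f x + (- complex_of_real t * z) * g x))\<^sup>2 =
          (L2_norm M f)\<^sup>2 - 2 * t * (cmod z)\<^sup>2"
        unfolding eq True by simp
      also have "\<dots> < 0" using z by (simp add: t_def)
      finally show False by (simp add: not_less)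
    qed
    then show ?thesis by (simp add: True)
  next
    case False
    then have a: "a > 0" by (simp add: a_def less_le)
    \<comment> \<open>The minimiser of the quadratic in \<open>c\<close>: subtracting the projection
      of \<open>f\<close> to the line through \<open>g\<close>.\<close>
    define c where "c = - z / complex_of_real a"
    have "cnj c * z = - complex_of_real ((cmod z)\<^sup>2) / complex_of_real a"
      unfolding c_def complex_norm_square by (simp add: mult.commute)
    then have 1: "Re (cnj c * z) = - (cmod z)\<^sup>2 / a"
      by (simp add: of_real_divide[symmetric] del: of_real_divide of_real_power)
    have 2: "(cmod c)\<^sup>2 * a = (cmod z)\<^sup>2 / a"
      using a by (simp add: c_def norm_divide power_divide power2_eq_square)
    have "0 \<le> (L2_norm M (\<lambda>x. f x + c * g x))\<^sup>2" by simp
    then have "0 \<le> (L2_norm M f)\<^sup>2 - (cmod z)\<^sup>2 / a"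
      unfolding eq 1 2 by simp
    then show ?thesis using a by (simp add: field_simps)
  qed
  then have "(cmod z)\<^sup>2 \<le> (L2_norm M f * L2_norm M g)\<^sup>2"
    by (simp add: a_def power_mult_distrib)
  then show ?thesis unfolding z_def[symmetric]
    by (rule power2_le_imp_le) simp
qed

lemma L2_norm_triangle:
  assumes f: "f \<in> L2 M" and g: "g \<in> L2 M"
  shows "L2_norm M (\<lambda>x. f x + g x) \<le> L2_norm M f + L2_norm M g"
proof -
  have "Re (L2_inner M f g) \<le> L2_norm M f * L2_norm M g"
    using L2_Cauchy_Schwarz[OF f g] complex_Re_le_cmod order_trans by blast
  then have "(L2_norm M (\<lambda>x. f x + g x))\<^sup>2 \<le> (L2_norm M f + L2_norm M g)\<^sup>2"
    unfolding L2_norm_add_square[OF f g] power2_sum by simp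
  then show ?thesis by (rule power2_le_imp_le) simp
qed

lemma L2_norm_dist_triangle:
  assumes "f \<in> L2 M" "g \<in> L2 M" "h \<in> L2 M"
  shows "L2_norm M (\<lambda>x. f x - h x) \<le> L2_norm M (\<lambda>x. f x - g x) + L2_norm M (\<lambda>x. g x - h x)"
  using L2_norm_triangle[OF L2_diff[OF assms(1,2)] L2_diff[OF assms(2,3)]] by simp

lemma L2_norm_diff_ge:
  assumes "f \<in> L2 M" "g \<in> L2 M"
  shows "\<bar>L2_norm M f - L2_norm M g\<bar> \<le> L2_norm M (\<lambda>x. f x - g x)"
  using L2_norm_triangle[OF L2_diff[OF assms] assms(2)]
    L2_norm_triangle[OF L2_diff[OF assms(2,1)] assms(1)]
  by (simp add: L2_norm_minus_commute[of M g f])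

text \<open>On a set of finite measure square integrability implies integrability, by pairing with
  the indicator. This lets functions with compact support be transformed by the integral
  itself.\<close>

lemma L2_integrable_bounded_support:
  assumes f: "f \<in> L2 M" and A: "A \<in> sets M" "emeasure M A < \<infinity>" and "AE x in M. x \<notin> A \<longrightarrow> f x = 0"
  shows "integrable M f"
proof -
  have "integrable M (\<lambda>x. f x * cnj (indicator A x))"
    by (rule L2_mult_integrable[OF f L2_indicator[OF A]])
  then show ?thesis
  proof (rule integrable_cong_AE_imp)
    show "AE x in M. f x * cnj (indicator A x) = f x"
      using assms(4) by eventually_elim (auto simp: indicator_def)
  qed (rule L2_measurable[OF f])
qed

lemma L2_norm_indicator:
  assumes "A \<in> sets M"
  shows "L2_norm M (indicator A) = sqrt (measure M A)"
proof -
  have "(\<lambda>x. (cmod (indicator A x))\<^sup>2) = (indicator A :: 'a \<Rightarrow> real)"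
    by (auto simp: indicator_def)
  then show ?thesis using sets.sets_into_space[OF assms]
    by (simp add: L2_norm_def Int_absorb2)
qed

lemma L2_norm_diff_indicator_le:
  assumes "f \<in> borel_measurable M" "g \<in> borel_measurable M"
    and A: "A \<in> sets M" "emeasure M A < \<infinity>" and e: "0 \<le> e"
    and 1: "\<And>x. x \<in> A \<Longrightarrow> cmod (f x - g x) \<le> e" and 2: "\<And>x. x \<notin> A \<Longrightarrow> f x = g x"
  shows "L2_norm M (\<lambda>x. f x - g x) \<le> e * sqrt (measure M A)"
proof -
  have "L2_norm M (\<lambda>x. f x - g x) \<le> L2_norm M (\<lambda>x. of_real e * indicator A x)"
    using 1 2 assms(1,2) e
    by (intro L2_norm_mono L2_scale L2_indicator A) (auto simp: indicator_def)
  also have "\<dots> = e * L2_norm M (indicator A)"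
    using e by (simp add: L2_norm_scale)
  also have "L2_norm M (indicator A) = sqrt (measure M A)" by (rule L2_norm_indicator[OF A(1)])
  finally show ?thesis .
qed

subsection \<open>Haar measures\<close>

lemma
  assumes "haar_measure M"
  shows haar_sets: "sets M = sets borel"
    and haar_nonzero: "emeasure M UNIV \<noteq> 0"
    and haar_compact_finite: "compact K \<Longrightarrow> emeasure M K < \<infinity>"
    and haar_emeasure_translate: "A \<in> sets M \<Longrightarrow> emeasure M ((+) a ` A) = emeasure M A"
    and haar_outer: "A \<in> sets M \<Longrightarrow> emeasure M A = (INF U\<in>{U. open U \<and> A \<subseteq> U}. emeasure M U)"
    and haar_inner_open: "open U \<Longrightarrow> emeasure M U = (SUP K\<in>{K. compact K \<and> K \<subseteq> U}. emeasure M K)"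
proof -
  note * = assms[unfolded haar_measure_def]
  show 1: "sets M = sets borel" by (rule *[THEN conjunct1])
  show "emeasure M UNIV \<noteq> 0" by (rule *[THEN conjunct2, THEN conjunct1])
  show "compact K \<Longrightarrow> emeasure M K < \<infinity>"
    by (rule *[THEN conjunct2, THEN conjunct2, THEN conjunct1, rule_format])
  show "A \<in> sets M \<Longrightarrow> emeasure M ((+) a ` A) = emeasure M A"
    unfolding 1
    by (rule *[THEN conjunct2, THEN conjunct2, THEN conjunct2, THEN conjunct1, rule_format])
  show "A \<in> sets M \<Longrightarrow> emeasure M A = (INF U\<in>{U. open U \<and> A \<subseteq> U}. emeasure M U)"
    unfolding 1
    by (rule *[THEN conjunct2, THEN conjunct2, THEN conjunct2, THEN conjunct2, THEN conjunct1, rule_format])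
  show "open U \<Longrightarrow> emeasure M U = (SUP K\<in>{K. compact K \<and> K \<subseteq> U}. emeasure M K)"
    by (rule *[THEN conjunct2, THEN conjunct2, THEN conjunct2, THEN conjunct2, THEN conjunct2, rule_format])
qed

lemma haar_space: "haar_measure M \<Longrightarrow> space M = UNIV"
  using sets_eq_imp_space_eq[OF haar_sets] by auto

lemma translate_image_eq_vimage: "(+) a ` A = (+) (- a) -` A" for a :: "'g::ab_group_add"
proof safe
  fix x assume "- a + x \<in> A"
  then have "a + (- a + x) \<in> (+) a ` A" by blast
  then show "x \<in> (+) a ` A" by (simp add: algebra_simps)
qed simp

lemma open_translate:
  fixes U :: "'g::topological_ab_group_add set"
  shows "open U \<Longrightarrow> open ((+) a ` U)"
  unfolding translate_image_eq_vimage by (intro open_vimage continuous_intros)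

lemma compact_sets_haar:
  fixes M :: "'g::{topological_ab_group_add,t2_space} measure"
  shows "haar_measure M \<Longrightarrow> compact K \<Longrightarrow> K \<in> sets M"
  by (simp add: haar_sets borel_closed compact_imp_closed)

lemma borel_measurable_haar:
  assumes "haar_measure M" "continuous_on UNIV f"
  shows "f \<in> borel_measurable M"
  using borel_measurable_continuous_onI[OF assms(2)] haar_sets[OF assms(1)]
  by (simp cong: measurable_cong_sets)

lemma measurable_translate_haar:
  fixes M :: "'g::{topological_ab_group_add,t2_space} measure"
  assumes "haar_measure M"
  shows "(+) a \<in> measurable M M"
proof -
  have "(+) a \<in> measurable borel borel"
    by (intro borel_measurable_continuous_onI continuous_intros)
  then show ?thesis using haar_sets[OF assms] by (simp cong: measurable_cong_sets)
qed

lemma distr_translate_haar: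
  fixes M :: "'g::{topological_ab_group_add,t2_space} measure"
  assumes M: "haar_measure M"
  shows "distr M M ((+) a) = M"
proof (rule measure_eqI)
  fix A assume "A \<in> sets (distr M M ((+) a))"
  then have A: "A \<in> sets M" by simp
  have "(+) a -` A = (+) (- a) ` A" unfolding translate_image_eq_vimage by simp
  then have "emeasure (distr M M ((+) a)) A = emeasure M ((+) (- a) ` A)"
    using A by (simp add: emeasure_distr measurable_translate_haar[OF M] haar_space[OF M])
  then show "emeasure (distr M M ((+) a)) A = emeasure M A"
    using haar_emeasure_translate[OF M A] by metis
qed simp

lemma
  fixes M :: "'g::{topological_ab_group_add,t2_space} measure"
    and f :: "'g \<Rightarrow> 'b::{banach, second_countable_topology}"
  assumes M: "haar_measure M" and f: "f \<in> borel_measurable M"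
  shows haar_integral_translate: "(LINT x|M. f (a + x)) = integral\<^sup>L M f"
    and haar_integrable_translate: "integrable M (\<lambda>x. f (a + x)) \<longleftrightarrow> integrable M f"
  using integral_distr[OF measurable_translate_haar[OF M] f, of a]
    integrable_distr_eq[OF measurable_translate_haar[OF M] f, of a]
  by (simp_all add: distr_translate_haar[OF M])

lemma haar_borel_measurable_translate:
  fixes M :: "'g::{topological_ab_group_add,t2_space} measure"
  assumes M: "haar_measure M" and f: "f \<in> borel_measurable M"
  shows "(\<lambda>x. f (a + x)) \<in> borel_measurable M"
  using measurable_compose[OF measurable_translate_haar[OF M] f] .

lemma haar_nontrivial:
  assumes M: "haar_measure M"
  shows "\<exists>K. compact K \<and> emeasure M K \<noteq> 0"
proof (rule ccontr)
  assume "\<nexists>K. compact K \<and> emeasure M K \<noteq> 0"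
  then have "(SUP K\<in>{K. compact K \<and> K \<subseteq> UNIV}. emeasure M K) = (SUP K\<in>{K. compact K \<and> K \<subseteq> (UNIV :: 'a set)}. 0)"
    by (intro SUP_cong) auto
  moreover have "emeasure M UNIV = (SUP K\<in>{K. compact K \<and> K \<subseteq> UNIV}. emeasure M K)"
    by (rule haar_inner_open[OF M open_UNIV])
  moreover have "(SUP K\<in>{K. compact K \<and> K \<subseteq> (UNIV :: 'a set)}. (0::ennreal)) = 0"
    by (intro SUP_eqI) auto
  ultimately show False using haar_nonzero[OF M] by metis
qed

text \<open>Finitely many translates of a nonempty open set cover any compact set, so a null open
  set would make all compact sets null.\<close>

lemma haar_open_pos:
  fixes M :: "'g::{topological_ab_group_add,t2_space} measure"
  assumes M: "haar_measure M" and U: "open U" "U \<noteq> {}"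
  shows "emeasure M U > 0"
proof (rule ccontr)
  assume "\<not> emeasure M U > 0"
  then have 0: "U \<in> null_sets M"
    using U haar_sets[OF M] by (auto simp: null_sets_def)
  obtain K where K: "compact K" "emeasure M K \<noteq> 0" using haar_nontrivial[OF M] by blast
  obtain u where u: "u \<in> U" using U by blast
  have "K \<subseteq> (\<Union>a\<in>K. (+) (a - u) ` U)" using u by force
  then obtain F where F: "F \<subseteq> K" "finite F" "K \<subseteq> (\<Union>a\<in>F. (+) (a - u) ` U)"
    using compactE_image[OF K(1), of K "\<lambda>a. (+) (a - u) ` U"] open_translate[OF U(1)] by blast
  have "(+) a ` U \<in> null_sets M" for a
    using 0 haar_emeasure_translate[OF M, of U a] open_translate[OF U(1), of a] haar_sets[OF M]
    by (auto simp: null_sets_def)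
  then have "(\<Union>a\<in>F. (+) (a - u) ` U) \<in> null_sets M"
    using F(2) by (intro null_sets_UN' countable_finite) auto
  then have "K \<in> null_sets M"
    using F(3) compact_sets_haar[OF M K(1)] null_sets_subset by blast
  then show False using K by auto
qed

section \<open>Inner regularity of Haar measures\<close>

text \<open>Inner regularity on open sets is carried over to sets of finite measure: take a compact
  set inside an open superset \<open>U\<close> of \<open>A\<close> and remove from it an open
  \<open>W\<close> that covers \<open>U - A\<close> tightly. What is lost lies in
  \<open>U - K1\<close> or in \<open>A \<inter> W\<close>, each of measure below
  \<open>e / 2\<close>.\<close>

lemma haar_inner_regular:
  fixes M :: "'g::{topological_ab_group_add,t2_space} measure"
  assumes M: "haar_measure M" and A: "A \<in> fmeasurable M" and e: "0 < e"
  shows "\<exists>K. compact K \<and> K \<subseteq> A \<and> measure M (A - K) < e"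
proof -
  note [simp] = haar_sets[OF M]
  have fm: "B \<in> fmeasurable M" if "B \<in> sets borel" "B \<subseteq> C" "C \<in> fmeasurable M" for B C
    using that by (auto intro: fmeasurableI2)
  have outer: "\<exists>U\<in>fmeasurable M. open U \<and> B \<subseteq> U \<and> measure M U < measure M B + d"
    if B: "B \<in> fmeasurable M" and d: "0 < d" for B d
  proof -
    have "emeasure M B < ennreal (measure M B + d)"
      using B d by (simp add: emeasure_eq_measure2)
    then obtain U where U: "open U" "B \<subseteq> U" "emeasure M U < ennreal (measure M B + d)"
      using haar_outer[OF M fmeasurableD[OF B]] by (auto simp: INF_less_iff)
    then have "U \<in> fmeasurable M"
      by (intro fmeasurableI) (auto simp: less_top[symmetric] top_unique)
    then show ?thesis using U by (auto simp: emeasure_eq_measure2 ennreal_less_iff)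
  qed
  define d where "d = e / 2"
  have d: "0 < d" using e by (simp add: d_def)
  obtain U where U: "U \<in> fmeasurable M" "open U" "A \<subseteq> U"
    using outer[OF A d] by blast
  obtain K1 where K1: "compact K1" "K1 \<subseteq> U" "measure M U < measure M K1 + d"
  \<comment> \<open>If the difference were negative, \<open>ennreal\<close> would truncate it to 0
    and the strict inequality could fail for a null \<open>U\<close>; the empty set serves
    instead.\<close>
  proof (cases "measure M U < d")
    case True
    then show ?thesis by (intro that[of "{}"]) auto
  next
    case False
    have "ennreal (measure M U - d) < emeasure M U"
      using False U(1) d by (simp add: emeasure_eq_measure2 ennreal_less_iff)
    then obtain K1 where K1: "compact K1" "K1 \<subseteq> U" "ennreal (measure M U - d) < emeasure M K1"
      using haar_inner_open[OF M U(2)] by (auto simp: less_SUP_iff)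
    have "K1 \<in> fmeasurable M"
      using K1 U(1) compact_sets_haar[OF M K1(1)] by (auto intro: fm[of K1 U])
    then have "measure M U - d < measure M K1"
      using K1(3) False by (simp add: emeasure_eq_measure2 ennreal_less_iff)
    then show ?thesis using K1 that by simp
  qed
  have K1f: "K1 \<in> fmeasurable M"
    using K1 U(1) compact_sets_haar[OF M K1(1)] by (auto intro: fm[of K1 U])
  have UA: "U - A \<in> fmeasurable M" using A U by (intro fmeasurable_Diff) auto
  obtain W where W: "W \<in> fmeasurable M" "open W" "U - A \<subseteq> W" "measure M W < measure M (U - A) + d"
    using outer[OF UA d] by blast
  define K where "K = K1 - W"
  have [simp]: "A \<in> sets borel" "U \<in> sets borel" "W \<in> sets borel" "K1 \<in> sets borel"
    using A U(1) W(1) K1f by (auto dest: fmeasurableD)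
  have 1: "measure M (U - K1) < d"
    using K1 U K1f by (subst measure_Diff) (auto simp: fmeasurable_def)
  have "measure M (A \<inter> W) + measure M (U - A) = measure M (A \<inter> W \<union> (U - A))"
  proof -
    have "A \<inter> W \<inter> (U - A) = {}" by blast
    moreover have "A \<inter> W \<in> fmeasurable M" using A W by (intro fmeasurable_Int_fmeasurable) auto
    ultimately show ?thesis using measure_Un3[of "A \<inter> W" M "U - A"] UA by simp
  qed
  also have "\<dots> \<le> measure M W"
    using A W UA by (intro measure_mono_fmeasurable sets.Un sets.Int sets.Diff) auto
  finally have 2: "measure M (A \<inter> W) < d" using W(4) by simp
  have "measure M (A - K) \<le> measure M ((U - K1) \<union> (A \<inter> W))"
    using A W U K1f by (intro measure_mono_fmeasurable fmeasurable.Un fmeasurable_Diff fmeasurable_Int_fmeasurable sets.Diff) (auto simp: K_def)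
  also have "\<dots> \<le> measure M (U - K1) + measure M (A \<inter> W)"
    using A W U K1f by (intro measure_Un_le) auto
  also have "\<dots> < e" using 1 2 by (simp add: d_def)
  finally have "measure M (A - K) < e" .
  moreover have "compact K" unfolding K_def using K1(1) W(2) by (rule compact_diff)
  moreover have "K \<subseteq> A" using K1 W by (auto simp: K_def)
  ultimately show ?thesis by blast
qed

text \<open>Inner regularity for the finite measure with density \<open>|\<phi>|^2\<close>, on sets
  that may have infinite Haar measure. It reduces to sets of finite Haar measure because the level
  bands of the density exhaust its mass.\<close>

lemma haar_inner_regular_L2:
  fixes M :: "'g::{topological_ab_group_add,t2_space} measure"
  assumes M: "haar_measure M" and A: "A \<in> sets M" and \<phi>: "\<phi> \<in> L2 M" and e: "0 < e"
  shows "\<exists>K. compact K \<and> K \<subseteq> A \<and> L2_norm M (\<lambda>x. indicator (A - K) x * \<phi> x) < e"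
proof -
  note [measurable] = A L2_measurable[OF \<phi>]
  define h where "h x = (cmod (\<phi> x))\<^sup>2" for x
  have h: "integrable M h" "\<And>x. 0 \<le> h x" using L2_integrable[OF \<phi>] by (simp_all add: h_def[abs_def])
  have [measurable]: "h \<in> borel_measurable M" using h by auto
  \<comment> \<open>The lower bound makes the band of finite measure, the upper bound turns small
    measure into small mass.\<close>
  define B where "B n = {x \<in> space M. x \<in> A \<and> 1 / real (Suc n) \<le> h x \<and> h x \<le> real (Suc n)}" for n
  have [measurable]: "B n \<in> sets M" for n unfolding B_def by measurable
  have "(\<lambda>n. LINT x|M. indicator (A - B n) x * h x) \<longlonglongrightarrow> (LINT x|M. 0)"
  proof (rule integral_dominated_convergence[where w=h])
    show "AE x in M. (\<lambda>n. indicator (A - B n) x * h x) \<longlonglongrightarrow> 0"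
    proof (rule AE_I2)
      fix x assume x: "x \<in> space M"
      show "(\<lambda>n. indicator (A - B n) x * h x) \<longlonglongrightarrow> 0"
      proof (cases "x \<in> A \<and> h x \<noteq> 0")
        case False
        then have "(\<lambda>n. indicator (A - B n) x * h x) = (\<lambda>n. 0)" by (auto simp: fun_eq_iff)
        then show ?thesis by simp
      next
        case True
        then have pos: "h x > 0" using h(2)[of x] by (simp add: less_le)
        have "eventually (\<lambda>n. 1 / h x \<le> real (Suc n) \<and> h x \<le> real (Suc n)) sequentially"
          using eventually_ge_at_top[of "nat \<lceil>max (1 / h x) (h x)\<rceil>"]
          by eventually_elim linarith
        then have "eventually (\<lambda>n. indicator (A - B n) x * h x = 0) sequentially"
        proof eventually_elim
          case (elim n)
          then have "x \<in> B n" using True pos x by (auto simp: B_def field_simps)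
          then show ?case by simp
        qed
        then show ?thesis by (rule tendsto_eventually)
      qed
    qed
    show "AE x in M. norm (indicator (A - B n) x * h x) \<le> h x" for n
      using h(2) by (auto simp: indicator_def)
  qed (use h in auto)
  then have "eventually (\<lambda>n. (LINT x|M. indicator (A - B n) x * h x) < e\<^sup>2 / 2) sequentially"
    using e by (intro order_tendstoD) auto
  then obtain n where n: "(LINT x|M. indicator (A - B n) x * h x) < e\<^sup>2 / 2"
    by (meson eventually_sequentially order_refl)
  have "integrable M (indicator (B n) :: _ \<Rightarrow> real)"
  proof (rule Bochner_Integration.integrable_bound)
    show "integrable M (\<lambda>x. real (Suc n) * h x)" using h by simp
    show "AE x in M. norm (indicator (B n) x :: real) \<le> norm (real (Suc n) * h x)"
      using h(2) by (auto simp: indicator_def B_def field_simps)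
  qed measurable
  then have Bf: "B n \<in> fmeasurable M"
    by (simp add: integrable_indicator_iff fmeasurable_def)
  \<comment> \<open>The factor \<open>Suc n\<close> cancels the upper bound of the density on
    \<open>B n\<close>; half of \<open>e^2\<close> remains for the mass outside the band.\<close>
  obtain K where K: "compact K" "K \<subseteq> B n" "measure M (B n - K) < e\<^sup>2 / (2 * real (Suc n))"
    using haar_inner_regular[OF M Bf, of "e\<^sup>2 / (2 * real (Suc n))"] e by auto
  have [measurable]: "K \<in> sets M" by (rule compact_sets_haar[OF M K(1)])
  have Kf: "B n - K \<in> fmeasurable M" using Bf by (intro fmeasurable_Diff) auto
  have "(L2_norm M (\<lambda>x. indicator (A - K) x * \<phi> x))\<^sup>2 = (LINT x|M. indicator (A - K) x * h x)"
    unfolding L2_norm_square h_def by (intro Bochner_Integration.integral_cong) (auto simp: indicator_def)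
  also have "\<dots> \<le> (LINT x|M. indicator (A - B n) x * h x + real (Suc n) * indicator (B n - K) x)"
  proof (rule integral_mono)
    show "integrable M (\<lambda>x. indicator (A - K) x * h x)"
      by (rule Bochner_Integration.integrable_bound[OF h(1)]) (use h(2) in \<open>auto simp: indicator_def\<close>)
    have "integrable M (\<lambda>x. indicator (A - B n) x * h x)"
      by (rule Bochner_Integration.integrable_bound[OF h(1)]) (use h(2) in \<open>auto simp: indicator_def\<close>)
    then show "integrable M (\<lambda>x. indicator (A - B n) x * h x + real (Suc n) * indicator (B n - K) x)"
      using Kf by (auto simp: fmeasurable_def)
    show "indicator (A - K) x * h x \<le> indicator (A - B n) x * h x + real (Suc n) * indicator (B n - K) x"
      for x using K(2) h(2)[of x] by (auto simp: indicator_def B_def)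
  qed
  also have "\<dots> = (LINT x|M. indicator (A - B n) x * h x) + real (Suc n) * measure M (B n - K)"
  proof -
    have "integrable M (\<lambda>x. indicator (A - B n) x * h x)"
      by (rule Bochner_Integration.integrable_bound[OF h(1)]) (use h(2) in \<open>auto simp: indicator_def\<close>)
    then show ?thesis using Kf by (simp add: fmeasurable_def haar_space[OF M])
  qed
  also have "\<dots> < e\<^sup>2 / 2 + e\<^sup>2 / 2"
    using n K(3) by (intro add_strict_mono) (simp_all add: field_simps)
  finally have "L2_norm M (\<lambda>x. indicator (A - K) x * \<phi> x) < e"
    using e by (simp add: power2_less_imp_less)
  moreover have "K \<subseteq> A" using K(2) by (auto simp: B_def)
  ultimately show ?thesis using K(1) by blast
qed

subsection \<open>Trigonometric polynomials\<close>

text \<open>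
  Families of unimodular characters indexed by a group are used in both directions: points of the
  group evaluated on the dual, and characters evaluated on the group.
\<close>

definition char_family :: "'i::ab_group_add set \<Rightarrow> ('i \<Rightarrow> 'g::topological_space \<Rightarrow> complex) \<Rightarrow> bool" where
  "char_family I e \<longleftrightarrow> add_subgroup I \<and>
     (\<forall>i\<in>I. continuous_on UNIV (e i) \<and> (\<forall>x. cmod (e i x) = 1)) \<and>
     (\<forall>i\<in>I. \<forall>j\<in>I. \<forall>x. e (i + j) x = e i x * e j x)"

text \<open>Generated by adding one term at a time, with repeated frequencies allowed, so closure
  properties go by induction without collecting coefficients. \<open>trig_span_sum\<close> recovers
  a finite sum over distinct frequencies.\<close>

inductive_set trig_span :: "'i set \<Rightarrow> ('i \<Rightarrow> 'g \<Rightarrow> complex) \<Rightarrow> ('g \<Rightarrow> complex) set"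
  for I e where
  zero: "(\<lambda>x. 0) \<in> trig_span I e"
| step: "p \<in> trig_span I e \<Longrightarrow> i \<in> I \<Longrightarrow> (\<lambda>x. p x + c * e i x) \<in> trig_span I e"

lemma
  assumes "char_family I e"
  shows char_family_zero: "0 \<in> I" "e 0 x = 1"
    and char_family_add: "i \<in> I \<Longrightarrow> j \<in> I \<Longrightarrow> i + j \<in> I"
      "i \<in> I \<Longrightarrow> j \<in> I \<Longrightarrow> e (i + j) x = e i x * e j x"
    and char_family_uminus: "i \<in> I \<Longrightarrow> - i \<in> I" "i \<in> I \<Longrightarrow> e (- i) x = cnj (e i x)"
    and char_family_norm: "i \<in> I \<Longrightarrow> cmod (e i x) = 1"
    and char_family_cont: "i \<in> I \<Longrightarrow> continuous_on UNIV (e i)"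
proof -
  show 1: "0 \<in> I" and 2: "\<And>i j. i \<in> I \<Longrightarrow> j \<in> I \<Longrightarrow> i + j \<in> I" and 3: "\<And>i. i \<in> I \<Longrightarrow> - i \<in> I"
    and 4: "\<And>i j x. i \<in> I \<Longrightarrow> j \<in> I \<Longrightarrow> e (i + j) x = e i x * e j x"
    and 5: "\<And>i x. i \<in> I \<Longrightarrow> cmod (e i x) = 1"
    and "i \<in> I \<Longrightarrow> continuous_on UNIV (e i)" for i
    using assms unfolding char_family_def add_subgroup_def by blast+
  have ne: "e i x \<noteq> 0" if "i \<in> I" for i x using 5[OF that, of x] by auto
  show 6: "e 0 x = 1" for x using 4[OF 1 1, of x] ne[OF 1, of x] by simp
  show "e (- i) x = cnj (e i x)" if "i \<in> I" for i
  proof -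
    have "e i x * e (- i) x = 1" using 4[OF that 3[OF that], of x] 6 by simp
    moreover have "e i x * cnj (e i x) = 1"
      using 5[OF that, of x] by (simp add: complex_norm_square[symmetric])
    ultimately show ?thesis using ne[OF that, of x] by (metis mult_left_cancel)
  qed
qed

lemma trig_span_scale: "p \<in> trig_span I e \<Longrightarrow> (\<lambda>x. c * p x) \<in> trig_span I e"
proof (induction rule: trig_span.induct)
  case (step p i d)
  then show ?case using trig_span.step[OF step.IH step.hyps(2), of "c * d"]
    by (simp add: algebra_simps)
qed (simp add: trig_span.zero)

lemma trig_span_add:
  assumes "p \<in> trig_span I e" and "q \<in> trig_span I e"
  shows "(\<lambda>x. p x + q x) \<in> trig_span I e"
  using assms(2)
proof (induction rule: trig_span.induct)
  case (step q i d)
  then show ?case using trig_span.step[OF step.IH step.hyps(2), of d]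
    by (simp add: add.assoc)
qed (simp add: assms)

lemma trig_span_char: "i \<in> I \<Longrightarrow> (\<lambda>x. c * e i x) \<in> trig_span I e"
  using trig_span.step[OF trig_span.zero] by fastforce

lemma trig_span_mult:
  assumes e: "char_family I e" and p: "p \<in> trig_span I e" and q: "q \<in> trig_span I e"
  shows "(\<lambda>x. p x * q x) \<in> trig_span I e"
proof -
  have pe: "(\<lambda>x. p x * e i x) \<in> trig_span I e" if i: "i \<in> I" for i
    using p
  proof (induction rule: trig_span.induct)
    case (step p j d)
    have "(\<lambda>x. p x * e i x + d * e (j + i) x) \<in> trig_span I e"
      by (intro trig_span.step step.IH char_family_add[OF e] i step.hyps)
    then show ?case using char_family_add(2)[OF e step.hyps(2) i] by (simp add: algebra_simps)
  qed (simp add: trig_span.zero)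
  show ?thesis using q
  proof (induction rule: trig_span.induct)
    case (step q i d)
    then show ?case using trig_span_add[OF step.IH trig_span_scale[OF pe[OF step.hyps(2)], of d]]
      by (simp add: algebra_simps)
  qed (simp add: trig_span.zero)
qed

lemma trig_span_cont:
  assumes e: "char_family I e" and p: "p \<in> trig_span I e"
  shows "continuous_on UNIV p"
  using p
proof (induction rule: trig_span.induct)
  case (step p i c)
  then show ?case
    by (intro continuous_on_add continuous_on_mult continuous_on_const char_family_cont[OF e])
qed simp

lemma trig_span_bounded:
  assumes e: "char_family I e" and p: "p \<in> trig_span I e"
  shows "\<exists>B. \<forall>x. cmod (p x) \<le> B"
  using p
proof (induction rule: trig_span.induct)
  case (step p i c)
  then obtain B where "\<And>x. cmod (p x) \<le> B" by blast
  then have "cmod (p x + c * e i x) \<le> B + cmod c" for x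
    using norm_triangle_ineq[of "p x" "c * e i x"] char_family_norm[OF e step.hyps(2), of x]
    by (smt (verit) mult_cancel_left1 norm_mult)
  then show ?case by blast
qed auto

lemma trig_span_sum:
  assumes "p \<in> trig_span I e"
  shows "\<exists>S c. finite S \<and> S \<subseteq> I \<and> p = (\<lambda>x. \<Sum>i\<in>S. c i * e i x)"
  using assms
proof (induction rule: trig_span.induct)
  case (step p i d)
  then obtain S c where S: "finite S" "S \<subseteq> I" "p = (\<lambda>x. \<Sum>i\<in>S. c i * e i x)" by blast
  \<comment> \<open>If \<open>i\<close> already occurs in \<open>S\<close>, the new coefficient is
    added to the old one.\<close>
  define c' where "c' j = (if j \<in> S then c j else 0) + (if j = i then d else 0)" for j
  have "p x + d * e i x = (\<Sum>j\<in>insert i S. c' j * e j x)" for x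
  proof -
    have "(\<Sum>j\<in>insert i S. c' j * e j x) =
        (\<Sum>j\<in>insert i S. if j \<in> S then c j * e j x else 0) + (\<Sum>j\<in>insert i S. if j = i then d * e j x else 0)"
      unfolding sum.distrib[symmetric] by (intro sum.cong) (auto simp: c'_def distrib_right)
    also have "(\<Sum>j\<in>insert i S. if j = i then d * e j x else 0) = d * e i x"
      using S(1) by (simp add: sum.delta)
    also have "(\<Sum>j\<in>insert i S. if j \<in> S then c j * e j x else 0) = p x"
      unfolding S(3) using S(1) by (subst sum.inter_restrict[symmetric]) (auto simp: Int_absorb1 subset_insertI)
    finally show ?thesis by simp
  qed
  then show ?case using S step.hyps(2) by (intro exI[of _ "insert i S"] exI[of _ c']) auto
qed (auto intro!: exI[of _ "{}"])

text \<open>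
  The library makes function spaces Hausdorff only over countable index types. Its arities for the
  weaker separation classes have to be generalised first, or they conflict with the new one.
\<close>

instance "fun" :: (type, t0_space) t0_space
proof
  fix f g :: "'a \<Rightarrow> 'b" assume "f \<noteq> g"
  then obtain i where "f i \<noteq> g i" by blast
  from iffD1[OF separation_t0 this] obtain U where U: "open U" "\<not> (f i \<in> U \<longleftrightarrow> g i \<in> U)"
    by blast
  have c: "continuous_on UNIV (\<lambda>f :: 'a \<Rightarrow> 'b. f i)"
    by (rule continuous_on_product_coordinates)
  show "\<exists>U. open U \<and> \<not> (f \<in> U \<longleftrightarrow> g \<in> U)"
    using U open_vimage[OF U(1) c] by (intro exI[of _ "(\<lambda>f. f i) -` U"]) auto
qed

instance "fun" :: (type, t1_space) t1_space
proof
  fix f g :: "'a \<Rightarrow> 'b" assume "f \<noteq> g"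
  then obtain i where "f i \<noteq> g i" by blast
  then obtain U where U: "open U" "f i \<in> U" "g i \<notin> U"
    using t1_space[of "f i" "g i"] by metis
  have c: "continuous_on UNIV (\<lambda>f :: 'a \<Rightarrow> 'b. f i)"
    by (rule continuous_on_product_coordinates)
  show "\<exists>U. open U \<and> f \<in> U \<and> g \<notin> U"
    using U open_vimage[OF U(1) c] by (intro exI[of _ "(\<lambda>f. f i) -` U"]) auto
qed

instance "fun" :: (type, t2_space) t2_space
proof
  fix f g :: "'a \<Rightarrow> 'b" assume "f \<noteq> g"
  then obtain i where "f i \<noteq> g i" by blast
  then obtain U V where UV: "open U" "open V" "f i \<in> U" "g i \<in> V" "U \<inter> V = {}"
    using hausdorff[of "f i" "g i"] by metis
  have c: "continuous_on UNIV (\<lambda>f :: 'a \<Rightarrow> 'b. f i)"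
    by (rule continuous_on_product_coordinates)
  show "\<exists>U V. open U \<and> open V \<and> f \<in> U \<and> g \<in> V \<and> U \<inter> V = {}"
    using UV open_vimage[OF UV(1) c] open_vimage[OF UV(2) c]
    by (intro exI[of _ "(\<lambda>f. f i) -` U"] exI[of _ "(\<lambda>f. f i) -` V"]) auto
qed

text \<open>
  Mapping the space into a torus makes the bounds \<open>0 \<le> q \<le> 1\<close> hold globally and not only on a
  compact set: the torus is compact although the space is not.
\<close>

lemma trig_separation:
  fixes e :: "'i::ab_group_add \<Rightarrow> 'g::topological_space \<Rightarrow> complex"
  assumes e: "char_family I e" and K: "compact K" "compact K'"
    and sep: "\<And>x y. x \<in> K \<Longrightarrow> y \<in> K' \<Longrightarrow> \<exists>i\<in>I. e i x \<noteq> e i y"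
    and \<epsilon>: "0 < \<epsilon>" "\<epsilon> < 1"
  shows "\<exists>q :: 'g \<Rightarrow> real. (\<lambda>x. complex_of_real (q x)) \<in> trig_span I e \<and> (\<forall>x. 0 \<le> q x \<and> q x \<le> 1) \<and>
    (\<forall>x\<in>K. 1 - \<epsilon> < q x) \<and> (\<forall>x\<in>K'. q x < \<epsilon>)"
proof -
  \<comment> \<open>Coordinates outside \<open>I\<close> are frozen at 1, here and in
    \<open>T\<close>, so that distinct points of \<open>T\<close> differ at an index of
    \<open>I\<close>.\<close>
  define \<Theta> where "\<Theta> x i = (if i \<in> I then e i x else 1)" for x i
  define T where "T = (PiE UNIV (\<lambda>i. if i \<in> I then sphere 0 1 else {1}) :: ('i \<Rightarrow> complex) set)"
  \<comment> \<open>Functions on the torus whose pullback along \<Theta> is a trigonometric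
    polynomial: Stone-Weierstrass runs on \<open>T\<close> and its result is read back on the
    space.\<close>
  define R where "R = {f. continuous_on T f \<and> (\<lambda>x. complex_of_real (f (\<Theta> x))) \<in> trig_span I e}"
  have \<Theta>T: "\<Theta> x \<in> T" for x
    using char_family_norm[OF e] by (auto simp: T_def \<Theta>_def)
  have \<Theta>c: "continuous_on UNIV \<Theta>"
  proof (rule continuous_on_coordinatewise_then_product)
    show "continuous_on UNIV (\<lambda>x. \<Theta> x i)" for i
      by (cases "i \<in> I") (simp_all add: \<Theta>_def char_family_cont[OF e])
  qed
  interpret function_ring_on R T
  proof
    have "compactin (product_topology (\<lambda>i. euclidean) UNIV) T"
      unfolding T_def by (subst compactin_PiE) auto
    then show "compact T" by (simp add: euclidean_product_topology)
    show "continuous_on T f" if "f \<in> R" for f using that by (simp add: R_def)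
    show "(\<lambda>x. f x + g x) \<in> R" if "f \<in> R" "g \<in> R" for f g
      using that by (auto simp: R_def intro!: continuous_intros trig_span_add)
    show "(\<lambda>x. f x * g x) \<in> R" if "f \<in> R" "g \<in> R" for f g
      using that by (auto simp: R_def intro!: continuous_intros trig_span_mult[OF e])
    show "(\<lambda>_. c) \<in> R" for c
      using trig_span_char[where e=e, OF char_family_zero(1)[OF e], of "complex_of_real c"] char_family_zero(2)[OF e]
      by (simp add: R_def)
    show "\<exists>f\<in>R. f z \<noteq> f w" if zw: "z \<in> T" "w \<in> T" "z \<noteq> w" for z w
    proof -
      obtain i where i: "z i \<noteq> w i" using zw by blast
      then have I: "i \<in> I" using zw unfolding T_def PiE_iff by (metis UNIV_I singletonD)
      have cc: "continuous_on T (\<lambda>z. z i)"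
        by (rule continuous_on_subset[OF continuous_on_product_coordinates]) auto
      \<comment> \<open>The functions in \<open>R\<close> are real, so a character enters through
        its real and imaginary parts. These are trigonometric polynomials because the conjugate of
        \<open>e i\<close> is \<open>e (- i)\<close>.\<close>
      have "(\<lambda>x. (1/2) * e i x + (1/2) * e (- i) x) \<in> trig_span I e"
        by (intro trig_span_add trig_span_char I char_family_uminus[OF e])
      moreover have "complex_of_real (Re (\<Theta> x i)) = (1/2) * e i x + (1/2) * e (- i) x" for x
        using I char_family_uminus(2)[OF e I, of x] by (simp add: \<Theta>_def complex_eq_iff)
      ultimately have 1: "(\<lambda>z. Re (z i)) \<in> R"
        using cc by (auto simp: R_def intro!: continuous_intros)
      have "(\<lambda>x. (- \<i>/2) * e i x + (\<i>/2) * e (- i) x) \<in> trig_span I e"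
        by (intro trig_span_add trig_span_char I char_family_uminus[OF e])
      moreover have "complex_of_real (Im (\<Theta> x i)) = (- \<i>/2) * e i x + (\<i>/2) * e (- i) x" for x
        using I char_family_uminus(2)[OF e I, of x] by (simp add: \<Theta>_def complex_eq_iff)
      ultimately have 2: "(\<lambda>z. Im (z i)) \<in> R"
        using cc by (auto simp: R_def intro!: continuous_intros)
      from i have "Re (z i) \<noteq> Re (w i) \<or> Im (z i) \<noteq> Im (w i)" by (simp add: complex_eq_iff)
      then show ?thesis using bexI[OF _ 1, of "\<lambda>f. f z \<noteq> f w"] bexI[OF _ 2, of "\<lambda>f. f z \<noteq> f w"] by blast
    qed
  qed
  have cl: "closed (\<Theta> ` C)" if "compact C" for C
    using that by (intro compact_imp_closed compact_continuous_image continuous_on_subset[OF \<Theta>c]) auto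
  have "\<Theta> ` K' \<inter> \<Theta> ` K = {}"
  proof (safe, simp)
    fix x y assume xy: "x \<in> K'" "y \<in> K" "\<Theta> x = \<Theta> y"
    then obtain i where "i \<in> I" "e i y \<noteq> e i x" using sep by blast
    then show False using fun_cong[OF xy(3), of i] by (simp add: \<Theta>_def)
  qed
  \<comment> \<open>\<open>two\<close> is the Urysohn-type step in the proof of Stone-Weierstrass:
    values between 0 and 1, below \<epsilon> on the first closed set and above 1 - \<epsilon> on the
    second.\<close>
  then obtain f where f: "f \<in> R" "f ` T \<subseteq> {0..1}" "\<forall>x\<in>\<Theta> ` K'. f x < \<epsilon>" "\<forall>x\<in>\<Theta> ` K. f x > 1 - \<epsilon>"
    using two[of "\<Theta> ` K'" "\<Theta> ` K" \<epsilon>] cl K \<Theta>T \<epsilon> by (metis image_subsetI)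
  have "0 \<le> f (\<Theta> x) \<and> f (\<Theta> x) \<le> 1" for x using f(2) \<Theta>T[of x] by force
  then show ?thesis using f by (intro exI[of _ "\<lambda>x. f (\<Theta> x)"]) (auto simp: R_def)
qed

lemma trig_span_mult_L2:
  assumes M: "haar_measure M" and e: "char_family I e" and p: "p \<in> trig_span I e" and \<phi>: "\<phi> \<in> L2 M"
  shows "(\<lambda>x. p x * \<phi> x) \<in> L2 M"
  using trig_span_bounded[OF e p] L2_mult_bounded[OF \<phi> borel_measurable_haar[OF M trig_span_cont[OF e p]]]
  by blast

text \<open>Inner regularity of the mass of \<phi> replaces \<open>A \<inter> N\<close> and
  \<open>N - A\<close> by compact subsets, on which a separating polynomial is close to 1 and to 0.
  Outside them the bounds \<open>0 \<le> q \<le> 1\<close> keep the error below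
  \<open>|\<phi>|\<close>, and little mass is left there. Separation is demanded only on a set
  \<open>N\<close> that carries \<phi>, so exceptional null sets can be discarded.\<close>

lemma trig_approx_indicator:
  fixes M :: "'g::{topological_ab_group_add,t2_space} measure"
  assumes M: "haar_measure M" and \<phi>: "\<phi> \<in> L2 M" and e: "char_family I e"
    and A: "A \<in> sets M" and N: "N \<in> sets M" and \<phi>N: "AE x in M. \<phi> x \<noteq> 0 \<longrightarrow> x \<in> N"
    and sep: "\<And>x y. x \<in> A \<inter> N \<Longrightarrow> y \<in> N - A \<Longrightarrow> \<exists>i\<in>I. e i x \<noteq> e i y"
    and \<epsilon>: "0 < \<epsilon>"
  shows "\<exists>p\<in>trig_span I e. L2_norm M (\<lambda>x. p x * \<phi> x - indicator A x * \<phi> x) < \<epsilon>"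
proof -
  \<comment> \<open>Passing to the modulus makes the three error terms below nonnegative, so that
    their sum bounds pointwise without cancellation.\<close>
  define \<psi> where "\<psi> x = complex_of_real (cmod (\<phi> x))" for x
  note [measurable] = L2_measurable[OF \<phi>] A N
  have [measurable]: "\<psi> \<in> borel_measurable M" unfolding \<psi>_def by measurable
  have \<psi>: "\<psi> \<in> L2 M" by (rule L2_dominated[OF \<phi>, of _ 1]) (auto simp: \<psi>_def)
  obtain K where K: "compact K" "K \<subseteq> A \<inter> N"
      "L2_norm M (\<lambda>x. indicator (A \<inter> N - K) x * \<psi> x) < \<epsilon> / 4"
    using haar_inner_regular_L2[OF M _ \<psi>, of "A \<inter> N" "\<epsilon> / 4"] \<epsilon> by auto
  obtain K' where K': "compact K'" "K' \<subseteq> N - A"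
      "L2_norm M (\<lambda>x. indicator (N - A - K') x * \<psi> x) < \<epsilon> / 4"
    using haar_inner_regular_L2[OF M _ \<psi>, of "N - A" "\<epsilon> / 4"] \<epsilon> by auto
  note [measurable] = compact_sets_haar[OF M K(1)] compact_sets_haar[OF M K'(1)]
  define s where "s = L2_norm M \<psi> + 1"
  have s: "0 < s" "L2_norm M \<psi> \<le> s" using L2_norm_nonneg[of M \<psi>] by (auto simp: s_def simp del: L2_norm_nonneg)
  \<comment> \<open>The bound 1/2 satisfies the condition \<open>\<delta> < 1\<close> of
    \<open>trig_separation\<close>; the other one makes the uniform error at most \<epsilon>/4. The
    1 in \<open>s\<close> covers \<psi> of norm zero.\<close>
  define \<delta> where "\<delta> = min (1/2) (\<epsilon> / (4 * s))"
  have \<delta>: "0 < \<delta>" "\<delta> < 1" using \<epsilon> s by (auto simp: \<delta>_def)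
  have "\<delta> * L2_norm M \<psi> \<le> \<epsilon> / (4 * s) * s"
    using \<epsilon> s by (intro mult_mono) (auto simp: \<delta>_def)
  also have "\<dots> = \<epsilon> / 4" using s by simp
  finally have \<delta>\<psi>: "\<delta> * L2_norm M \<psi> \<le> \<epsilon> / 4" .
  obtain q :: "'g \<Rightarrow> real" where q: "(\<lambda>x. complex_of_real (q x)) \<in> trig_span I e"
      "\<And>x. 0 \<le> q x" "\<And>x. q x \<le> 1" "\<And>x. x \<in> K \<Longrightarrow> 1 - \<delta> < q x" "\<And>x. x \<in> K' \<Longrightarrow> q x < \<delta>"
  proof -
    have "\<exists>i\<in>I. e i x \<noteq> e i y" if "x \<in> K" "y \<in> K'" for x y
      using that K(2) K'(2) sep by blast
    from trig_separation[OF e K(1) K'(1) this \<delta>] show ?thesis using that by blast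
  qed
  define p where "p x = complex_of_real (q x)" for x
  have p: "p \<in> trig_span I e" using q(1) by (simp add: p_def[abs_def])
  define g1 g2 g3 where "g1 x = complex_of_real \<delta> * \<psi> x"
    and "g2 x = indicator (A \<inter> N - K) x * \<psi> x" and "g3 x = indicator (N - A - K') x * \<psi> x" for x
  have ind: "(\<lambda>x. indicator B x * \<psi> x) \<in> L2 M" if "B \<in> sets M" for B
    using that by (intro L2_mult_bounded[OF \<psi>, of _ 1]) (auto simp: indicator_def)
  have g: "g1 \<in> L2 M" "g2 \<in> L2 M" "g3 \<in> L2 M"
    unfolding g1_def g2_def g3_def by (auto intro!: L2_scale ind \<psi>)
  have pm: "(\<lambda>x. p x * \<phi> x) \<in> borel_measurable M"
    using trig_span_mult_L2[OF M e p \<phi>] by (rule L2_measurable)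
  have "L2_norm M (\<lambda>x. p x * \<phi> x - indicator A x * \<phi> x) \<le> L2_norm M (\<lambda>x. g1 x + (g2 x + g3 x))"
  proof (rule L2_norm_mono)
    show "(\<lambda>x. g1 x + (g2 x + g3 x)) \<in> L2 M" by (intro L2_add g)
    show "(\<lambda>x. p x * \<phi> x - indicator A x * \<phi> x) \<in> borel_measurable M"
      by (intro borel_measurable_diff pm) measurable
    show "AE x in M. cmod (p x * \<phi> x - indicator A x * \<phi> x) \<le> cmod (g1 x + (g2 x + g3 x))"
      using \<phi>N
    proof eventually_elim
      case (elim x)
      \<comment> \<open>A bound for the error of \<open>q\<close> on \<open>N\<close>: \<delta> on
        the two compact sets, and at least 1 on what they miss.\<close>
      define r where "r = \<delta> + (indicator (A \<inter> N - K) x + indicator (N - A - K') x)"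
      have "g1 x + (g2 x + g3 x) = complex_of_real (r * cmod (\<phi> x))"
        by (simp add: g1_def g2_def g3_def r_def \<psi>_def indicator_def algebra_simps)
      moreover have "0 \<le> r" using \<delta> by (simp add: r_def)
      ultimately have 1: "cmod (g1 x + (g2 x + g3 x)) = r * cmod (\<phi> x)" by (simp add: norm_mult)
      have 2: "cmod (p x * \<phi> x - indicator A x * \<phi> x) = \<bar>q x - indicator A x\<bar> * cmod (\<phi> x)"
      proof -
        have "p x * \<phi> x - indicator A x * \<phi> x = complex_of_real (q x - indicator A x) * \<phi> x"
          by (simp add: p_def indicator_def algebra_simps)
        then show ?thesis by (simp only: norm_mult norm_of_real)
      qed
      show ?case
      proof (cases "\<phi> x = 0")
        case False
        with elim have "x \<in> N" by simp
        then have "\<bar>q x - indicator A x\<bar> \<le> r"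
          using q(2)[of x] q(3)[of x] q(4)[of x] q(5)[of x] \<delta> K(2) K'(2)
          by (auto simp: r_def indicator_def)
        then show ?thesis unfolding 1 2 by (rule mult_right_mono) simp
      qed simp
    qed
  qed
  also have "\<dots> \<le> L2_norm M g1 + (L2_norm M g2 + L2_norm M g3)"
    using L2_norm_triangle[OF g(1) L2_add[OF g(2,3)]] L2_norm_triangle[OF g(2,3)] by simp
  also have "L2_norm M g1 \<le> \<epsilon> / 4"
    using \<delta>\<psi> \<delta> unfolding g1_def L2_norm_scale by simp
  also have "L2_norm M g2 < \<epsilon> / 4" using K(3) by (simp add: g2_def[abs_def])
  also have "L2_norm M g3 < \<epsilon> / 4" using K'(3) by (simp add: g3_def[abs_def])
  finally have "L2_norm M (\<lambda>x. p x * \<phi> x - indicator A x * \<phi> x) < \<epsilon>" using \<epsilon> by simp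
  then show ?thesis using p by blast
qed

subsection \<open>Characters and integrals over the dual\<close>

lemma cmod_integral_le:
  fixes f :: "'a \<Rightarrow> complex"
  assumes "integrable M f" "integrable M g" "\<And>x. cmod (f x) \<le> g x"
  shows "cmod (LINT x|M. f x) \<le> (LINT x|M. g x)"
proof -
  have "(LINT x|M. cmod (f x)) \<le> (LINT x|M. g x)"
    by (rule integral_mono) (use assms in auto)
  then show ?thesis using integral_norm_bound[of M f] by linarith
qed

lemma integral_indicator_complex:
  "(LINT x|M. (indicator A x :: complex)) = complex_of_real (measure M (A \<inter> space M))"
proof -
  have "(\<lambda>x. indicator A x :: complex) = (\<lambda>x. complex_of_real (indicator A x))"
    by (auto simp: indicator_def)
  then show ?thesis by simp
qed

lemma eval_char_zero [simp]: "eval_char \<xi> 0 = 1"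
proof -
  have "eval_char \<xi> 0 \<noteq> 0" using eval_char_norm[of \<xi> 0] by (metis norm_zero zero_neq_one)
  then show ?thesis using eval_char_add[of \<xi> 0 0] by simp
qed

lemma eval_char_mult_cnj [simp]:
  "eval_char \<xi> x * cnj (eval_char \<xi> x) = 1" "cnj (eval_char \<xi> x) * eval_char \<xi> x = 1"
proof -
  show 1: "eval_char \<xi> x * cnj (eval_char \<xi> x) = 1"
    unfolding complex_norm_square[symmetric] by simp
  show "cnj (eval_char \<xi> x) * eval_char \<xi> x = 1"
    by (rule trans[OF mult.commute 1])
qed

lemma eval_char_uminus: "eval_char \<xi> (- x) = cnj (eval_char \<xi> x)"
proof -
  have "eval_char \<xi> (- x) = cnj (eval_char \<xi> x) * (eval_char \<xi> x * eval_char \<xi> (- x))"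
    by (simp add: mult.assoc[symmetric])
  then show ?thesis by (simp add: eval_char_add[symmetric])
qed

lemma eval_char_diff: "eval_char \<xi> (x - y) = eval_char \<xi> x * cnj (eval_char \<xi> y)"
  using eval_char_add[of \<xi> x "- y"] by (simp add: eval_char_uminus)

lemma eval_char_dual_diff: "eval_char (\<xi> - \<psi>) x = eval_char \<xi> x * cnj (eval_char \<psi> x)"
  unfolding minus_dual_def plus_dual.rep_eq uminus_dual.rep_eq ..

lemma continuous_on_eval_char_dual:
  fixes x :: "'a::topological_ab_group_add"
  shows "continuous_on UNIV (\<lambda>\<xi>. eval_char \<xi> x)"
proof -
  have "((\<lambda>\<xi>. eval_char \<xi> x) \<longlongrightarrow> eval_char \<xi> x) (nhds \<xi>)" for \<xi>
  proof (rule tendstoI)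
    fix e :: real assume "0 < e"
    then show "\<forall>\<^sub>F \<psi> in nhds \<xi>. dist (eval_char \<psi> x) (eval_char \<xi> x) < e"
      unfolding eventually_nhds_dual
      by (intro exI[of _ "{x}"] exI[of _ e]) (auto simp: dual_ball_def dist_norm)
  qed
  then show ?thesis
    by (auto simp: continuous_on_def intro: tendsto_mono[OF at_within_le_nhds])
qed

lemma char_family_eval_char: "add_subgroup I \<Longrightarrow> char_family I eval_char"
  unfolding char_family_def by (simp add: plus_dual.rep_eq eval_char_cont)

lemma char_family_eval_point: "add_subgroup I \<Longrightarrow> char_family I (\<lambda>x \<xi>. eval_char \<xi> x)"
  unfolding char_family_def by (simp add: eval_char_add continuous_on_eval_char_dual)

lemma finite_disjoint_refinement:
  assumes "finite T" "\<And>t. t \<in> T \<Longrightarrow> U t \<in> sets M" "K \<in> sets M" "K \<subseteq> (\<Union>t\<in>T. U t)"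
  shows "\<exists>A. disjoint_family_on A T \<and> (\<forall>t\<in>T. A t \<in> sets M \<and> A t \<subseteq> U t) \<and> (\<Union>t\<in>T. A t) = K"
  using assms
proof (induction T arbitrary: K rule: finite_induct)
  case (insert s T)
  have "\<exists>A. disjoint_family_on A T \<and> (\<forall>t\<in>T. A t \<in> sets M \<and> A t \<subseteq> U t) \<and> (\<Union>t\<in>T. A t) = K - U s"
    by (rule insert.IH) (use insert.prems in auto)
  then obtain A where A: "disjoint_family_on A T" "\<And>t. t \<in> T \<Longrightarrow> A t \<in> sets M"
    "\<And>t. t \<in> T \<Longrightarrow> A t \<subseteq> U t" "(\<Union>t\<in>T. A t) = K - U s" by blast
  define B where "B t = (if t = s then K \<inter> U s else A t)" for t
  have BA: "B t = A t" if "t \<in> T" for t using that insert.hyps by (auto simp: B_def)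
  have "disjoint_family_on B (insert s T)"
    unfolding disjoint_family_on_def
  proof (intro ballI impI)
    fix m n assume mn: "m \<in> insert s T" "n \<in> insert s T" "m \<noteq> n"
    have *: "B s \<inter> B t = {}" if "t \<in> T" for t
      using A(4) BA[OF that] that by (auto simp: B_def)
    show "B m \<inter> B n = {}"
      using mn * BA A(1) unfolding disjoint_family_on_def by (metis Int_commute insertE)
  qed
  moreover have "\<forall>t\<in>insert s T. B t \<in> sets M \<and> B t \<subseteq> U t"
    using insert.prems A(2,3) BA by (auto simp: B_def)
  moreover have "(\<Union>t\<in>insert s T. B t) = K"
  proof -
    have "(\<Union>t\<in>T. B t) = (\<Union>t\<in>T. A t)" using BA by auto
    then show ?thesis using A(4) by (auto simp: B_def)
  qed
  ultimately show ?case by blast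
qed (simp add: disjoint_family_on_def)

text \<open>This is how the topology of the dual enters: on one piece all characters agree up to
  \<epsilon> on the whole of \<open>E\<close>. The pieces serve as cells of a quadrature and as
  supports of local units.\<close>

lemma dual_partition:
  fixes K :: "'a::{topological_ab_group_add,t2_space} dual set"
  assumes K: "compact K" and E: "compact E" and \<epsilon>: "0 < \<epsilon>"
  shows "\<exists>T A. finite T \<and> disjoint_family_on A T \<and>
    (\<forall>t\<in>T. A t \<in> sets borel \<and> A t \<subseteq> dual_ball t E \<epsilon>) \<and> (\<Union>t\<in>T. A t) = K"
proof -
  have "K \<subseteq> (\<Union>t\<in>K. dual_ball t E \<epsilon>)" using \<epsilon> by (auto simp: dual_ball_def)
  then obtain T where T: "T \<subseteq> K" "finite T" "K \<subseteq> (\<Union>t\<in>T. dual_ball t E \<epsilon>)"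
    using compactE_image[OF K, of K "\<lambda>t. dual_ball t E \<epsilon>"] open_dual_ball[OF E] by blast
  have "\<exists>A. disjoint_family_on A T \<and> (\<forall>t\<in>T. A t \<in> sets borel \<and> A t \<subseteq> dual_ball t E \<epsilon>) \<and> (\<Union>t\<in>T. A t) = K"
    by (rule finite_disjoint_refinement[OF T(2) _ _ T(3)])
      (use K open_dual_ball[OF E] in \<open>auto simp: compact_imp_closed borel_closed borel_open\<close>)
  then show ?thesis using T(2) by blast
qed

lemma sum_disjoint_indicator:
  fixes a :: "'i \<Rightarrow> complex"
  assumes "finite T" "disjoint_family_on A T" "t \<in> T" "x \<in> A t"
  shows "(\<Sum>s\<in>T. a s * indicator (A s) x) = a t"
proof -
  have "x \<notin> A s" if "s \<in> T" "s \<noteq> t" for s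
    using assms that unfolding disjoint_family_on_def by blast
  then have "(\<Sum>s\<in>T. a s * indicator (A s) x) = (\<Sum>s\<in>T. if s = t then a s else 0)"
    using assms(4) by (intro sum.cong) auto
  then show ?thesis using assms by simp
qed

text \<open>
  Joint continuity of \<open>(\<xi>, x) \<mapsto> \<xi> x\<close> does not give measurability for the product \<open>\<sigma>\<close>-algebra when
  the groups are not second countable. Replacing the integral over the dual by a finite quadrature
  that is uniform over a compact set avoids Fubini's theorem.
\<close>

lemma dual_quadrature:
  fixes \<nu> :: "'a::{topological_ab_group_add,t2_space} dual measure"
  assumes \<nu>: "haar_measure \<nu>" and F: "integrable \<nu> F" "\<And>\<xi>. \<xi> \<notin> K \<Longrightarrow> F \<xi> = 0"
    and K: "compact K" and E: "compact E" and \<epsilon>: "0 < \<epsilon>"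
  shows "\<exists>T c. finite T \<and> (\<forall>G B. G \<in> borel_measurable \<nu> \<longrightarrow>
      (\<forall>t. \<forall>\<xi>\<in>dual_ball t E \<epsilon>. cmod (G \<xi> - G t) \<le> B) \<longrightarrow>
      cmod ((LINT \<xi>|\<nu>. F \<xi> * G \<xi>) - (\<Sum>t\<in>T. c t * G t)) \<le> B * (LINT \<xi>|\<nu>. cmod (F \<xi>)))"
proof -
  note [measurable] = borel_measurable_integrable[OF F(1)]
  obtain T A where T: "finite T" and dis: "disjoint_family_on A T"
    and A: "\<And>t. t \<in> T \<Longrightarrow> A t \<in> sets borel" "\<And>t. t \<in> T \<Longrightarrow> A t \<subseteq> dual_ball t E \<epsilon>" "(\<Union>t\<in>T. A t) = K"
    using dual_partition[OF K E \<epsilon>] by metis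
  \<comment> \<open>Nodes and weights depend only on \<open>F\<close> and the partition, so one
    quadrature serves every integrand \<open>G\<close> of small oscillation.\<close>
  define c where "c t = (LINT \<xi>|\<nu>. F \<xi> * indicator (A t) \<xi>)" for t
  have FA: "integrable \<nu> (\<lambda>\<xi>. F \<xi> * indicator (A t) \<xi>)" if "t \<in> T" for t
  proof (rule Bochner_Integration.integrable_bound[OF F(1)])
    show "(\<lambda>\<xi>. F \<xi> * indicator (A t) \<xi>) \<in> borel_measurable \<nu>"
      using A(1)[OF that] haar_sets[OF \<nu>] by measurable
  qed (auto simp: indicator_def)
  have main: "cmod ((LINT \<xi>|\<nu>. F \<xi> * G \<xi>) - (\<Sum>t\<in>T. c t * G t)) \<le> B * (LINT \<xi>|\<nu>. cmod (F \<xi>))"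
    if [measurable]: "G \<in> borel_measurable \<nu>" and G: "\<forall>t. \<forall>\<xi>\<in>dual_ball t E \<epsilon>. cmod (G \<xi> - G t) \<le> B"
    for G B
  proof -
    \<comment> \<open>The step function that takes on each cell the value of \<open>G\<close> at its
      node; integrating it against \<open>F\<close> gives the quadrature sum.\<close>
    define S where "S \<xi> = (\<Sum>t\<in>T. G t * indicator (A t) \<xi>)" for \<xi>
    have GS: "cmod (G \<xi> - S \<xi>) \<le> B" if \<xi>: "\<xi> \<in> K" for \<xi>
    proof -
      obtain t where t: "t \<in> T" "\<xi> \<in> A t" using A(3) \<xi> by blast
      have "S \<xi> = G t" unfolding S_def by (rule sum_disjoint_indicator[OF T dis t])
      then show ?thesis using G A(2)[OF t(1)] t(2) by auto
    qed
    have FS: "F \<xi> * S \<xi> = (\<Sum>t\<in>T. G t * (F \<xi> * indicator (A t) \<xi>))" for \<xi>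
      by (simp add: S_def sum_distrib_left mult_ac)
    have iFS: "integrable \<nu> (\<lambda>\<xi>. F \<xi> * S \<xi>)"
      unfolding FS by (intro Bochner_Integration.integrable_sum integrable_mult_right) (use FA in auto)
    have [measurable]: "S \<in> borel_measurable \<nu>"
      unfolding S_def using A(1) haar_sets[OF \<nu>] by (intro borel_measurable_sum borel_measurable_times) auto
    have bnd: "cmod (F \<xi> * (G \<xi> - S \<xi>)) \<le> B * cmod (F \<xi>)" for \<xi>
      using mult_right_mono[OF GS norm_ge_zero[of "F \<xi>"]] F(2)[of \<xi>]
      by (cases "\<xi> \<in> K") (auto simp: norm_mult mult.commute)
    have iFD: "integrable \<nu> (\<lambda>\<xi>. F \<xi> * (G \<xi> - S \<xi>))"
    proof (rule Bochner_Integration.integrable_bound)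
      show "integrable \<nu> (\<lambda>\<xi>. B * cmod (F \<xi>))" using F(1) by auto
      show "AE \<xi> in \<nu>. norm (F \<xi> * (G \<xi> - S \<xi>)) \<le> norm (B * cmod (F \<xi>))"
        using order_trans[OF bnd abs_ge_self] by simp
    qed measurable
    have "integrable \<nu> (\<lambda>\<xi>. F \<xi> * (G \<xi> - S \<xi>) + F \<xi> * S \<xi>)"
      by (rule Bochner_Integration.integrable_add[OF iFD iFS])
    then have iFG: "integrable \<nu> (\<lambda>\<xi>. F \<xi> * G \<xi>)" by (simp add: algebra_simps)
    have "(\<Sum>t\<in>T. c t * G t) = (LINT \<xi>|\<nu>. F \<xi> * S \<xi>)"
      unfolding FS c_def using FA by (subst Bochner_Integration.integral_sum) (auto simp: mult.commute)
    then have "(LINT \<xi>|\<nu>. F \<xi> * G \<xi>) - (\<Sum>t\<in>T. c t * G t) = (LINT \<xi>|\<nu>. F \<xi> * (G \<xi> - S \<xi>))"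
      using Bochner_Integration.integral_diff[OF iFG iFS] by (simp add: right_diff_distrib)
    also have "cmod \<dots> \<le> (LINT \<xi>|\<nu>. B * cmod (F \<xi>))"
      by (rule cmod_integral_le[OF iFD]) (use F(1) bnd in auto)
    finally show ?thesis by simp
  qed
  show ?thesis
    by (intro exI[of _ T] exI[of _ c] conjI allI impI T) (rule main)
qed

lemma synthesis_bounded:
  shows "cmod (LINT \<xi>|\<nu>. F \<xi> * eval_char \<xi> x) \<le> (LINT \<xi>|\<nu>. cmod (F \<xi>))"
proof -
  have "(LINT \<xi>|\<nu>. cmod (F \<xi> * eval_char \<xi> x)) = (LINT \<xi>|\<nu>. cmod (F \<xi>))"
    by (simp add: norm_mult)
  then show ?thesis using integral_norm_bound[of \<nu> "\<lambda>\<xi>. F \<xi> * eval_char \<xi> x"] by linarith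
qed

lemma borel_measurable_eval_char_dual:
  "haar_measure \<nu> \<Longrightarrow> (\<lambda>\<xi>. eval_char \<xi> x) \<in> borel_measurable \<nu>"
  by (rule borel_measurable_haar[OF _ continuous_on_eval_char_dual])

text \<open>Evaluation at a point of a compact \<open>E\<close> oscillates by less than \<epsilon>
  on \<open>dual_ball t E \<epsilon>\<close>. Hence one quadrature approximates the integral
  uniformly on \<open>E\<close> by a finite combination of continuous characters, and local
  compactness turns this into continuity everywhere.\<close>

lemma synthesis_continuous:
  fixes \<nu> :: "'a::{topological_ab_group_add,t2_space} dual measure"
  assumes lc: "locally_compact_space (euclidean :: 'a topology)"
    and \<nu>: "haar_measure \<nu>" and F: "integrable \<nu> F" "\<And>\<xi>. \<xi> \<notin> K \<Longrightarrow> F \<xi> = 0" and K: "compact K"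
  shows "continuous_on UNIV (\<lambda>x. LINT \<xi>|\<nu>. F \<xi> * eval_char \<xi> x)"
proof -
  define f where "f x = (LINT \<xi>|\<nu>. F \<xi> * eval_char \<xi> x)" for x
  define n1 where "n1 = (LINT \<xi>|\<nu>. cmod (F \<xi>))"
  have n1: "0 \<le> n1" by (simp add: n1_def)
  have cE: "continuous_on E f" if E: "compact E" for E
  proof -
    have "\<exists>p. continuous_on E p \<and> (\<forall>x\<in>E. cmod (f x - p x) \<le> 1 / real (Suc n) * n1)" for n
    proof -
      have "0 < 1 / real (Suc n)" by simp
      from dual_quadrature[OF \<nu> F K E this]
      obtain T c where T: "finite T" and *: "\<And>G B. G \<in> borel_measurable \<nu> \<Longrightarrow>
        (\<forall>t. \<forall>\<xi>\<in>dual_ball t E (1 / real (Suc n)). cmod (G \<xi> - G t) \<le> B) \<Longrightarrow>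
        cmod ((LINT \<xi>|\<nu>. F \<xi> * G \<xi>) - (\<Sum>t\<in>T. c t * G t)) \<le> B * (LINT \<xi>|\<nu>. cmod (F \<xi>))"
        by blast
      have "cmod (f x - (\<Sum>t\<in>T. c t * eval_char t x)) \<le> 1 / real (Suc n) * n1" if "x \<in> E" for x
        unfolding f_def n1_def
        by (rule *[OF borel_measurable_eval_char_dual[OF \<nu>]]) (use that in \<open>auto simp: dual_ball_def less_imp_le\<close>)
      moreover have "continuous_on E (\<lambda>x. \<Sum>t\<in>T. c t * eval_char t x)"
        by (intro continuous_on_sum continuous_on_mult continuous_on_const continuous_on_subset[OF eval_char_cont]) auto
      ultimately show ?thesis by blast
    qed
    then obtain p where p: "\<And>n. continuous_on E (p n)"
      "\<And>n x. x \<in> E \<Longrightarrow> cmod (f x - p n x) \<le> 1 / real (Suc n) * n1" by metis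
    have lim: "(\<lambda>n. 1 / real (Suc n) * n1) \<longlonglongrightarrow> 0"
      using tendsto_mult_right[OF LIMSEQ_inverse_real_of_nat, of n1] by (simp add: inverse_eq_divide)
    have "uniform_limit E p f sequentially"
      unfolding uniform_limit_iff
    proof (intro allI impI)
      fix e :: real assume "0 < e"
      from order_tendstoD(2)[OF lim this]
      show "\<forall>\<^sub>F n in sequentially. \<forall>x\<in>E. dist (p n x) (f x) < e"
      proof eventually_elim
        case (elim n)
        then show ?case using p(2)[of _ n] by (auto simp: dist_norm norm_minus_commute intro: le_less_trans)
      qed
    qed
    then show ?thesis
      by (rule uniform_limit_theorem[rotated]) (auto simp: p(1))
  qed
  have "isCont f x" for x
  proof -
    obtain U E where "open U" "compact E" "x \<in> U" "U \<subseteq> E"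
      using lc unfolding locally_compact_space_def by (metis UNIV_I compactin_euclidean_iff open_openin topspace_euclidean)
    then show ?thesis
      using continuous_on_subset[OF cE[of E], of U] by (simp add: continuous_on_eq_continuous_at)
  qed
  then show ?thesis unfolding f_def[abs_def, symmetric] by (simp add: continuous_at_imp_continuous_on)
qed

text \<open>Makes the transform of a compactly supported function an admissible integrand for
  \<open>dual_quadrature\<close>.\<close>

lemma fourier_dual_ball:
  assumes \<phi>: "integrable \<mu> \<phi>" "\<And>x. x \<notin> E \<Longrightarrow> \<phi> x = 0" and \<mu>: "haar_measure \<mu>"
    and \<xi>: "\<xi> \<in> dual_ball t E \<epsilon>"
  shows "cmod (fourier \<mu> \<phi> \<xi> - fourier \<mu> \<phi> t) \<le> \<epsilon> * (LINT x|\<mu>. cmod (\<phi> x))"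
proof -
  have m: "(\<lambda>x. eval_char \<xi> x) \<in> borel_measurable \<mu>" for \<xi>
    by (rule borel_measurable_haar[OF \<mu> eval_char_cont])
  have i: "integrable \<mu> (\<lambda>x. \<phi> x * cnj (eval_char \<xi> x))" for \<xi>
    by (rule Bochner_Integration.integrable_bound[OF \<phi>(1)])
      (use m[of \<xi>] borel_measurable_integrable[OF \<phi>(1)] in \<open>auto simp: norm_mult intro!: borel_measurable_times borel_measurable_cnj\<close>)
  have "fourier \<mu> \<phi> \<xi> - fourier \<mu> \<phi> t = (LINT x|\<mu>. \<phi> x * cnj (eval_char \<xi> x) - \<phi> x * cnj (eval_char t x))"
    unfolding fourier_def by (rule Bochner_Integration.integral_diff[symmetric, OF i i])
  also have "cmod \<dots> \<le> (LINT x|\<mu>. \<epsilon> * cmod (\<phi> x))"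
  proof (rule cmod_integral_le)
    show "integrable \<mu> (\<lambda>x. \<phi> x * cnj (eval_char \<xi> x) - \<phi> x * cnj (eval_char t x))"
      by (rule Bochner_Integration.integrable_diff[OF i i])
    show "integrable \<mu> (\<lambda>x. \<epsilon> * cmod (\<phi> x))" using \<phi>(1) by auto
    show "cmod (\<phi> x * cnj (eval_char \<xi> x) - \<phi> x * cnj (eval_char t x)) \<le> \<epsilon> * cmod (\<phi> x)" for x
    proof (cases "x \<in> E")
      case True
      have "\<phi> x * cnj (eval_char \<xi> x) - \<phi> x * cnj (eval_char t x) = cnj (eval_char \<xi> x - eval_char t x) * \<phi> x"
        by (simp add: algebra_simps)
      then have "cmod (\<phi> x * cnj (eval_char \<xi> x) - \<phi> x * cnj (eval_char t x)) =
          cmod (eval_char \<xi> x - eval_char t x) * cmod (\<phi> x)"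
        by (simp only: norm_mult complex_mod_cnj)
      then show ?thesis using \<xi> True by (auto simp: dual_ball_def less_imp_le intro!: mult_right_mono)
    qed (use \<phi>(2) in auto)
  qed
  finally show ?thesis by simp
qed

text \<open>The exchange of integrals holds exactly when \<open>F\<close> is replaced by finitely
  many weighted nodes. The same nodes approximate both sides, the left one through point evaluations
  on \<open>E\<close> and the right one through the transform of \<phi>, so the two sides differ by
  at most twice the quadrature error.\<close>

lemma synthesis_fourier_swap:
  fixes \<nu> :: "'a::{topological_ab_group_add,t2_space} dual measure"
  assumes \<mu>: "haar_measure \<mu>" and \<nu>: "haar_measure \<nu>"
    and F: "integrable \<nu> F" "\<And>\<xi>. \<xi> \<notin> K \<Longrightarrow> F \<xi> = 0" and K: "compact K"
    and \<phi>: "integrable \<mu> \<phi>" "\<And>x. x \<notin> E \<Longrightarrow> \<phi> x = 0" and E: "compact E"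
    and [measurable]: "(\<lambda>x. LINT \<xi>|\<nu>. F \<xi> * eval_char \<xi> x) \<in> borel_measurable \<mu>"
      "fourier \<mu> \<phi> \<in> borel_measurable \<nu>"
  shows "(LINT x|\<mu>. (LINT \<xi>|\<nu>. F \<xi> * eval_char \<xi> x) * cnj (\<phi> x)) = (LINT \<xi>|\<nu>. F \<xi> * cnj (fourier \<mu> \<phi> \<xi>))"
proof -
  define f where "f x = (LINT \<xi>|\<nu>. F \<xi> * eval_char \<xi> x)" for x
  define nF where "nF = (LINT \<xi>|\<nu>. cmod (F \<xi>))"
  define n\<phi> where "n\<phi> = (LINT x|\<mu>. cmod (\<phi> x))"
  note [measurable] = borel_measurable_integrable[OF \<phi>(1)] borel_measurable_haar[OF \<mu> eval_char_cont]
  have [measurable]: "f \<in> borel_measurable \<mu>" unfolding f_def by measurable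
  have bi: "integrable \<mu> (\<lambda>x. b x * cnj (\<phi> x))"
    if [measurable]: "b \<in> borel_measurable \<mu>" and "\<And>x. cmod (b x) \<le> B" for b B
  proof (rule Bochner_Integration.integrable_bound)
    show "integrable \<mu> (\<lambda>x. B * cmod (\<phi> x))" using \<phi>(1) by auto
    show "AE x in \<mu>. norm (b x * cnj (\<phi> x)) \<le> norm (B * cmod (\<phi> x))"
    proof (rule AE_I2)
      fix x
      have "cmod (b x) * cmod (\<phi> x) \<le> B * cmod (\<phi> x)" by (rule mult_right_mono[OF that(2) norm_ge_zero])
      from order_trans[OF this abs_ge_self]
      show "norm (b x * cnj (\<phi> x)) \<le> norm (B * cmod (\<phi> x))" by (simp add: norm_mult)
    qed
  qed measurable
  have bf: "cmod (f x) \<le> nF" for x unfolding f_def nF_def by (rule synthesis_bounded)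
  have main: "cmod ((LINT x|\<mu>. f x * cnj (\<phi> x)) - (LINT \<xi>|\<nu>. F \<xi> * cnj (fourier \<mu> \<phi> \<xi>))) \<le> 2 * \<epsilon> * (nF * n\<phi>)"
    if \<epsilon>: "0 < \<epsilon>" for \<epsilon>
  proof -
    from dual_quadrature[OF \<nu> F K E \<epsilon>, folded nF_def]
    obtain T c where T: "finite T" and *: "\<And>G B. G \<in> borel_measurable \<nu> \<Longrightarrow>
        (\<forall>t. \<forall>\<xi>\<in>dual_ball t E \<epsilon>. cmod (G \<xi> - G t) \<le> B) \<Longrightarrow>
        cmod ((LINT \<xi>|\<nu>. F \<xi> * G \<xi>) - (\<Sum>t\<in>T. c t * G t)) \<le> B * nF"
      by blast
    define p where "p x = (\<Sum>t\<in>T. c t * eval_char t x)" for x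
    have [measurable]: "p \<in> borel_measurable \<mu>" unfolding p_def by measurable
    have fp: "cmod (f x - p x) \<le> \<epsilon> * nF" if "x \<in> E" for x
      unfolding f_def p_def
      by (rule *[OF borel_measurable_eval_char_dual[OF \<nu>]]) (use that in \<open>auto simp: dual_ball_def less_imp_le\<close>)
    have "cmod ((LINT \<xi>|\<nu>. F \<xi> * cnj (fourier \<mu> \<phi> \<xi>)) - (\<Sum>t\<in>T. c t * cnj (fourier \<mu> \<phi> t))) \<le> \<epsilon> * n\<phi> * nF"
    proof (rule *, safe)
      fix t \<xi> assume "\<xi> \<in> dual_ball t E \<epsilon>"
      from fourier_dual_ball[OF \<phi> \<mu> this]
      show "cmod (cnj (fourier \<mu> \<phi> \<xi>) - cnj (fourier \<mu> \<phi> t)) \<le> \<epsilon> * n\<phi>"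
        unfolding n\<phi>_def by (metis complex_cnj_diff complex_mod_cnj)
    qed measurable
    moreover have "(\<Sum>t\<in>T. c t * cnj (fourier \<mu> \<phi> t)) = (LINT x|\<mu>. p x * cnj (\<phi> x))"
    proof -
      have e: "integrable \<mu> (\<lambda>x. eval_char t x * cnj (\<phi> x))" for t by (rule bi[of _ 1]) auto
      have "cnj (fourier \<mu> \<phi> t) = (LINT x|\<mu>. eval_char t x * cnj (\<phi> x))" for t
        unfolding fourier_def by (simp add: Bochner_Integration.integral_cnj[symmetric] mult.commute del: Bochner_Integration.integral_cnj)
      then have "(\<Sum>t\<in>T. c t * cnj (fourier \<mu> \<phi> t)) = (\<Sum>t\<in>T. LINT x|\<mu>. c t * (eval_char t x * cnj (\<phi> x)))" by simp
      also have "\<dots> = (LINT x|\<mu>. (\<Sum>t\<in>T. c t * (eval_char t x * cnj (\<phi> x))))"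
        using e by (intro Bochner_Integration.integral_sum[symmetric]) auto
      finally show ?thesis by (simp add: p_def sum_distrib_right mult.assoc)
    qed
    moreover have "cmod ((LINT x|\<mu>. f x * cnj (\<phi> x)) - (LINT x|\<mu>. p x * cnj (\<phi> x))) \<le> \<epsilon> * nF * n\<phi>"
    proof -
      have pb: "cmod (p x) \<le> (\<Sum>t\<in>T. cmod (c t))" for x
        unfolding p_def by (rule order_trans[OF norm_sum]) (simp add: norm_mult)
      have i1: "integrable \<mu> (\<lambda>x. f x * cnj (\<phi> x))" by (rule bi[OF _ bf]) measurable
      have i2: "integrable \<mu> (\<lambda>x. p x * cnj (\<phi> x))" by (rule bi[OF _ pb]) measurable
      have "(LINT x|\<mu>. f x * cnj (\<phi> x)) - (LINT x|\<mu>. p x * cnj (\<phi> x)) = (LINT x|\<mu>. f x * cnj (\<phi> x) - p x * cnj (\<phi> x))"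
        by (rule Bochner_Integration.integral_diff[symmetric, OF i1 i2])
      also have "cmod \<dots> \<le> (LINT x|\<mu>. \<epsilon> * nF * cmod (\<phi> x))"
      proof (rule cmod_integral_le)
        show "integrable \<mu> (\<lambda>x. f x * cnj (\<phi> x) - p x * cnj (\<phi> x))"
          by (rule Bochner_Integration.integrable_diff[OF i1 i2])
        show "cmod (f x * cnj (\<phi> x) - p x * cnj (\<phi> x)) \<le> \<epsilon> * nF * cmod (\<phi> x)" for x
          unfolding left_diff_distrib[symmetric] norm_mult complex_mod_cnj
          using fp[of x] \<phi>(2)[of x] by (cases "x \<in> E") (auto intro: mult_right_mono)
      qed (use \<phi>(1) in auto)
      finally show ?thesis by (simp add: n\<phi>_def)
    qed
    ultimately show ?thesis
      using norm_triangle_ineq4[of "(LINT x|\<mu>. f x * cnj (\<phi> x)) - (LINT x|\<mu>. p x * cnj (\<phi> x))"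
          "(LINT \<xi>|\<nu>. F \<xi> * cnj (fourier \<mu> \<phi> \<xi>)) - (LINT x|\<mu>. p x * cnj (\<phi> x))"]
      by (simp add: algebra_simps)
  qed
  have nn: "0 \<le> nF * n\<phi>" by (simp add: nF_def n\<phi>_def)
  have "cmod ((LINT x|\<mu>. f x * cnj (\<phi> x)) - (LINT \<xi>|\<nu>. F \<xi> * cnj (fourier \<mu> \<phi> \<xi>))) \<le> 0"
  proof (rule field_le_epsilon)
    fix e :: real assume e: "0 < e"
    \<comment> \<open>With \<epsilon> chosen as \<open>e / (2 * s)\<close> the bound of
      \<open>main\<close> is at most \<open>e\<close>; the 1 avoids division by zero.\<close>
    define s where "s = nF * n\<phi> + 1"
    have s: "0 < s" "nF * n\<phi> \<le> s" using nn by (simp_all add: s_def)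
    have "2 * (e / (2 * s)) * (nF * n\<phi>) \<le> 2 * (e / (2 * s)) * s"
      using e s by (intro mult_left_mono) auto
    also have "\<dots> = e" using s by simp
    finally show "cmod ((LINT x|\<mu>. f x * cnj (\<phi> x)) - (LINT \<xi>|\<nu>. F \<xi> * cnj (fourier \<mu> \<phi> \<xi>))) \<le> 0 + e"
      using main[of "e / (2 * s)"] e s by simp
  qed
  then show ?thesis unfolding f_def by simp
qed

subsection \<open>The transform on square-integrable functions\<close>

lemma fourier_add_scale:
  assumes \<mu>: "haar_measure \<mu>" and f: "integrable \<mu> f" and g: "integrable \<mu> g"
  shows "fourier \<mu> (\<lambda>x. f x + c * g x) \<xi> = fourier \<mu> f \<xi> + c * fourier \<mu> g \<xi>"
proof -
  have i: "integrable \<mu> (\<lambda>x. h x * cnj (eval_char \<xi> x))" if h: "integrable \<mu> h" for h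
  proof (rule Bochner_Integration.integrable_bound[OF h])
    note [measurable] = borel_measurable_integrable[OF h] borel_measurable_haar[OF \<mu> eval_char_cont]
    show "(\<lambda>x. h x * cnj (eval_char \<xi> x)) \<in> borel_measurable \<mu>" by measurable
  qed (simp add: norm_mult)
  have "fourier \<mu> (\<lambda>x. f x + c * g x) \<xi>
      = (LINT x|\<mu>. f x * cnj (eval_char \<xi> x) + c * (g x * cnj (eval_char \<xi> x)))"
    by (simp add: fourier_def algebra_simps)
  also have "\<dots> = fourier \<mu> f \<xi> + c * fourier \<mu> g \<xi>"
    unfolding fourier_def using i[OF f] i[OF g] by simp
  finally show ?thesis .
qed

lemma fourier_translate:
  fixes \<mu> :: "'a::{topological_ab_group_add,t2_space} measure"
  assumes \<mu>: "haar_measure \<mu>" and h: "h \<in> borel_measurable \<mu>"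
  shows "fourier \<mu> (\<lambda>x. h (a + x)) \<xi> = eval_char \<xi> a * fourier \<mu> h \<xi>"
proof -
  note [measurable] = h borel_measurable_haar[OF \<mu> eval_char_cont]
  have 1: "h (a + x) * cnj (eval_char \<xi> x) = eval_char \<xi> a * (h (a + x) * cnj (eval_char \<xi> (a + x)))" for x
  proof -
    have "eval_char \<xi> a * (h (a + x) * cnj (eval_char \<xi> (a + x)))
        = (eval_char \<xi> a * cnj (eval_char \<xi> a)) * (h (a + x) * cnj (eval_char \<xi> x))"
      by (simp only: eval_char_add complex_cnj_mult mult_ac)
    then show ?thesis by (simp only: eval_char_mult_cnj mult_1)
  qed
  have "fourier \<mu> (\<lambda>x. h (a + x)) \<xi> = eval_char \<xi> a * (LINT x|\<mu>. h (a + x) * cnj (eval_char \<xi> (a + x)))"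
    unfolding fourier_def 1 by simp
  also have "(LINT x|\<mu>. h (a + x) * cnj (eval_char \<xi> (a + x))) = fourier \<mu> h \<xi>"
    unfolding fourier_def
    by (rule haar_integral_translate[OF \<mu>, of "\<lambda>x. h x * cnj (eval_char \<xi> x)"]) measurable
  finally show ?thesis .
qed

lemma L2_translate:
  fixes \<mu> :: "'a::{topological_ab_group_add,t2_space} measure"
  assumes \<mu>: "haar_measure \<mu>" and h: "h \<in> L2 \<mu>"
  shows "(\<lambda>x. h (a + x)) \<in> L2 \<mu>"
proof (rule L2_I)
  note [measurable] = L2_measurable[OF h]
  show "(\<lambda>x. h (a + x)) \<in> borel_measurable \<mu>"
    by (rule haar_borel_measurable_translate[OF \<mu> L2_measurable[OF h]])
  show "integrable \<mu> (\<lambda>x. (cmod (h (a + x)))\<^sup>2)"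
    using haar_integrable_translate[OF \<mu>, of "\<lambda>x. (cmod (h x))\<^sup>2" a] L2_integrable[OF h] by simp
qed

locale plancherel_pair =
  fixes \<mu> :: "'a::{topological_ab_group_add, t2_space} measure"
    and \<nu> :: "'a dual measure"
  assumes lc: "locally_compact_space (euclidean :: 'a topology)"
    and sc: "sigma_compact (UNIV :: 'a set)"
    and \<mu>: "haar_measure \<mu>" and \<nu>: "haar_measure \<nu>"
    and iso: "fourier_isometry \<mu> \<nu>"
begin

lemma fourier_L2:
  assumes "h \<in> L2 \<mu>" "integrable \<mu> h"
  shows "fourier \<mu> h \<in> L2 \<nu>" "L2_norm \<nu> (fourier \<mu> h) = L2_norm \<mu> h"
  using iso assms unfolding fourier_isometry_def by blast+

lemma has_fourier_L2_fourier:
  assumes "h \<in> L2 \<mu>" "integrable \<mu> h"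
  shows "has_fourier_L2 \<mu> \<nu> h (fourier \<mu> h)"
  unfolding has_fourier_L2_def
  using assms fourier_L2[OF assms] by (intro conjI exI[of _ "\<lambda>n. h"]) (simp_all add: L2_norm_def)

lemma has_fourier_L2_norm:
  assumes "has_fourier_L2 \<mu> \<nu> f F"
  shows "L2_norm \<mu> f = L2_norm \<nu> F"
proof -
  obtain h where f: "f \<in> L2 \<mu>" and F: "F \<in> L2 \<nu>"
    and h: "\<And>n. h n \<in> L2 \<mu>" "\<And>n. integrable \<mu> (h n)"
      "(\<lambda>n. L2_norm \<mu> (\<lambda>x. h n x - f x)) \<longlonglongrightarrow> 0"
      "(\<lambda>n. L2_norm \<nu> (\<lambda>\<xi>. fourier \<mu> (h n) \<xi> - F \<xi>)) \<longlonglongrightarrow> 0"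
    using assms unfolding has_fourier_L2_def by blast
  have 1: "(\<lambda>n. L2_norm \<mu> (h n) - L2_norm \<mu> f) \<longlonglongrightarrow> 0"
    by (rule tendsto_rabs_zero_cancel, rule tendsto_sandwich[OF _ _ tendsto_const h(3)])
      (simp_all add: L2_norm_diff_ge h f)
  have "\<bar>L2_norm \<mu> (h n) - L2_norm \<nu> F\<bar> \<le> L2_norm \<nu> (\<lambda>\<xi>. fourier \<mu> (h n) \<xi> - F \<xi>)" for n
    using L2_norm_diff_ge[OF fourier_L2(1)[OF h(1,2)] F, of n] unfolding fourier_L2(2)[OF h(1,2)] .
  note b = this
  have 2: "(\<lambda>n. L2_norm \<mu> (h n) - L2_norm \<nu> F) \<longlonglongrightarrow> 0"
    by (rule tendsto_rabs_zero_cancel, rule tendsto_sandwich[OF _ _ tendsto_const h(4)]) (simp_all add: b)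
  have "(\<lambda>n. L2_norm \<nu> F - L2_norm \<mu> f) \<longlonglongrightarrow> 0"
    using tendsto_diff[OF 1 2] by simp
  then show ?thesis by (simp add: LIMSEQ_const_iff)
qed

lemma has_fourier_L2_add_scale:
  assumes "has_fourier_L2 \<mu> \<nu> f F" and "has_fourier_L2 \<mu> \<nu> g G"
  shows "has_fourier_L2 \<mu> \<nu> (\<lambda>x. f x + c * g x) (\<lambda>\<xi>. F \<xi> + c * G \<xi>)"
proof -
  obtain h where f: "f \<in> L2 \<mu>" and F: "F \<in> L2 \<nu>"
    and h: "\<And>n. h n \<in> L2 \<mu>" "\<And>n. integrable \<mu> (h n)"
      "(\<lambda>n. L2_norm \<mu> (\<lambda>x. h n x - f x)) \<longlonglongrightarrow> 0"
      "(\<lambda>n. L2_norm \<nu> (\<lambda>\<xi>. fourier \<mu> (h n) \<xi> - F \<xi>)) \<longlonglongrightarrow> 0"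
    using assms(1) unfolding has_fourier_L2_def by blast
  obtain k where g: "g \<in> L2 \<mu>" and G: "G \<in> L2 \<nu>"
    and k: "\<And>n. k n \<in> L2 \<mu>" "\<And>n. integrable \<mu> (k n)"
      "(\<lambda>n. L2_norm \<mu> (\<lambda>x. k n x - g x)) \<longlonglongrightarrow> 0"
      "(\<lambda>n. L2_norm \<nu> (\<lambda>\<xi>. fourier \<mu> (k n) \<xi> - G \<xi>)) \<longlonglongrightarrow> 0"
    using assms(2) unfolding has_fourier_L2_def by blast
  define w where "w n x = h n x + c * k n x" for n x
  have w: "w n \<in> L2 \<mu>" "integrable \<mu> (w n)" for n
    unfolding w_def[abs_def] using h(2) k(2) by (simp_all add: L2_add L2_scale h(1) k(1))
  have fw: "fourier \<mu> (w n) \<xi> = fourier \<mu> (h n) \<xi> + c * fourier \<mu> (k n) \<xi>" for n \<xi>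
    unfolding w_def[abs_def] by (rule fourier_add_scale[OF \<mu> h(2) k(2)])
  have bnd: "L2_norm M (\<lambda>x. (p x + c * q x) - (p' x + c * q' x))
      \<le> L2_norm M (\<lambda>x. p x - p' x) + cmod c * L2_norm M (\<lambda>x. q x - q' x)"
    if "p \<in> L2 M" "q \<in> L2 M" "p' \<in> L2 M" "q' \<in> L2 M" for M :: "'b measure" and p q p' q'
  proof -
    have "L2_norm M (\<lambda>x. (p x - p' x) + c * (q x - q' x))
        \<le> L2_norm M (\<lambda>x. p x - p' x) + L2_norm M (\<lambda>x. c * (q x - q' x))"
      using that by (intro L2_norm_triangle L2_diff L2_scale)
    moreover have "(p x - p' x) + c * (q x - q' x) = (p x + c * q x) - (p' x + c * q' x)" for x
      by (simp add: algebra_simps)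
    ultimately show ?thesis by (simp only: L2_norm_scale)
  qed
  have lim: "(\<lambda>n. a n + cmod c * b n) \<longlonglongrightarrow> 0" if "a \<longlonglongrightarrow> 0" "b \<longlonglongrightarrow> 0" for a b :: "nat \<Rightarrow> real"
    using tendsto_add[OF that(1) tendsto_mult_left[OF that(2), of "cmod c"]] by simp
  have "(\<lambda>n. L2_norm \<mu> (\<lambda>x. w n x - (f x + c * g x))) \<longlonglongrightarrow> 0"
    by (rule tendsto_sandwich[OF _ _ tendsto_const lim[OF h(3) k(3)]])
      (simp_all add: w_def bnd h k f g)
  moreover have "(\<lambda>n. L2_norm \<nu> (\<lambda>\<xi>. fourier \<mu> (w n) \<xi> - (F \<xi> + c * G \<xi>))) \<longlonglongrightarrow> 0"
    by (rule tendsto_sandwich[OF _ _ tendsto_const lim[OF h(4) k(4)]])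
      (simp_all add: fw bnd fourier_L2 h k F G)
  moreover have "(\<lambda>x. f x + c * g x) \<in> L2 \<mu>" "(\<lambda>\<xi>. F \<xi> + c * G \<xi>) \<in> L2 \<nu>"
    using f g F G by (simp_all add: L2_add L2_scale)
  ultimately show ?thesis unfolding has_fourier_L2_def
    using w fourier_L2(1)[OF w] by blast
qed

text \<open>Polarisation: the norms of \<open>f + c g\<close> and \<open>F + c G\<close> agree for
  every \<open>c\<close>; \<open>c = 1\<close> compares the real parts and \<open>c = \<i>\<close>
  the imaginary parts.\<close>

lemma has_fourier_L2_inner:
  assumes fF: "has_fourier_L2 \<mu> \<nu> f F" and gG: "has_fourier_L2 \<mu> \<nu> g G"
  shows "L2_inner \<mu> f g = L2_inner \<nu> F G"
proof -
  have L: "f \<in> L2 \<mu>" "g \<in> L2 \<mu>" "F \<in> L2 \<nu>" "G \<in> L2 \<nu>"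
    using assms by (auto simp: has_fourier_L2_def)
  have *: "Re (cnj c * L2_inner \<mu> f g) = Re (cnj c * L2_inner \<nu> F G)" for c
  proof -
    have "(L2_norm \<mu> (\<lambda>x. f x + c * g x))\<^sup>2 = (L2_norm \<nu> (\<lambda>\<xi>. F \<xi> + c * G \<xi>))\<^sup>2"
      using has_fourier_L2_norm[OF has_fourier_L2_add_scale[OF assms, of c]] by simp
    then show ?thesis
      using has_fourier_L2_norm[OF fF] has_fourier_L2_norm[OF gG]
        L2_norm_add_square[OF L(1) L2_scale[OF L(2), of c]] L2_norm_add_square[OF L(3) L2_scale[OF L(4), of c]]
      by (simp only: L2_norm_scale L2_inner_scale_right)
  qed
  show ?thesis using *[of 1] *[of \<i>] by (simp add: complex_eq_iff)
qed

section \<open>The closure of the image of the transform\<close>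

text \<open>\<open>L2\<close> is a plain set of functions without a topology of its own, so the
  closure of the image of integrable functions is written with \<epsilon>. Once an \<open>F\<close>
  with compact support is known to belong to it, \<open>has_fourier_L2_synthesis\<close> exhibits a
  function with transform \<open>F\<close>.\<close>

definition fourier_closure :: "('a dual \<Rightarrow> complex) set" where
  "fourier_closure = {F \<in> L2 \<nu>. \<forall>\<epsilon>>0. \<exists>h\<in>L2 \<mu>. integrable \<mu> h \<and> L2_norm \<nu> (\<lambda>\<xi>. fourier \<mu> h \<xi> - F \<xi>) < \<epsilon>}"

lemma fourier_closure_L2: "F \<in> fourier_closure \<Longrightarrow> F \<in> L2 \<nu>"
  unfolding fourier_closure_def by simp

lemma fourier_closureE:
  assumes "F \<in> fourier_closure" "0 < \<epsilon>"
  obtains h where "h \<in> L2 \<mu>" "integrable \<mu> h" "L2_norm \<nu> (\<lambda>\<xi>. fourier \<mu> h \<xi> - F \<xi>) < \<epsilon>"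
proof -
  have "\<forall>\<epsilon>>0. \<exists>h\<in>L2 \<mu>. integrable \<mu> h \<and> L2_norm \<nu> (\<lambda>\<xi>. fourier \<mu> h \<xi> - F \<xi>) < \<epsilon>"
    using assms(1) unfolding fourier_closure_def by simp
  from this[rule_format, OF assms(2)] show thesis using that by blast
qed

lemma fourier_closure_closed:
  assumes F: "F \<in> L2 \<nu>" and "\<And>\<epsilon>. 0 < \<epsilon> \<Longrightarrow> \<exists>G\<in>fourier_closure. L2_norm \<nu> (\<lambda>\<xi>. G \<xi> - F \<xi>) < \<epsilon>"
  shows "F \<in> fourier_closure"
  unfolding fourier_closure_def
proof (intro CollectI conjI allI impI F)
  fix \<epsilon> :: real assume "0 < \<epsilon>"
  then obtain G where G: "G \<in> fourier_closure" "L2_norm \<nu> (\<lambda>\<xi>. G \<xi> - F \<xi>) < \<epsilon> / 2"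
    using assms(2)[of "\<epsilon> / 2"] by auto
  obtain h where h: "h \<in> L2 \<mu>" "integrable \<mu> h" "L2_norm \<nu> (\<lambda>\<xi>. fourier \<mu> h \<xi> - G \<xi>) < \<epsilon> / 2"
    by (rule fourier_closureE[OF G(1) half_gt_zero[OF \<open>0 < \<epsilon>\<close>]])
  from L2_norm_dist_triangle[OF fourier_L2(1)[OF h(1,2)] fourier_closure_L2[OF G(1)] F] h G(2)
  show "\<exists>h\<in>L2 \<mu>. integrable \<mu> h \<and> L2_norm \<nu> (\<lambda>\<xi>. fourier \<mu> h \<xi> - F \<xi>) < \<epsilon>"
    by (intro bexI[of _ h]) auto
qed

lemma fourier_in_closure:
  assumes "h \<in> L2 \<mu>" "integrable \<mu> h"
  shows "fourier \<mu> h \<in> fourier_closure"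
  unfolding fourier_closure_def
proof (intro CollectI conjI allI impI fourier_L2[OF assms] bexI[of _ h] assms)
  fix \<epsilon> :: real assume "0 < \<epsilon>"
  then show "L2_norm \<nu> (\<lambda>\<xi>. fourier \<mu> h \<xi> - fourier \<mu> h \<xi>) < \<epsilon>" by (simp add: L2_norm_def)
qed

lemma fourier_closure_add:
  assumes F: "F \<in> fourier_closure" and G: "G \<in> fourier_closure"
  shows "(\<lambda>\<xi>. F \<xi> + G \<xi>) \<in> fourier_closure"
proof -
  note L = fourier_closure_L2[OF F] fourier_closure_L2[OF G]
  show ?thesis
  proof (rule fourier_closure_closed)
    show "(\<lambda>\<xi>. F \<xi> + G \<xi>) \<in> L2 \<nu>" using L by (rule L2_add)
    fix \<epsilon> :: real assume "0 < \<epsilon>"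
    then have e: "0 < \<epsilon> / 2" by simp
    obtain h where h: "h \<in> L2 \<mu>" "integrable \<mu> h" "L2_norm \<nu> (\<lambda>\<xi>. fourier \<mu> h \<xi> - F \<xi>) < \<epsilon> / 2"
      by (rule fourier_closureE[OF F e])
    obtain k where k: "k \<in> L2 \<mu>" "integrable \<mu> k" "L2_norm \<nu> (\<lambda>\<xi>. fourier \<mu> k \<xi> - G \<xi>) < \<epsilon> / 2"
      by (rule fourier_closureE[OF G e])
    have hk: "(\<lambda>x. h x + 1 * k x) \<in> L2 \<mu>" "integrable \<mu> (\<lambda>x. h x + 1 * k x)"
      using h k by (simp_all add: L2_add)
    have "L2_norm \<nu> (\<lambda>\<xi>. (fourier \<mu> h \<xi> - F \<xi>) + (fourier \<mu> k \<xi> - G \<xi>)) < \<epsilon>"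
      using L2_norm_triangle[OF L2_diff[OF fourier_L2(1)[OF h(1,2)] L(1)] L2_diff[OF fourier_L2(1)[OF k(1,2)] L(2)]]
        h(3) k(3) by linarith
    then have "L2_norm \<nu> (\<lambda>\<xi>. fourier \<mu> (\<lambda>x. h x + 1 * k x) \<xi> - (F \<xi> + G \<xi>)) < \<epsilon>"
      unfolding fourier_add_scale[OF \<mu> h(2) k(2)] by (simp add: algebra_simps)
    then show "\<exists>H\<in>fourier_closure. L2_norm \<nu> (\<lambda>\<xi>. H \<xi> - (F \<xi> + G \<xi>)) < \<epsilon>"
      using fourier_in_closure[OF hk] by blast
  qed
qed

lemma fourier_closure_sum:
  "(\<And>t. t \<in> T \<Longrightarrow> F t \<in> fourier_closure) \<Longrightarrow> (\<lambda>\<xi>. \<Sum>t\<in>T. F t \<xi>) \<in> fourier_closure"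
proof (induction T rule: infinite_finite_induct)
  case (insert t T)
  then show ?case using fourier_closure_add[of "F t" "\<lambda>\<xi>. \<Sum>t\<in>T. F t \<xi>"] by simp
next
  case empty
  have "fourier \<mu> (\<lambda>x. 0) \<in> fourier_closure" by (rule fourier_in_closure) simp_all
  then show ?case by (simp add: fourier_def[abs_def])
next
  case infinite
  have "fourier \<mu> (\<lambda>x. 0) \<in> fourier_closure" by (rule fourier_in_closure) simp_all
  then show ?case using infinite by (simp add: fourier_def[abs_def])
qed

text \<open>Multiplication by evaluation at \<open>a\<close> is translation by \<open>a\<close> on
  the group, which preserves the image before the closure is taken.\<close>

lemma fourier_closure_mult_char:
  assumes F: "F \<in> fourier_closure"
  shows "(\<lambda>\<xi>. eval_char \<xi> a * F \<xi>) \<in> fourier_closure"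
proof (rule fourier_closure_closed)
  note L = fourier_closure_L2[OF F]
  show "(\<lambda>\<xi>. eval_char \<xi> a * F \<xi>) \<in> L2 \<nu>"
    by (rule L2_mult_bounded[where C=1, OF L borel_measurable_eval_char_dual[OF \<nu>]]) simp
  fix \<epsilon> :: real assume e: "0 < \<epsilon>"
  obtain h where h: "h \<in> L2 \<mu>" "integrable \<mu> h" "L2_norm \<nu> (\<lambda>\<xi>. fourier \<mu> h \<xi> - F \<xi>) < \<epsilon>"
    by (rule fourier_closureE[OF F e])
  have ha: "(\<lambda>x. h (a + x)) \<in> L2 \<mu>" "integrable \<mu> (\<lambda>x. h (a + x))"
    using L2_translate[OF \<mu> h(1)] haar_integrable_translate[OF \<mu> L2_measurable[OF h(1)]] h(2) by auto
  have "L2_norm \<nu> (\<lambda>\<xi>. fourier \<mu> (\<lambda>x. h (a + x)) \<xi> - eval_char \<xi> a * F \<xi>)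
      = L2_norm \<nu> (\<lambda>\<xi>. fourier \<mu> h \<xi> - F \<xi>)"
    unfolding fourier_translate[OF \<mu> L2_measurable[OF h(1)]] right_diff_distrib[symmetric]
    by (simp add: L2_norm_def norm_mult)
  then show "\<exists>G\<in>fourier_closure. L2_norm \<nu> (\<lambda>\<xi>. G \<xi> - eval_char \<xi> a * F \<xi>) < \<epsilon>"
    using fourier_in_closure[OF ha] h(3) by (intro bexI[of _ "fourier \<mu> (\<lambda>x. h (a + x))"]) simp_all
qed

lemma trig_mult_fourier:
  assumes h: "h \<in> L2 \<mu>" "integrable \<mu> h" and p: "p \<in> trig_span UNIV (\<lambda>x \<xi>. eval_char \<xi> x)"
  shows "\<exists>k\<in>L2 \<mu>. integrable \<mu> k \<and> fourier \<mu> k = (\<lambda>\<xi>. p \<xi> * fourier \<mu> h \<xi>)"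
  using p
proof (induction rule: trig_span.induct)
  case zero
  show ?case by (intro bexI[of _ "\<lambda>x. 0"]) (simp_all add: fourier_def[abs_def])
next
  case (step p a c)
  then obtain k where k: "k \<in> L2 \<mu>" "integrable \<mu> k" "fourier \<mu> k = (\<lambda>\<xi>. p \<xi> * fourier \<mu> h \<xi>)" by blast
  have ha: "(\<lambda>x. h (a + x)) \<in> L2 \<mu>" "integrable \<mu> (\<lambda>x. h (a + x))"
    using L2_translate[OF \<mu> h(1)] haar_integrable_translate[OF \<mu> L2_measurable[OF h(1)]] h(2) by auto
  show ?case
  proof (intro bexI conjI)
    show "(\<lambda>x. k x + c * h (a + x)) \<in> L2 \<mu>" using k ha by (intro L2_add L2_scale)
    show "integrable \<mu> (\<lambda>x. k x + c * h (a + x))" using k ha by simp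
    show "fourier \<mu> (\<lambda>x. k x + c * h (a + x)) = (\<lambda>\<xi>. (p \<xi> + c * eval_char \<xi> a) * fourier \<mu> h \<xi>)"
      using fourier_add_scale[OF \<mu> k(2) ha(2)] k(3) fourier_translate[OF \<mu> L2_measurable[OF h(1)]]
      by (simp add: fun_eq_iff distrib_right mult.assoc)
  qed
qed

text \<open>Distinct characters differ at some point of the group, so every measurable set is
  admissible in \<open>trig_approx_indicator\<close>. Trigonometric polynomials in group points act
  on the image by combinations of translations, and restriction to \<open>A\<close> is a limit of
  such actions.\<close>

lemma indicator_mult_fourier_in_closure:
  assumes h: "h \<in> L2 \<mu>" "integrable \<mu> h" and A: "A \<in> sets \<nu>"
  shows "(\<lambda>\<xi>. indicator A \<xi> * fourier \<mu> h \<xi>) \<in> fourier_closure"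
proof (rule fourier_closure_closed)
  show "(\<lambda>\<xi>. indicator A \<xi> * fourier \<mu> h \<xi>) \<in> L2 \<nu>"
    using A by (intro L2_mult_bounded[OF fourier_L2(1)[OF h], where C=1]) (auto simp: indicator_def)
  fix \<epsilon> :: real assume e: "0 < \<epsilon>"
  have "add_subgroup (UNIV :: 'a set)" by (simp add: add_subgroup_def)
  note cf = char_family_eval_point[OF this]
  have "\<exists>p\<in>trig_span UNIV (\<lambda>x \<xi>. eval_char \<xi> x).
      L2_norm \<nu> (\<lambda>\<xi>. p \<xi> * fourier \<mu> h \<xi> - indicator A \<xi> * fourier \<mu> h \<xi>) < \<epsilon>"
  proof (rule trig_approx_indicator[OF \<nu> fourier_L2(1)[OF h] cf A _ _ _ e])
    show "UNIV \<in> sets \<nu>" using sets.top[of \<nu>] haar_space[OF \<nu>] by simp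
    show "\<exists>i\<in>UNIV. eval_char x i \<noteq> eval_char y i" if "x \<in> A \<inter> UNIV" "y \<in> UNIV - A" for x y
      using that eval_char_inject[of x y] by (auto simp: fun_eq_iff)
  qed simp
  then obtain p where p: "p \<in> trig_span UNIV (\<lambda>x \<xi>. eval_char \<xi> x)"
      "L2_norm \<nu> (\<lambda>\<xi>. p \<xi> * fourier \<mu> h \<xi> - indicator A \<xi> * fourier \<mu> h \<xi>) < \<epsilon>" by blast
  obtain k where k: "k \<in> L2 \<mu>" "integrable \<mu> k" "fourier \<mu> k = (\<lambda>\<xi>. p \<xi> * fourier \<mu> h \<xi>)"
    using trig_mult_fourier[OF h p(1)] by blast
  show "\<exists>G\<in>fourier_closure. L2_norm \<nu> (\<lambda>\<xi>. G \<xi> - indicator A \<xi> * fourier \<mu> h \<xi>) < \<epsilon>"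
    using fourier_in_closure[OF k(1,2)] p(2) by (intro bexI[of _ "fourier \<mu> k"]) (simp_all add: k(3))
qed

lemma compact_neighbourhood:
  obtains U E where "open U" "compact E" "(x :: 'a) \<in> U" "U \<subseteq> E"
  using lc unfolding locally_compact_space_def by (metis UNIV_I compactin_euclidean_iff open_openin topspace_euclidean)

text \<open>Glues local units: each small piece of \<open>K\<close> is matched by a transform that
  is nearly 1 there, cut off to that piece. A compact neighbourhood of 0 in the group has positive
  finite measure, so a normalised function to start from exists.\<close>

lemma indicator_compact_in_closure:
  assumes K: "compact K"
  shows "indicator K \<in> fourier_closure"
proof (rule fourier_closure_closed)
  note Ks = compact_sets_haar[OF \<nu> K] and Kf = haar_compact_finite[OF \<nu> K]
  show "indicator K \<in> L2 \<nu>" by (rule L2_indicator[OF Ks Kf])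
  fix \<epsilon> :: real assume e: "0 < \<epsilon>"
  obtain U E where UE: "open U" "compact E" "(0 :: 'a) \<in> U" "U \<subseteq> E" by (rule compact_neighbourhood)
  note Es = compact_sets_haar[OF \<mu> UE(2)] and Ef = haar_compact_finite[OF \<mu> UE(2)]
  have "0 < emeasure \<mu> U" using haar_open_pos[OF \<mu> UE(1)] UE(3) by auto
  also have "\<dots> \<le> emeasure \<mu> E" using UE(4) Es by (rule emeasure_mono)
  finally have m: "0 < measure \<mu> E" using Ef by (simp add: measure_def enn2real_positive_iff)
  define s where "s = sqrt (measure \<nu> K) + 1"
  have s: "0 < s" by (simp add: s_def add_nonneg_pos)
  define \<delta> where "\<delta> = \<epsilon> / (2 * s)"
  have \<delta>: "0 < \<delta>" using e s by (simp add: \<delta>_def)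
  obtain T A where T: "finite T" and dis: "disjoint_family_on A T"
    and A: "\<And>t. t \<in> T \<Longrightarrow> A t \<in> sets borel" "\<And>t. t \<in> T \<Longrightarrow> A t \<subseteq> dual_ball t E \<delta>" "(\<Union>t\<in>T. A t) = K"
    using dual_partition[OF K UE(2) \<delta>] by metis
  \<comment> \<open>The character \<open>t\<close> moves to \<open>t\<close> the place where the
    transform is 1, and total mass 1 keeps the transform within \<delta> of that value on
    \<open>dual_ball t E \<delta>\<close>.\<close>
  define \<phi> where "\<phi> t x = eval_char t x * (indicator E x / complex_of_real (measure \<mu> E))" for t x
  have E1: "(indicator E :: 'a \<Rightarrow> complex) \<in> L2 \<mu>" by (rule L2_indicator[OF Es Ef])
  have \<phi>L: "\<phi> t \<in> L2 \<mu>" for t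
  proof -
    have "(\<lambda>x. (1 / complex_of_real (measure \<mu> E)) * (eval_char t x * indicator E x)) \<in> L2 \<mu>"
      by (intro L2_scale L2_mult_bounded[OF E1, where C=1] borel_measurable_haar[OF \<mu> eval_char_cont]) simp
    then show ?thesis by (simp add: \<phi>_def[abs_def])
  qed
  have \<phi>0: "\<phi> t x = 0" if "x \<notin> E" for t x using that by (simp add: \<phi>_def)
  have \<phi>I: "integrable \<mu> (\<phi> t)" for t
    by (rule L2_integrable_bounded_support[OF \<phi>L Es Ef]) (simp add: \<phi>0)
  have \<phi>n: "(LINT x|\<mu>. cmod (\<phi> t x)) = 1" for t
  proof -
    have "(\<lambda>x. cmod (\<phi> t x)) = (\<lambda>x. indicator E x / measure \<mu> E)"
      using m by (auto simp: \<phi>_def norm_mult norm_divide indicator_def fun_eq_iff)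
    then show ?thesis using m Es by (simp add: haar_space[OF \<mu>])
  qed
  have \<phi>t: "fourier \<mu> (\<phi> t) t = 1" for t
  proof -
    have "\<phi> t x * cnj (eval_char t x) = complex_of_real (indicator E x / measure \<mu> E)" for x
      by (simp add: \<phi>_def indicator_def)
    then show ?thesis using m Es unfolding fourier_def
      by (simp add: haar_space[OF \<mu>] del: of_real_divide)
  qed
  have \<phi>b: "cmod (1 - fourier \<mu> (\<phi> t) \<xi>) \<le> \<delta>" if "\<xi> \<in> dual_ball t E \<delta>" for t \<xi>
    using fourier_dual_ball[OF \<phi>I[of t] \<phi>0 \<mu> that] unfolding \<phi>n \<phi>t by (simp add: norm_minus_commute)
  define G where "G \<xi> = (\<Sum>t\<in>T. indicator (A t) \<xi> * fourier \<mu> (\<phi> t) \<xi>)" for \<xi>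
  have "G \<in> fourier_closure"
    unfolding G_def using A(1) haar_sets[OF \<nu>]
    by (intro fourier_closure_sum indicator_mult_fourier_in_closure \<phi>L \<phi>I) auto
  moreover have "L2_norm \<nu> (\<lambda>\<xi>. G \<xi> - indicator K \<xi>) < \<epsilon>"
  proof -
    have "L2_norm \<nu> (\<lambda>\<xi>. indicator K \<xi> - G \<xi>) \<le> \<delta> * sqrt (measure \<nu> K)"
    proof (rule L2_norm_diff_indicator_le[OF _ _ Ks Kf])
      show "G \<in> borel_measurable \<nu>"
        by (rule L2_measurable[OF fourier_closure_L2[OF \<open>G \<in> fourier_closure\<close>]])
      show "cmod (indicator K \<xi> - G \<xi>) \<le> \<delta>" if \<xi>: "\<xi> \<in> K" for \<xi>
      proof -
        obtain t where t: "t \<in> T" "\<xi> \<in> A t" using A(3) \<xi> by blast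
        have "G \<xi> = fourier \<mu> (\<phi> t) \<xi>"
          unfolding G_def using sum_disjoint_indicator[OF T dis t, of "\<lambda>t. fourier \<mu> (\<phi> t) \<xi>"]
          by (simp add: mult.commute)
        then show ?thesis using \<phi>b[of \<xi> t] A(2)[OF t(1)] t(2) \<xi> by auto
      qed
      show "indicator K \<xi> = G \<xi>" if "\<xi> \<notin> K" for \<xi>
        using that A(3) by (auto simp: G_def intro!: sum.neutral[symmetric])
    qed (use \<delta> Ks in auto)
    also have "\<dots> \<le> \<delta> * s" using \<delta> by (simp add: s_def)
    also have "\<dots> = \<epsilon> / 2" using s by (simp add: \<delta>_def)
    also have "\<dots> < \<epsilon>" using e by simp
    finally show ?thesis by (simp add: L2_norm_minus_commute[of \<nu> G])
  qed
  ultimately show "\<exists>G\<in>fourier_closure. L2_norm \<nu> (\<lambda>\<xi>. G \<xi> - indicator K \<xi>) < \<epsilon>" by blast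
qed

text \<open>
  Testing against truncations of \<open>f - h\<close> shows \<open>\<parallel>f - h\<parallel> \<le> \<parallel>F - fourier h\<parallel>\<close>, so no completeness of \<open>L\<^sup>2\<close> is needed.
\<close>

lemma has_fourier_L2_synthesis:
  assumes F: "F \<in> fourier_closure" and K: "compact K" and FK: "\<And>\<xi>. \<xi> \<notin> K \<Longrightarrow> F \<xi> = 0"
  shows "has_fourier_L2 \<mu> \<nu> (\<lambda>x. LINT \<xi>|\<nu>. F \<xi> * eval_char \<xi> x) F"
proof -
  define f where "f x = (LINT \<xi>|\<nu>. F \<xi> * eval_char \<xi> x)" for x
  note FL = fourier_closure_L2[OF F]
  have FI: "integrable \<nu> F"
    by (rule L2_integrable_bounded_support[OF FL compact_sets_haar[OF \<nu> K] haar_compact_finite[OF \<nu> K]])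
      (simp add: FK)
  have fc: "continuous_on UNIV f"
    unfolding f_def[abs_def] by (rule synthesis_continuous[OF lc \<nu> FI FK K])
  have fm [measurable]: "f \<in> borel_measurable \<mu>" by (rule borel_measurable_haar[OF \<mu> fc])
  have fb: "cmod (f x) \<le> (LINT \<xi>|\<nu>. cmod (F \<xi>))" for x
    unfolding f_def by (rule synthesis_bounded)
  \<comment> \<open>Square integrability of \<open>f\<close> is not known in advance. The bound for
    \<open>f - h\<close> is proved on each compact set of an increasing exhaustion, and monotone
    convergence passes to the whole group.\<close>
  obtain C :: "nat \<Rightarrow> 'a set" where C: "\<And>n. compact (C n)" "(\<Union>n. C n) = UNIV"
    using sc unfolding sigma_compact_def by blast
  define E where "E n = (\<Union>i\<le>n. C i)" for n
  have E: "compact (E n)" for n unfolding E_def using C(1) by (intro compact_UN) auto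
  have Einc: "E m \<subseteq> E n" if "m \<le> n" for m n using that unfolding E_def by fastforce
  have Ex: "\<exists>n. x \<in> E n" for x using C(2) unfolding E_def by blast
  have Es [measurable]: "E n \<in> sets \<mu>" for n by (rule compact_sets_haar[OF \<mu> E])
  have Ef: "emeasure \<mu> (E n) < \<infinity>" for n by (rule haar_compact_finite[OF \<mu> E])
  have key: "f \<in> L2 \<mu> \<and> L2_norm \<mu> (\<lambda>x. h x - f x) \<le> L2_norm \<nu> (\<lambda>\<xi>. fourier \<mu> h \<xi> - F \<xi>)"
    if h: "h \<in> L2 \<mu>" "integrable \<mu> h" for h
  proof -
    define u where "u x = f x - h x" for x
    define b where "b = L2_norm \<nu> (\<lambda>\<xi>. F \<xi> - fourier \<mu> h \<xi>)"
    note [measurable] = L2_measurable[OF h(1)]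
    have um [measurable]: "u \<in> borel_measurable \<mu>" unfolding u_def by measurable
    \<comment> \<open>Cutting off to a compact set makes \<open>v n\<close> both integrable and
      square integrable with compact support, so the isometry and
      \<open>synthesis_fourier_swap\<close> apply to it.\<close>
    define v where "v n x = indicator (E n) x * u x" for n x
    have iE: "(indicator (E n) :: 'a \<Rightarrow> complex) \<in> L2 \<mu>" for n by (rule L2_indicator[OF Es Ef])
    have fE: "(\<lambda>x. f x * indicator (E n) x) \<in> L2 \<mu>" for n
      by (rule L2_mult_bounded[OF iE fm fb])
    have hE: "(\<lambda>x. indicator (E n) x * h x) \<in> L2 \<mu>" for n
      by (rule L2_mult_bounded[OF h(1), where C=1]) (auto simp: indicator_def)
    have v: "v n \<in> L2 \<mu>" for n
    proof -
      have "v n = (\<lambda>x. f x * indicator (E n) x - indicator (E n) x * h x)"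
        by (simp add: v_def u_def fun_eq_iff algebra_simps)
      then show ?thesis using L2_diff[OF fE hE, of n n] by simp
    qed
    have v0: "v n x = 0" if "x \<notin> E n" for n x using that by (simp add: v_def)
    have vI: "integrable \<mu> (v n)" for n
      by (rule L2_integrable_bounded_support[OF v[of n] Es[of n] Ef[of n]]) (simp add: v0)
    have vb: "L2_norm \<mu> (v n) \<le> b" for n
    proof -
      have i1: "integrable \<mu> (\<lambda>x. f x * cnj (v n x))"
      proof -
        have "integrable \<mu> (\<lambda>x. (f x * indicator (E n) x) * cnj (v n x))"
          by (rule L2_mult_integrable[OF fE v])
        moreover have "(f x * indicator (E n) x) * cnj (v n x) = f x * cnj (v n x)" for x
          by (cases "x \<in> E n") (simp_all add: v0)
        ultimately show ?thesis by simp
      qed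
      have "(L2_norm \<mu> (v n))\<^sup>2 = cmod (L2_inner \<mu> (v n) (v n))"
        by (simp add: L2_inner_self norm_power)
      also have "L2_inner \<mu> (v n) (v n) = (LINT x|\<mu>. f x * cnj (v n x)) - L2_inner \<mu> h (v n)"
      proof -
        have "v n x * cnj (v n x) = f x * cnj (v n x) - h x * cnj (v n x)" for x
          by (cases "x \<in> E n") (simp_all add: v_def u_def algebra_simps)
        then show ?thesis unfolding L2_inner_def
          using Bochner_Integration.integral_diff[OF i1 L2_mult_integrable[OF h(1) v]] by simp
      qed
      also have "(LINT x|\<mu>. f x * cnj (v n x)) = L2_inner \<nu> F (fourier \<mu> (v n))"
        unfolding f_def L2_inner_def
        by (rule synthesis_fourier_swap[OF \<mu> \<nu> FI FK K vI v0 E fm[unfolded f_def[abs_def]] L2_measurable[OF fourier_L2(1)[OF v vI]]])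
      also have "L2_inner \<mu> h (v n) = L2_inner \<nu> (fourier \<mu> h) (fourier \<mu> (v n))"
        by (rule has_fourier_L2_inner[OF has_fourier_L2_fourier[OF h] has_fourier_L2_fourier[OF v vI]])
      also have "L2_inner \<nu> F (fourier \<mu> (v n)) - L2_inner \<nu> (fourier \<mu> h) (fourier \<mu> (v n))
          = L2_inner \<nu> (\<lambda>\<xi>. F \<xi> - fourier \<mu> h \<xi>) (fourier \<mu> (v n))"
        by (rule L2_inner_diff_left[symmetric, OF FL fourier_L2(1)[OF h] fourier_L2(1)[OF v vI]])
      also have "cmod \<dots> \<le> b * L2_norm \<nu> (fourier \<mu> (v n))"
        unfolding b_def
        by (rule L2_Cauchy_Schwarz[OF L2_diff[OF FL fourier_L2(1)[OF h]] fourier_L2(1)[OF v vI]])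
      also have "\<dots> = b * L2_norm \<mu> (v n)" by (simp add: fourier_L2(2)[OF v vI])
      finally show ?thesis
        using L2_norm_nonneg[of \<mu> "v n"] L2_norm_nonneg[of \<nu> "\<lambda>\<xi>. F \<xi> - fourier \<mu> h \<xi>"]
        unfolding b_def[symmetric] power2_eq_square
        by (cases "L2_norm \<mu> (v n) = 0") (auto simp: mult_le_cancel_right)
    qed
    have "(\<integral>\<^sup>+x. ennreal ((cmod (u x))\<^sup>2) \<partial>\<mu>) = (\<integral>\<^sup>+x. (SUP n. ennreal ((cmod (v n x))\<^sup>2)) \<partial>\<mu>)"
    proof (rule nn_integral_cong)
      fix x
      show "ennreal ((cmod (u x))\<^sup>2) = (SUP n. ennreal ((cmod (v n x))\<^sup>2))"
      proof (rule antisym)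
        obtain n where "x \<in> E n" using Ex by blast
        then show "ennreal ((cmod (u x))\<^sup>2) \<le> (SUP n. ennreal ((cmod (v n x))\<^sup>2))"
          by (intro SUP_upper2[of n]) (simp_all add: v_def)
        show "(SUP n. ennreal ((cmod (v n x))\<^sup>2)) \<le> ennreal ((cmod (u x))\<^sup>2)"
          by (rule SUP_least) (simp add: v_def indicator_def)
      qed
    qed
    also have "\<dots> = (SUP n. \<integral>\<^sup>+x. ennreal ((cmod (v n x))\<^sup>2) \<partial>\<mu>)"
    proof (rule nn_integral_monotone_convergence_SUP)
      show "incseq (\<lambda>n x. ennreal ((cmod (v n x))\<^sup>2))"
      proof (intro incseq_SucI le_funI)
        fix n x
        show "ennreal ((cmod (v n x))\<^sup>2) \<le> ennreal ((cmod (v (Suc n) x))\<^sup>2)"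
          using Einc[of n "Suc n"] by (auto simp: v_def indicator_def)
      qed
      show "(\<lambda>x. ennreal ((cmod (v n x))\<^sup>2)) \<in> borel_measurable \<mu>" for n
        using L2_measurable[OF v] by measurable
    qed
    also have "\<dots> \<le> ennreal (b\<^sup>2)"
    proof (rule SUP_least)
      fix n
      have "(\<integral>\<^sup>+x. ennreal ((cmod (v n x))\<^sup>2) \<partial>\<mu>) = ennreal ((L2_norm \<mu> (v n))\<^sup>2)"
        unfolding L2_norm_square by (rule nn_integral_eq_integral[OF L2_integrable[OF v]]) simp
      also have "\<dots> \<le> ennreal (b\<^sup>2)" using vb[of n] by (intro ennreal_leI power_mono) auto
      finally show "(\<integral>\<^sup>+x. ennreal ((cmod (v n x))\<^sup>2) \<partial>\<mu>) \<le> ennreal (b\<^sup>2)" .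
    qed
    finally have nn: "(\<integral>\<^sup>+x. ennreal ((cmod (u x))\<^sup>2) \<partial>\<mu>) \<le> ennreal (b\<^sup>2)" .
    have ui: "integrable \<mu> (\<lambda>x. (cmod (u x))\<^sup>2)"
      by (rule integrableI_nonneg) (use nn in \<open>auto intro: le_less_trans\<close>)
    have uL: "u \<in> L2 \<mu>" by (rule L2_I[OF um ui])
    have "f \<in> L2 \<mu>" using L2_add[OF uL h(1)] by (simp add: u_def[abs_def])
    moreover have "L2_norm \<mu> u \<le> b"
    proof -
      have "ennreal ((L2_norm \<mu> u)\<^sup>2) \<le> ennreal (b\<^sup>2)"
        unfolding L2_norm_square using nn by (subst nn_integral_eq_integral[OF ui, symmetric]) auto
      then have "(L2_norm \<mu> u)\<^sup>2 \<le> b\<^sup>2" by simp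
      then show ?thesis by (rule power2_le_imp_le) (simp add: b_def)
    qed
    ultimately show ?thesis
      using L2_norm_minus_commute[of \<mu> f h] L2_norm_minus_commute[of \<nu> F "fourier \<mu> h"]
      by (simp add: u_def[abs_def] b_def)
  qed
  have "\<exists>h\<in>L2 \<mu>. integrable \<mu> h \<and> L2_norm \<nu> (\<lambda>\<xi>. fourier \<mu> h \<xi> - F \<xi>) < 1 / real (Suc n)" for n
  proof -
    have "0 < 1 / real (Suc n)" by simp
    from fourier_closureE[OF F this] show ?thesis by blast
  qed
  then obtain h where h: "\<And>n. h n \<in> L2 \<mu>" "\<And>n. integrable \<mu> (h n)"
      "\<And>n. L2_norm \<nu> (\<lambda>\<xi>. fourier \<mu> (h n) \<xi> - F \<xi>) < 1 / real (Suc n)" by metis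
  have lim: "(\<lambda>n. 1 / real (Suc n)) \<longlonglongrightarrow> 0"
    using LIMSEQ_inverse_real_of_nat by (simp add: inverse_eq_divide)
  have 1: "(\<lambda>n. L2_norm \<nu> (\<lambda>\<xi>. fourier \<mu> (h n) \<xi> - F \<xi>)) \<longlonglongrightarrow> 0"
    by (rule tendsto_sandwich[OF _ _ tendsto_const lim]) (simp_all only: L2_norm_nonneg less_imp_le[OF h(3)] always_eventually simp_thms)
  have 2: "(\<lambda>n. L2_norm \<mu> (\<lambda>x. h n x - f x)) \<longlonglongrightarrow> 0"
    by (rule tendsto_sandwich[OF _ _ tendsto_const 1]) (use key[OF h(1,2)] in auto)
  show ?thesis
    unfolding has_fourier_L2_def f_def[abs_def, symmetric]
    using key[OF h(1)[of 0] h(2)[of 0]] FL h(1,2) fourier_L2(1)[OF h(1,2)] 1 2 by blast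
qed

end

text \<open>If every character were 1 at \<open>x\<close>, an indicator and its translate by
  \<open>x\<close> would have equal transforms. By the isometry their difference has norm zero,
  which is impossible when the two sets are disjoint and of positive measure.\<close>

lemma (in plancherel_pair) characters_separate:
  fixes x :: 'a
  assumes "x \<noteq> 0"
  shows "\<exists>\<xi>. eval_char \<xi> x \<noteq> 1"
proof (rule ccontr)
  assume "\<nexists>\<xi>. eval_char \<xi> x \<noteq> 1"
  then have triv: "eval_char \<xi> x = 1" for \<xi> by blast
  obtain U0 V0 where UV: "open U0" "open V0" "0 \<in> U0" "x \<in> V0" "U0 \<inter> V0 = {}"
    using hausdorff[of 0 x] assms by metis
  obtain U1 E where UE: "open U1" "compact E" "(0 :: 'a) \<in> U1" "U1 \<subseteq> E" by (rule compact_neighbourhood)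
  \<comment> \<open>Lying in \<open>U0\<close> and being shifted by \<open>x\<close> into
    \<open>V0\<close> makes \<open>U\<close> disjoint from its translate; lying in \<open>U1\<close>
    makes its measure finite.\<close>
  define U where "U = U0 \<inter> U1 \<inter> (+) x -` V0"
  have "open ((+) x -` V0)" by (intro open_vimage UV continuous_intros)
  then have U: "open U" "0 \<in> U" using UV UE by (auto simp: U_def)
  have Us: "U \<in> sets \<mu>" using U haar_sets[OF \<mu>] by simp
  have "emeasure \<mu> U \<le> emeasure \<mu> E"
    by (rule emeasure_mono[OF _ compact_sets_haar[OF \<mu> UE(2)]]) (use UE in \<open>auto simp: U_def\<close>)
  then have Uf: "emeasure \<mu> U < \<infinity>" using haar_compact_finite[OF \<mu> UE(2)] by (rule le_less_trans)
  have "0 < emeasure \<mu> U" using haar_open_pos[OF \<mu> U(1)] U(2) by auto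
  then have m: "0 < measure \<mu> U" using Uf by (simp add: measure_def enn2real_positive_iff)
  define u :: "'a \<Rightarrow> complex" where "u = indicator U"
  define f where "f y = u y + (- 1) * u (- x + y)" for y
  have uL: "u \<in> L2 \<mu>" unfolding u_def by (rule L2_indicator[OF Us Uf])
  have uI: "integrable \<mu> u"
    by (rule L2_integrable_bounded_support[OF uL Us Uf]) (simp add: u_def)
  have uxL: "(\<lambda>y. u (- x + y)) \<in> L2 \<mu>" by (rule L2_translate[OF \<mu> uL])
  have uxI: "integrable \<mu> (\<lambda>y. u (- x + y))"
    using haar_integrable_translate[OF \<mu> L2_measurable[OF uL]] uI by blast
  have fL: "f \<in> L2 \<mu>" and fI: "integrable \<mu> f"
    unfolding f_def[abs_def] by (intro L2_add L2_scale uL uxL) (use uI uxI in simp)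
  have "fourier \<mu> f \<xi> = 0" for \<xi>
    unfolding f_def[abs_def] fourier_add_scale[OF \<mu> uI uxI] fourier_translate[OF \<mu> L2_measurable[OF uL]]
    by (simp add: eval_char_uminus triv)
  then have "L2_norm \<mu> f = 0"
    using fourier_L2(2)[OF fL fI] by (simp add: L2_norm_def)
  moreover have "L2_norm \<mu> u \<le> L2_norm \<mu> f"
  proof (rule L2_norm_mono[OF fL L2_measurable[OF uL]], rule AE_I2)
    fix y
    have "\<not> (y \<in> U \<and> - x + y \<in> U)"
    proof
      assume "y \<in> U \<and> - x + y \<in> U"
      then have "y \<in> U0" "x + (- x + y) \<in> V0" by (auto simp: U_def)
      then show False using UV(5) by auto
    qed
    then show "cmod (u y) \<le> cmod (f y)" by (auto simp: f_def u_def indicator_def)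
  qed
  ultimately show False using m L2_norm_indicator[OF Us] by (simp add: u_def)
qed

subsection \<open>Discrete subgroups\<close>

lemma open_diff_neighbourhood:
  fixes U :: "'g::topological_ab_group_add set"
  assumes "open U" "0 \<in> U"
  obtains V where "open V" "0 \<in> V" "\<And>a b. a \<in> V \<Longrightarrow> b \<in> V \<Longrightarrow> a - b \<in> U"
proof -
  have "open ((\<lambda>p :: 'g \<times> 'g. fst p - snd p) -` U)"
    by (intro open_vimage assms continuous_intros)
  moreover have "(0, 0) \<in> (\<lambda>p :: 'g \<times> 'g. fst p - snd p) -` U" using assms by simp
  ultimately obtain A B where AB: "open A" "open B" "(0, 0) \<in> A \<times> B"
    "A \<times> B \<subseteq> (\<lambda>p :: 'g \<times> 'g. fst p - snd p) -` U"
    by (rule open_prod_elim)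
  show thesis
  proof (rule that)
    show "open (A \<inter> B)" "0 \<in> A \<inter> B" using AB by auto
    fix a b assume "a \<in> A \<inter> B" "b \<in> A \<inter> B"
    then have "(a, b) \<in> A \<times> B" by blast
    then show "a - b \<in> U" using AB(4) by fastforce
  qed
qed

lemma add_subgroup_diff: "add_subgroup S \<Longrightarrow> a \<in> S \<Longrightarrow> b \<in> S \<Longrightarrow> a - b \<in> S"
  unfolding add_subgroup_def by (metis add_uminus_conv_diff)

text \<open>Isolation of 0 becomes uniform by translation: two points of \<Lambda> in one translate
  of \<open>V\<close> differ by an element of a neighbourhood that meets \<Lambda> only in
  0.\<close>

lemma discrete_subgroup_separated:
  fixes \<Lambda> :: "'g::topological_ab_group_add set"
  assumes \<Lambda>: "add_subgroup \<Lambda>" and dis: "discrete \<Lambda>"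
  obtains V where "open V" "0 \<in> V"
    "\<And>x l m. l \<in> \<Lambda> \<Longrightarrow> m \<in> \<Lambda> \<Longrightarrow> l \<in> (+) x ` V \<Longrightarrow> m \<in> (+) x ` V \<Longrightarrow> l = m"
proof -
  have "0 \<in> \<Lambda>" using \<Lambda> by (simp add: add_subgroup_def)
  then obtain U where U: "open U" "U \<inter> \<Lambda> = {0}"
    using dis unfolding discrete_def isolated_in_def by blast
  then have "0 \<in> U" by blast
  then obtain V where V: "open V" "0 \<in> V" "\<And>a b. a \<in> V \<Longrightarrow> b \<in> V \<Longrightarrow> a - b \<in> U"
    using open_diff_neighbourhood[OF U(1)] by metis
  show thesis
  proof (rule that[OF V(1,2)])
    fix x l m assume lm: "l \<in> \<Lambda>" "m \<in> \<Lambda>" "l \<in> (+) x ` V" "m \<in> (+) x ` V"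
    then obtain a b where "l = x + a" "m = x + b" "a \<in> V" "b \<in> V" by blast
    then have "l - m \<in> U" using V(3)[of a b] by simp
    then have "l - m = 0" using add_subgroup_diff[OF \<Lambda> lm(1,2)] U(2) by blast
    then show "l = m" by simp
  qed
qed

lemma discrete_subgroup_finite_Int_compact:
  fixes \<Lambda> :: "'g::topological_ab_group_add set"
  assumes \<Lambda>: "add_subgroup \<Lambda>" and dis: "discrete \<Lambda>" and C: "compact C"
  shows "finite (\<Lambda> \<inter> C)"
proof -
  obtain V where V: "open V" "0 \<in> V"
    "\<And>x l m. l \<in> \<Lambda> \<Longrightarrow> m \<in> \<Lambda> \<Longrightarrow> l \<in> (+) x ` V \<Longrightarrow> m \<in> (+) x ` V \<Longrightarrow> l = m"
    by (rule discrete_subgroup_separated[OF \<Lambda> dis]) blast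
  have "C \<subseteq> (\<Union>x\<in>C. (+) x ` V)" using V(2) by force
  then obtain F where F: "F \<subseteq> C" "finite F" "C \<subseteq> (\<Union>x\<in>F. (+) x ` V)"
    using compactE_image[OF C, of C "\<lambda>x. (+) x ` V"] open_translate[OF V(1)] by blast
  have "finite (\<Lambda> \<inter> (+) x ` V)" for x
  proof (cases "\<Lambda> \<inter> (+) x ` V = {}")
    case False
    then obtain l where "l \<in> \<Lambda> \<inter> (+) x ` V" by blast
    then have "\<Lambda> \<inter> (+) x ` V \<subseteq> {l}" using V(3) by blast
    then show ?thesis by (rule finite_subset) simp
  qed simp
  then have "finite (\<Union>x\<in>F. \<Lambda> \<inter> (+) x ` V)" using F(2) by blast
  then show ?thesis by (rule finite_subset[rotated]) (use F(3) in blast)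
qed

text \<open>Such an \<open>l\<close> is a difference of points of \<open>C\<close> and
  \<open>D\<close>, hence lies in a compact set. This is what makes all sums over \<Lambda>
  finite.\<close>

lemma discrete_subgroup_finite_meeting:
  fixes \<Lambda> :: "'g::topological_ab_group_add set"
  assumes \<Lambda>: "add_subgroup \<Lambda>" "discrete \<Lambda>" and C: "compact C" and D: "compact D"
  shows "finite {l \<in> \<Lambda>. \<exists>\<xi>\<in>C. - l + \<xi> \<in> D}"
proof -
  have "compact ((\<lambda>p. fst p - snd p) ` (C \<times> D))"
    by (intro compact_continuous_image compact_Times C D continuous_intros)
  note fin = discrete_subgroup_finite_Int_compact[OF \<Lambda> this]
  have "{l \<in> \<Lambda>. \<exists>\<xi>\<in>C. - l + \<xi> \<in> D} \<subseteq> \<Lambda> \<inter> (\<lambda>p. fst p - snd p) ` (C \<times> D)"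
  proof safe
    fix l \<xi> assume "\<xi> \<in> C" "- l + \<xi> \<in> D"
    then show "l \<in> (\<lambda>p. fst p - snd p) ` (C \<times> D)"
      by (intro image_eqI[of _ _ "(\<xi>, - l + \<xi>)"]) simp_all
  qed
  then show ?thesis using fin by (rule finite_subset)
qed

text \<open>Discrete subgroups of a Hausdorff group are closed: near \<open>x\<close> there is at
  most one point of \<Lambda>, and it can be removed from the neighbourhood.\<close>

lemma discrete_subgroup_closed_at:
  fixes \<Lambda> :: "'g::{topological_ab_group_add,t2_space} set"
  assumes \<Lambda>: "add_subgroup \<Lambda>" "discrete \<Lambda>" and x: "x \<notin> \<Lambda>"
  obtains N where "open N" "0 \<in> N" "\<And>a. a \<in> N \<Longrightarrow> x + a \<notin> \<Lambda>"
proof -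
  obtain V where V: "open V" "0 \<in> V"
    "\<And>x l m. l \<in> \<Lambda> \<Longrightarrow> m \<in> \<Lambda> \<Longrightarrow> l \<in> (+) x ` V \<Longrightarrow> m \<in> (+) x ` V \<Longrightarrow> l = m"
    by (rule discrete_subgroup_separated[OF \<Lambda>]) blast
  show thesis
  proof (cases "\<exists>a\<in>V. x + a \<in> \<Lambda>")
    case False
    then show thesis using that[of V] V by blast
  next
    case True
    then obtain a where a: "a \<in> V" "x + a \<in> \<Lambda>" by blast
    show thesis
    proof (rule that)
      show "open (V - {a})" using V(1) by (intro open_Diff) auto
      show "0 \<in> V - {a}" using V(2) a x by auto
      fix b assume b: "b \<in> V - {a}"
      show "x + b \<notin> \<Lambda>"
      proof
        assume "x + b \<in> \<Lambda>"
        then have "x + b = x + a" using V(3)[of "x + b" "x + a" x] a b by blast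
        then show False using b by simp
      qed
    qed
  qed
qed

section \<open>Fundamental domains and the annihilator\<close>

locale sampling_lattice = plancherel_pair +
  fixes \<Lambda> D :: "'a dual set"
  assumes \<Lambda>: "add_subgroup \<Lambda>" "discrete \<Lambda>"
    and D: "compact D" and fd: "fundamental_domain \<nu> \<Lambda> D"
begin

lemma Ds [measurable]: "D \<in> sets \<nu>" by (rule compact_sets_haar[OF \<nu> D])

lemma Df: "emeasure \<nu> D < \<infinity>" by (rule haar_compact_finite[OF \<nu> D])

lemma indicator_D_L2: "indicator D \<in> L2 \<nu>" by (rule L2_indicator[OF Ds Df])

lemma AE_translate:
  assumes "AE \<xi> in \<nu>. P \<xi>"
  shows "AE \<xi> in \<nu>. P (\<eta> + \<xi>)"
  using AE_distrD[OF measurable_translate_haar[OF \<nu>, of \<eta>], of P] assms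
  unfolding distr_translate_haar[OF \<nu>] by blast

lemma AE_covered: "AE \<xi> in \<nu>. \<exists>l\<in>\<Lambda>. - l + \<xi> \<in> D"
proof -
  have "AE \<xi> in \<nu>. \<xi> \<in> (\<Union>l\<in>\<Lambda>. (+) l ` D)" using fd unfolding fundamental_domain_def by blast
  then show ?thesis
  proof eventually_elim
    case (elim \<xi>)
    then obtain l d where "l \<in> \<Lambda>" "d \<in> D" "\<xi> = l + d" by blast
    then show ?case by (intro bexI[of _ l]) simp_all
  qed
qed

text \<open>Restricted to finite \<open>S\<close> because null overlaps are given for each pair
  separately and \<Lambda> may be uncountable.\<close>

lemma AE_disjoint:
  assumes S: "finite S" "S \<subseteq> \<Lambda>"
  shows "AE \<xi> in \<nu>. \<forall>l\<in>S. \<forall>m\<in>S. l \<noteq> m \<longrightarrow> \<not> (- l + \<xi> \<in> D \<and> - m + \<xi> \<in> D)"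
proof -
  have "AE \<xi> in \<nu>. l \<noteq> m \<longrightarrow> \<not> (- l + \<xi> \<in> D \<and> - m + \<xi> \<in> D)" if lm: "l \<in> S" "m \<in> S" for l m
  proof (cases "l = m")
    case False
    have "(+) l ` D \<inter> (+) m ` D \<in> null_sets \<nu>"
      using fd S(2) lm False unfolding fundamental_domain_def by blast
    then have "AE \<xi> in \<nu>. \<xi> \<notin> (+) l ` D \<inter> (+) m ` D" by (rule AE_not_in)
    then show ?thesis unfolding translate_image_eq_vimage by eventually_elim simp
  qed simp
  then show ?thesis using S(1) by (intro AE_finite_allI) auto
qed

text \<open>Finitely many translates of \<open>D\<close> cover a given compact set almost
  everywhere; if \<open>D\<close> were null, so would be every compact set.\<close>

lemma measure_D_pos: "0 < measure \<nu> D"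
proof (rule ccontr)
  assume "\<not> 0 < measure \<nu> D"
  then have "measure \<nu> D = 0" by (simp add: not_less order_antisym)
  then have "emeasure \<nu> D = 0" using Df by (simp add: emeasure_eq_ennreal_measure less_top)
  then have D0: "AE \<xi> in \<nu>. \<xi> \<notin> D" by (intro AE_not_in null_setsI Ds)
  obtain C where C: "compact C" "emeasure \<nu> C \<noteq> 0" using haar_nontrivial[OF \<nu>] by blast
  define S where "S = {l \<in> \<Lambda>. \<exists>\<xi>\<in>C. - l + \<xi> \<in> D}"
  have S: "finite S" unfolding S_def by (rule discrete_subgroup_finite_meeting[OF \<Lambda> C(1) D])
  have "AE \<xi> in \<nu>. \<forall>l\<in>S. - l + \<xi> \<notin> D" by (intro AE_finite_allI[OF S] AE_translate[OF D0])
  then have "AE \<xi> in \<nu>. \<xi> \<notin> C"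
    using AE_covered by eventually_elim (auto simp: S_def)
  then have "C \<in> null_sets \<nu>" using AE_iff_null_sets[OF compact_sets_haar[OF \<nu> C(1)]] by blast
  then show False using C(2) by auto
qed

text \<open>The premise on \<xi> says that \<open>S\<close> already contains every translate through
  \<xi>, so the finite sum has the value of the full one, which need not be formed.\<close>

lemma AE_sum_translates:
  assumes S: "finite S" "S \<subseteq> \<Lambda>"
  shows "AE \<xi> in \<nu>. (\<forall>l\<in>\<Lambda>. - l + \<xi> \<in> D \<longrightarrow> l \<in> S) \<longrightarrow> (\<Sum>l\<in>S. indicator D (- l + \<xi>)) = (1 :: complex)"
  using AE_covered AE_disjoint[OF S]
proof eventually_elim
  case (elim \<xi>)
  show ?case
  proof
    assume "\<forall>l\<in>\<Lambda>. - l + \<xi> \<in> D \<longrightarrow> l \<in> S"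
    with elim(1) obtain k where k: "k \<in> S" "- k + \<xi> \<in> D" by blast
    have "(\<Sum>l\<in>S. indicator D (- l + \<xi>)) = (\<Sum>l\<in>S. if l = k then 1 else (0 :: complex))"
      using elim(2) k by (intro sum.cong) (auto simp: indicator_def)
    then show "(\<Sum>l\<in>S. indicator D (- l + \<xi>)) = (1 :: complex)" using S k by simp
  qed
qed

text \<open>Integration over \<open>D\<close> plays the role of Haar measure on the quotient by
  \<Lambda>. The set \<eta> + \<open>D\<close> is cut along the translates of \<open>D\<close>, the
  pieces are moved by elements of \<Lambda>, under which \<open>h\<close> is unchanged, and together
  they fill \<open>D\<close> again.\<close>

lemma periodic_integral_translate:
  fixes h :: "'a dual \<Rightarrow> complex"
  assumes hm [measurable]: "h \<in> borel_measurable \<nu>" and hb: "\<And>\<xi>. cmod (h \<xi>) \<le> B"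
    and per: "\<And>l \<xi>. l \<in> \<Lambda> \<Longrightarrow> h (l + \<xi>) = h \<xi>"
  shows "(LINT \<xi>|\<nu>. indicator D \<xi> * h (\<eta> + \<xi>)) = (LINT \<xi>|\<nu>. indicator D \<xi> * h \<xi>)"
proof -
  define d :: "'a dual \<Rightarrow> complex" where "d = indicator D"
  have dm [measurable]: "d \<in> borel_measurable \<nu>" unfolding d_def by measurable
  have tm: "(\<lambda>\<xi>. f (a + \<xi>)) \<in> borel_measurable \<nu>"
    if "f \<in> borel_measurable \<nu>" for f :: "'a dual \<Rightarrow> complex" and a
    by (rule haar_borel_measurable_translate[OF \<nu> that])
  have m1: "(\<lambda>\<xi>. d (- \<eta> + \<xi>) * h \<xi>) \<in> borel_measurable \<nu>"
    by (rule borel_measurable_times[OF tm[OF dm] hm])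
  have m2: "(\<lambda>\<xi>. (d (- \<eta> + \<xi>) * h \<xi>) * d (- l + \<xi>)) \<in> borel_measurable \<nu>" for l
    by (rule borel_measurable_times[OF m1 tm[OF dm]])
  have m3: "(\<lambda>\<xi>. d (- \<eta> + (l + \<xi>)) * h (k + \<xi>)) \<in> borel_measurable \<nu>" for k l
    by (rule borel_measurable_times[OF tm[OF tm[OF dm]] tm[OF hm]])
  have m4: "(\<lambda>\<xi>. d (- \<eta> + (l + \<xi>)) * h \<xi>) \<in> borel_measurable \<nu>" for l
    by (rule borel_measurable_times[OF tm[OF tm[OF dm]] hm])
  \<comment> \<open>The finitely many translates of \<open>D\<close> that meet \<eta> +
    \<open>D\<close>.\<close>
  define S where "S = {l \<in> \<Lambda>. \<exists>\<xi>\<in>(+) \<eta> ` D. - l + \<xi> \<in> D}"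
  have "compact ((+) \<eta> ` D)" by (intro compact_continuous_image D continuous_intros)
  then have Sf: "finite S" unfolding S_def by (rule discrete_subgroup_finite_meeting[OF \<Lambda> _ D])
  have S\<Lambda>: "S \<subseteq> \<Lambda>" by (auto simp: S_def)
  have ib: "integrable \<nu> (\<lambda>\<xi>. b \<xi> * d \<xi>)"
    if [measurable]: "b \<in> borel_measurable \<nu>" and "\<And>\<xi>. cmod (b \<xi>) \<le> C" for b C
  proof (rule integrableI_bounded_set[OF Ds _ Df, where B=C])
    show "AE \<xi> in \<nu>. \<xi> \<in> D \<longrightarrow> norm (b \<xi> * d \<xi>) \<le> C" using that(2) by (simp add: d_def)
  qed (simp_all add: d_def)
  have d1: "cmod (d \<xi>) \<le> 1" for \<xi> by (simp add: d_def indicator_def)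
  have b2: "cmod (d \<zeta> * h \<xi>) \<le> B" for \<zeta> \<xi>
    using mult_mono[OF d1 hb, of \<xi> \<zeta>] by (simp add: norm_mult)
  have t: "(LINT \<xi>|\<nu>. f (a + \<xi>)) = (LINT \<xi>|\<nu>. f \<xi>)" if "f \<in> borel_measurable \<nu>"
    for f :: "'a dual \<Rightarrow> complex" and a
    using haar_integral_translate[OF \<nu> that] by simp
  have "(LINT \<xi>|\<nu>. d \<xi> * h (\<eta> + \<xi>)) = (LINT \<xi>|\<nu>. d (- \<eta> + \<xi>) * h \<xi>)"
    using t[OF borel_measurable_times[OF dm tm[OF hm]], of "- \<eta>" \<eta>] by simp
  also have "\<dots> = (LINT \<xi>|\<nu>. (\<Sum>l\<in>S. (d (- \<eta> + \<xi>) * h \<xi>) * d (- l + \<xi>)))"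
  proof (rule integral_cong_AE)
    show "AE \<xi> in \<nu>. d (- \<eta> + \<xi>) * h \<xi> = (\<Sum>l\<in>S. (d (- \<eta> + \<xi>) * h \<xi>) * d (- l + \<xi>))"
      using AE_sum_translates[OF Sf S\<Lambda>]
    proof eventually_elim
      case (elim \<xi>)
      show ?case
      proof (cases "- \<eta> + \<xi> \<in> D")
        case True
        then have "\<eta> + (- \<eta> + \<xi>) \<in> (+) \<eta> ` D" by blast
        then have "\<forall>l\<in>\<Lambda>. - l + \<xi> \<in> D \<longrightarrow> l \<in> S" by (auto simp: S_def)
        with elim show ?thesis unfolding sum_distrib_left[symmetric] d_def by simp
      qed (simp add: d_def)
    qed
  qed (intro borel_measurable_sum m1 m2)+
  also have "\<dots> = (\<Sum>l\<in>S. LINT \<xi>|\<nu>. (d (- \<eta> + \<xi>) * h \<xi>) * d (- l + \<xi>))"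
  proof (rule Bochner_Integration.integral_sum)
    fix l
    have "integrable \<nu> (\<lambda>\<xi>. (d (- \<eta> + (l + \<xi>)) * h (l + \<xi>)) * d \<xi>)"
      by (rule ib[OF m3 b2])
    then show "integrable \<nu> (\<lambda>\<xi>. (d (- \<eta> + \<xi>) * h \<xi>) * d (- l + \<xi>))"
      using haar_integrable_translate[OF \<nu> m2, of l l] by simp
  qed
  also have "\<dots> = (\<Sum>l\<in>S. LINT \<xi>|\<nu>. (d (- \<eta> + (l + \<xi>)) * h \<xi>) * d \<xi>)"
  proof (rule sum.cong)
    fix l assume "l \<in> S"
    then have "h (l + \<xi>) = h \<xi>" for \<xi> using per S\<Lambda> by blast
    then show "(LINT \<xi>|\<nu>. (d (- \<eta> + \<xi>) * h \<xi>) * d (- l + \<xi>)) = (LINT \<xi>|\<nu>. (d (- \<eta> + (l + \<xi>)) * h \<xi>) * d \<xi>)"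
      using t[OF m2, of l l] by simp
  qed simp
  also have "\<dots> = (LINT \<xi>|\<nu>. (\<Sum>l\<in>S. (d (- \<eta> + (l + \<xi>)) * h \<xi>) * d \<xi>))"
    by (rule Bochner_Integration.integral_sum[symmetric], rule ib[OF m4 b2])
  also have "\<dots> = (LINT \<xi>|\<nu>. d \<xi> * h \<xi>)"
  proof (rule integral_cong_AE)
    \<comment> \<open>Reassembling expands 1 at the point \<open>- \<eta> + \<xi>\<close> with \<xi>
      in \<open>D\<close>; the translates through it are indexed by the negatives of elements of
      \<open>S\<close>.\<close>
    have "finite (uminus ` S)" "uminus ` S \<subseteq> \<Lambda>"
      using Sf S\<Lambda> \<Lambda>(1) by (auto simp: add_subgroup_def)
    from AE_translate[OF AE_sum_translates[OF this], of "- \<eta>"]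
    show "AE \<xi> in \<nu>. (\<Sum>l\<in>S. (d (- \<eta> + (l + \<xi>)) * h \<xi>) * d \<xi>) = d \<xi> * h \<xi>"
    proof eventually_elim
      case (elim \<xi>)
      show ?case
      proof (cases "\<xi> \<in> D")
        case True
        have "\<forall>l\<in>\<Lambda>. - l + (- \<eta> + \<xi>) \<in> D \<longrightarrow> l \<in> uminus ` S"
        proof (intro ballI impI)
          fix l assume l: "l \<in> \<Lambda>" "- l + (- \<eta> + \<xi>) \<in> D"
          have "- l + \<xi> = \<eta> + (- l + (- \<eta> + \<xi>))" by (simp add: algebra_simps)
          then have "- l + \<xi> \<in> (+) \<eta> ` D" using l(2) by blast
          moreover have "- (- l) + (- l + \<xi>) \<in> D" using True by simp
          moreover have "- l \<in> \<Lambda>" using l(1) \<Lambda>(1) by (simp add: add_subgroup_def)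
          ultimately have "- l \<in> S" unfolding S_def by blast
          then show "l \<in> uminus ` S" by (intro image_eqI[of _ _ "- l"]) simp_all
        qed
        with elim have "(\<Sum>l\<in>uminus ` S. d (- l + (- \<eta> + \<xi>))) = 1" by (simp add: d_def)
        then have "(\<Sum>l\<in>S. d (- \<eta> + (l + \<xi>))) = 1"
          by (subst (asm) sum.reindex) (simp_all add: algebra_simps)
        then show ?thesis unfolding sum_distrib_right[symmetric] by (simp add: mult.commute)
      qed (simp add: d_def)
    qed
  qed (intro borel_measurable_sum borel_measurable_times[OF m4 dm] borel_measurable_times[OF dm hm])+
  finally show ?thesis by (simp add: d_def)
qed

text \<open>Translation by \<eta> leaves the integral unchanged but also multiplies it by the value
  of \<eta> at \<open>x\<close>, which is not 1 for a suitable \<eta>.\<close>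

lemma annihilator_orthogonal:
  assumes x: "x \<in> annihilator \<Lambda>" "x \<noteq> 0"
  shows "(LINT \<xi>|\<nu>. indicator D \<xi> * eval_char \<xi> x) = 0"
proof -
  obtain \<eta> where \<eta>: "eval_char \<eta> x \<noteq> 1" using characters_separate[OF x(2)] by blast
  have "(LINT \<xi>|\<nu>. indicator D \<xi> * eval_char (\<eta> + \<xi>) x) = (LINT \<xi>|\<nu>. indicator D \<xi> * eval_char \<xi> x)"
    by (rule periodic_integral_translate[where B=1, OF borel_measurable_eval_char_dual[OF \<nu>]])
      (use x(1) in \<open>simp_all add: plus_dual.rep_eq annihilator_def\<close>)
  moreover have "(LINT \<xi>|\<nu>. indicator D \<xi> * eval_char (\<eta> + \<xi>) x)
      = eval_char \<eta> x * (LINT \<xi>|\<nu>. indicator D \<xi> * eval_char \<xi> x)"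
  proof -
    have "indicator D \<xi> * eval_char (\<eta> + \<xi>) x = eval_char \<eta> x * (indicator D \<xi> * eval_char \<xi> x)" for \<xi>
      by (simp add: plus_dual.rep_eq mult_ac)
    then have "(LINT \<xi>|\<nu>. indicator D \<xi> * eval_char (\<eta> + \<xi>) x)
        = (LINT \<xi>|\<nu>. eval_char \<eta> x * (indicator D \<xi> * eval_char \<xi> x))"
      by (rule Bochner_Integration.integral_cong[OF refl])
    then show ?thesis by simp
  qed
  ultimately show ?thesis using \<eta> by simp
qed


text \<open>\<open>D\<close> supplies compactness and positive measure: of finitely many small
  translates covering it, one meets it in positive measure, and inner regularity finds a compact set
  inside.\<close>

lemma compact_subset_small:
  assumes N: "open N" "0 \<in> N"
  obtains K where "compact K" "0 < measure \<nu> K" "\<And>a b. a \<in> K \<Longrightarrow> b \<in> K \<Longrightarrow> a - b \<in> N"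
proof -
  obtain V where V: "open V" "0 \<in> V" "\<And>a b. a \<in> V \<Longrightarrow> b \<in> V \<Longrightarrow> a - b \<in> N"
    by (rule open_diff_neighbourhood[OF N]) blast
  have "D \<subseteq> (\<Union>x\<in>D. (+) x ` V)" using V(2) by force
  then obtain F where F: "F \<subseteq> D" "finite F" "D \<subseteq> (\<Union>x\<in>F. (+) x ` V)"
    using compactE_image[OF D, of D "\<lambda>x. (+) x ` V"] open_translate[OF V(1)] by blast
  have Vs: "(+) x ` V \<in> sets \<nu>" for x using open_translate[OF V(1)] haar_sets[OF \<nu>] by simp
  have "\<exists>x\<in>F. D \<inter> (+) x ` V \<notin> null_sets \<nu>"
  proof (rule ccontr)
    assume "\<not> ?thesis"
    then have "(\<Union>x\<in>F. D \<inter> (+) x ` V) \<in> null_sets \<nu>"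
      using F(2) by (intro null_sets_UN' countable_finite) auto
    moreover have "(\<Union>x\<in>F. D \<inter> (+) x ` V) = D" using F(3) by blast
    ultimately show False using measure_D_pos by (simp add: null_sets_def measure_def)
  qed
  then obtain x where x: "D \<inter> (+) x ` V \<notin> null_sets \<nu>" by blast
  define A where "A = D \<inter> (+) x ` V"
  have As: "A \<in> sets \<nu>" unfolding A_def by (rule sets.Int[OF Ds Vs])
  have "emeasure \<nu> A \<le> emeasure \<nu> D" by (rule emeasure_mono[OF _ Ds]) (simp add: A_def)
  then have "emeasure \<nu> A < \<infinity>" using Df by (rule le_less_trans)
  then have Af: "A \<in> fmeasurable \<nu>" using As by (simp add: fmeasurable_def)
  have "emeasure \<nu> A \<noteq> 0" using x As by (simp add: A_def null_sets_def)
  then have Apos: "0 < measure \<nu> A"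
    using Af by (simp add: emeasure_eq_measure2 zero_less_measure_iff)
  obtain K where K: "compact K" "K \<subseteq> A" "measure \<nu> (A - K) < measure \<nu> A"
    using haar_inner_regular[OF \<nu> Af Apos] by blast
  have Kf: "K \<in> fmeasurable \<nu>"
    using compact_sets_haar[OF \<nu> K(1)] haar_compact_finite[OF \<nu> K(1)] by (simp add: fmeasurable_def)
  show thesis
  proof (rule that[OF K(1)])
    have "measure \<nu> (A - K) = measure \<nu> A - measure \<nu> K"
      using K(2) Af Kf by (intro measure_Diff) (auto simp: fmeasurable_def)
    then show "0 < measure \<nu> K" using K(3) by simp
    fix a b assume "a \<in> K" "b \<in> K"
    then obtain v w where "a = x + v" "b = x + w" "v \<in> V" "w \<in> V"
      using K(2) unfolding A_def by blast
    then show "a - b \<in> N" using V(3)[of v w] by simp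
  qed
qed

text \<open>
  If \<open>\<xi>0 \<notin> \<Lambda>\<close> were trivial on the annihilator then, up to the finite measure
  \<open>|\<phi>|\<^sup>2 \<mu>\<close>, it could be approximated by combinations of characters in \<open>\<Lambda>\<close>; but \<open>\<xi>0 \<phi>\<close> is orthogonal to
  all \<open>\<lambda> \<phi>\<close> when the transform of \<open>\<phi>\<close> lives on a small set.
\<close>

lemma annihilator_separates:
  assumes \<xi>0: "\<xi>0 \<notin> \<Lambda>"
  shows "\<exists>x\<in>annihilator \<Lambda>. eval_char \<xi>0 x \<noteq> 1"
proof (rule ccontr)
  assume "\<not> ?thesis"
  then have triv: "eval_char \<xi>0 x = 1" if "x \<in> annihilator \<Lambda>" for x using that by blast
  obtain N where N: "open N" "0 \<in> N" "\<And>a. a \<in> N \<Longrightarrow> \<xi>0 + a \<notin> \<Lambda>"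
    by (rule discrete_subgroup_closed_at[OF \<Lambda> \<xi>0]) blast
  obtain K where K: "compact K" "0 < measure \<nu> K" "\<And>a b. a \<in> K \<Longrightarrow> b \<in> K \<Longrightarrow> a - b \<in> N"
    by (rule compact_subset_small[OF N(1,2)]) blast
  \<comment> \<open>Translating the indicator of \<open>K\<close> by \<psi> multiplies \<phi> by the
    character \<psi>, so inner products of such functions are measured by overlaps of translates of
    \<open>K\<close>.\<close>
  define \<phi> where "\<phi> x = (LINT \<xi>|\<nu>. indicator K \<xi> * eval_char \<xi> x)" for x
  have synth: "has_fourier_L2 \<mu> \<nu> (\<lambda>x. eval_char \<psi> x * \<phi> x) (indicator ((+) \<psi> ` K))" for \<psi>
  proof -
    have c: "compact ((+) \<psi> ` K)" by (intro compact_continuous_image K continuous_intros)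
    have "has_fourier_L2 \<mu> \<nu> (\<lambda>x. LINT \<xi>|\<nu>. indicator ((+) \<psi> ` K) \<xi> * eval_char \<xi> x) (indicator ((+) \<psi> ` K))"
      by (rule has_fourier_L2_synthesis[OF indicator_compact_in_closure[OF c] c]) simp
    moreover have "(LINT \<xi>|\<nu>. indicator ((+) \<psi> ` K) \<xi> * eval_char \<xi> x) = eval_char \<psi> x * \<phi> x" for x
    proof -
      have m: "(\<lambda>\<xi>. indicator ((+) \<psi> ` K) \<xi> * eval_char \<xi> x) \<in> borel_measurable \<nu>"
        by (intro borel_measurable_times borel_measurable_indicator compact_sets_haar[OF \<nu> c]
            borel_measurable_eval_char_dual[OF \<nu>])
      have "(LINT \<xi>|\<nu>. indicator ((+) \<psi> ` K) \<xi> * eval_char \<xi> x)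
          = (LINT \<xi>|\<nu>. indicator ((+) \<psi> ` K) (\<psi> + \<xi>) * eval_char (\<psi> + \<xi>) x)"
        by (rule haar_integral_translate[OF \<nu> m, symmetric])
      also have "\<dots> = (LINT \<xi>|\<nu>. eval_char \<psi> x * (indicator K \<xi> * eval_char \<xi> x))"
        by (rule Bochner_Integration.integral_cong[OF refl]) (auto simp: plus_dual.rep_eq indicator_def)
      finally show ?thesis by (simp add: \<phi>_def)
    qed
    ultimately show ?thesis by simp
  qed
  have \<phi>L: "\<phi> \<in> L2 \<mu>" using synth[of 0] by (simp add: has_fourier_L2_def zero_dual.rep_eq)
  have \<xi>0\<phi>L: "(\<lambda>x. eval_char \<psi> x * \<phi> x) \<in> L2 \<mu>" for \<psi> using synth[of \<psi>] by (simp add: has_fourier_L2_def)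
  \<comment> \<open>A common point of \<open>l + K\<close> and \<open>\<xi>0 + K\<close> would put
    \<open>l\<close> into \<open>\<xi>0 + N\<close>, which avoids \<Lambda>.\<close>
  have orth: "L2_inner \<mu> (\<lambda>x. eval_char l x * \<phi> x) (\<lambda>x. eval_char \<xi>0 x * \<phi> x) = 0" if l: "l \<in> \<Lambda>" for l
  proof -
    have z: "indicator ((+) l ` K) \<xi> * cnj (indicator ((+) \<xi>0 ` K) \<xi>) = (0 :: complex)" for \<xi>
    proof -
      have "\<not> (\<xi> \<in> (+) l ` K \<and> \<xi> \<in> (+) \<xi>0 ` K)"
      proof
        assume "\<xi> \<in> (+) l ` K \<and> \<xi> \<in> (+) \<xi>0 ` K"
        then obtain a b where ab: "\<xi> = l + a" "\<xi> = \<xi>0 + b" "a \<in> K" "b \<in> K" by blast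
        then have "l = \<xi>0 + (b - a)" by (metis add_diff_cancel_right' add_diff_eq)
        then show False using N(3)[OF K(3)[OF ab(4,3)]] l by simp
      qed
      then show ?thesis by (auto simp: indicator_def)
    qed
    have "L2_inner \<nu> (indicator ((+) l ` K)) (indicator ((+) \<xi>0 ` K)) = 0"
      unfolding L2_inner_def z by simp
    then show ?thesis using has_fourier_L2_inner[OF synth[of l] synth[of \<xi>0]] by simp
  qed
  note cf = char_family_eval_char[OF \<Lambda>(1)]
  have orth_span: "L2_inner \<mu> (\<lambda>x. p x * \<phi> x) (\<lambda>x. eval_char \<xi>0 x * \<phi> x) = 0"
    if "p \<in> trig_span \<Lambda> eval_char" for p
    using that
  proof (induction rule: trig_span.induct)
    case zero
    show ?case by (simp add: L2_inner_def)
  next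
    case (step p l c)
    have "L2_inner \<mu> (\<lambda>x. p x * \<phi> x + c * (eval_char l x * \<phi> x)) (\<lambda>x. eval_char \<xi>0 x * \<phi> x) = 0"
      using L2_inner_add_left[OF trig_span_mult_L2[OF \<mu> cf step.hyps(1) \<phi>L] L2_scale[OF \<xi>0\<phi>L] \<xi>0\<phi>L]
        step.IH orth[OF step.hyps(2)] by (simp add: L2_inner_scale_left)
    then show ?case by (simp add: distrib_right mult.assoc)
  qed
  \<comment> \<open>By \<open>triv\<close> the character \<xi>0 is constant on cosets of the
    annihilator, so \<Lambda> separates \<open>A\<close> from its complement. On \<open>A\<close>
    its real part is positive, which makes the real part of the pairing below the integral of a
    nonnegative function.\<close>
  define A where "A = {x. 1 / 2 < Re (eval_char \<xi>0 x)}"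
  have Ao: "open A" unfolding A_def by (intro open_Collect_less continuous_intros eval_char_cont)
  have As [measurable]: "A \<in> sets \<mu>" using Ao haar_sets[OF \<mu>] by simp
  note [measurable] = L2_measurable[OF \<phi>L] borel_measurable_haar[OF \<mu> eval_char_cont]
  define \<phi>A where "\<phi>A x = indicator A x * \<phi> x" for x
  have \<phi>AL: "\<phi>A \<in> L2 \<mu>"
    unfolding \<phi>A_def[abs_def] by (rule L2_mult_bounded[OF \<phi>L, where C=1]) (auto simp: indicator_def)
  have "cmod (L2_inner \<mu> \<phi>A (\<lambda>x. eval_char \<xi>0 x * \<phi> x)) \<le> 0"
  proof (rule field_le_epsilon)
    fix e :: real assume e: "0 < e"
    define n where "n = L2_norm \<mu> (\<lambda>x. eval_char \<xi>0 x * \<phi> x) + 1"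
    have n: "0 < n" "L2_norm \<mu> (\<lambda>x. eval_char \<xi>0 x * \<phi> x) \<le> n"
      by (simp_all add: n_def add_nonneg_pos)
    have "\<exists>p\<in>trig_span \<Lambda> eval_char. L2_norm \<mu> (\<lambda>x. p x * \<phi> x - indicator A x * \<phi> x) < e / n"
    proof (rule trig_approx_indicator[OF \<mu> \<phi>L cf As])
      show "UNIV \<in> sets \<mu>" using sets.top[of \<mu>] haar_space[OF \<mu>] by simp
      show "\<exists>i\<in>\<Lambda>. eval_char i x \<noteq> eval_char i y" if "x \<in> A \<inter> UNIV" "y \<in> UNIV - A" for x y
      proof (rule ccontr)
        assume "\<not> ?thesis"
        then have "x - y \<in> annihilator \<Lambda>" by (simp add: annihilator_def eval_char_diff)
        then have "eval_char \<xi>0 x * cnj (eval_char \<xi>0 y) = 1" using triv[of "x - y"] by (simp add: eval_char_diff)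
        then have "eval_char \<xi>0 x * (cnj (eval_char \<xi>0 y) * eval_char \<xi>0 y) = eval_char \<xi>0 y"
          by (simp only: mult.assoc[symmetric] mult_1)
        then have "eval_char \<xi>0 x = eval_char \<xi>0 y" by simp
        then show False using that by (simp add: A_def)
      qed
    qed (use e n in auto)
    then obtain p where p: "p \<in> trig_span \<Lambda> eval_char" "L2_norm \<mu> (\<lambda>x. p x * \<phi> x - \<phi>A x) < e / n"
      unfolding \<phi>A_def by blast
    have pL: "(\<lambda>x. p x * \<phi> x) \<in> L2 \<mu>" by (rule trig_span_mult_L2[OF \<mu> cf p(1) \<phi>L])
    have "cmod (L2_inner \<mu> \<phi>A (\<lambda>x. eval_char \<xi>0 x * \<phi> x))
        = cmod (L2_inner \<mu> (\<lambda>x. p x * \<phi> x - \<phi>A x) (\<lambda>x. eval_char \<xi>0 x * \<phi> x))"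
      unfolding L2_inner_diff_left[OF pL \<phi>AL \<xi>0\<phi>L] orth_span[OF p(1)] by simp
    also have "\<dots> \<le> L2_norm \<mu> (\<lambda>x. p x * \<phi> x - \<phi>A x) * L2_norm \<mu> (\<lambda>x. eval_char \<xi>0 x * \<phi> x)"
      by (rule L2_Cauchy_Schwarz[OF L2_diff[OF pL \<phi>AL] \<xi>0\<phi>L])
    also have "\<dots> \<le> e / n * n"
      using p(2) n e by (intro mult_mono) auto
    finally show "cmod (L2_inner \<mu> \<phi>A (\<lambda>x. eval_char \<xi>0 x * \<phi> x)) \<le> 0 + e" using n by simp
  qed
  then have 0: "L2_inner \<mu> \<phi>A (\<lambda>x. eval_char \<xi>0 x * \<phi> x) = 0" by simp
  define r where "r x = indicator A x * (Re (eval_char \<xi>0 x) * (cmod (\<phi> x))\<^sup>2)" for x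
  have r: "Re (\<phi>A x * cnj (eval_char \<xi>0 x * \<phi> x)) = r x" for x
  proof -
    have 1: "\<phi>A x * cnj (eval_char \<xi>0 x * \<phi> x)
        = complex_of_real (indicator A x) * (complex_of_real ((cmod (\<phi> x))\<^sup>2) * cnj (eval_char \<xi>0 x))"
      unfolding complex_norm_square by (simp add: \<phi>A_def mult_ac indicator_def)
    show ?thesis unfolding 1 by (simp add: r_def del: of_real_power)
  qed
  have ri: "integrable \<mu> r"
    using integrable_Re[OF L2_mult_integrable[OF \<phi>AL \<xi>0\<phi>L[of \<xi>0]]] by (simp only: r)
  have r0: "0 \<le> r x" for x by (simp add: r_def indicator_def A_def)
  have "(LINT x|\<mu>. r x) = 0"
  proof -
    have "(LINT x|\<mu>. r x) = Re (L2_inner \<mu> \<phi>A (\<lambda>x. eval_char \<xi>0 x * \<phi> x))"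
      unfolding L2_inner_def integral_Re[symmetric, OF L2_mult_integrable[OF \<phi>AL \<xi>0\<phi>L[of \<xi>0]]] by (simp only: r)
    then show ?thesis using 0 by simp
  qed
  then have "AE x in \<mu>. r x = 0"
    using integral_nonneg_eq_0_iff_AE[OF ri] r0 by simp
  moreover have Ki: "integrable \<nu> (indicator K :: _ \<Rightarrow> complex)"
  proof -
    note Ks = compact_sets_haar[OF \<nu> K(1)] haar_compact_finite[OF \<nu> K(1)]
    show ?thesis
      by (rule L2_integrable_bounded_support[OF L2_indicator[OF Ks] Ks]) (simp add: indicator_def)
  qed
  have \<phi>c: "continuous_on UNIV \<phi>"
    unfolding \<phi>_def[abs_def] by (rule synthesis_continuous[OF lc \<nu> Ki _ K(1)]) simp
  \<comment> \<open>Here \<open>r\<close> does not vanish. The set is open since \<phi> is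
    continuous, and contains 0 since \<open>\<phi> 0\<close> is the measure of \<open>K\<close>; so
    it cannot be null.\<close>
  define U where "U = A \<inter> {x. \<phi> x \<noteq> 0}"
  have "open U" unfolding U_def
    by (intro open_Int Ao open_Collect_neq \<phi>c continuous_on_const)
  have "0 \<in> U"
  proof -
    have "\<phi> 0 = complex_of_real (measure \<nu> K)"
      by (simp add: \<phi>_def haar_space[OF \<nu>] integral_indicator_complex)
    then show ?thesis using K(2) by (simp add: U_def A_def)
  qed
  have "r x \<noteq> 0" if "x \<in> U" for x using that by (auto simp: U_def A_def r_def)
  ultimately have "AE x in \<mu>. x \<notin> U" by (auto elim: eventually_mono)
  then have "U \<in> null_sets \<mu>"
    using AE_iff_null_sets[of U \<mu>] \<open>open U\<close> haar_sets[OF \<mu>] by auto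
  moreover have "0 < emeasure \<mu> U" using haar_open_pos[OF \<mu> \<open>open U\<close>] \<open>0 \<in> U\<close> by blast
  ultimately show False by auto
qed

lemma add_subgroup_annihilator: "add_subgroup (annihilator \<Lambda>)"
  unfolding add_subgroup_def annihilator_def by (simp add: eval_char_add eval_char_uminus)

lemma annihilator_family: "char_family (annihilator \<Lambda>) (\<lambda>x \<xi>. eval_char \<xi> x)"
  by (rule char_family_eval_point[OF add_subgroup_annihilator])

section \<open>Completeness of the annihilator characters on the fundamental domain\<close>

definition band_closure :: "('a dual \<Rightarrow> complex) set" where
  "band_closure = {F \<in> L2 \<nu>. \<forall>\<epsilon>>0. \<exists>p\<in>trig_span (annihilator \<Lambda>) (\<lambda>x \<xi>. eval_char \<xi> x).
     L2_norm \<nu> (\<lambda>\<xi>. p \<xi> * indicator D \<xi> - F \<xi>) < \<epsilon>}"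

lemma band_closure_L2: "F \<in> band_closure \<Longrightarrow> F \<in> L2 \<nu>"
  unfolding band_closure_def by simp

lemma band_closureE:
  assumes "F \<in> band_closure" "0 < \<epsilon>"
  obtains p where "p \<in> trig_span (annihilator \<Lambda>) (\<lambda>x \<xi>. eval_char \<xi> x)"
    "L2_norm \<nu> (\<lambda>\<xi>. p \<xi> * indicator D \<xi> - F \<xi>) < \<epsilon>"
proof -
  have "\<forall>\<epsilon>>0. \<exists>p\<in>trig_span (annihilator \<Lambda>) (\<lambda>x \<xi>. eval_char \<xi> x).
     L2_norm \<nu> (\<lambda>\<xi>. p \<xi> * indicator D \<xi> - F \<xi>) < \<epsilon>"
    using assms(1) unfolding band_closure_def by simp
  from this[rule_format, OF assms(2)] show thesis using that by blast
qed

lemma trig_indicator_L2: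
  "p \<in> trig_span (annihilator \<Lambda>) (\<lambda>x \<xi>. eval_char \<xi> x) \<Longrightarrow> (\<lambda>\<xi>. p \<xi> * indicator D \<xi>) \<in> L2 \<nu>"
  by (rule trig_span_mult_L2[OF \<nu> annihilator_family _ indicator_D_L2])

lemma band_closure_closed:
  assumes F: "F \<in> L2 \<nu>" and "\<And>\<epsilon>. 0 < \<epsilon> \<Longrightarrow> \<exists>G\<in>band_closure. L2_norm \<nu> (\<lambda>\<xi>. G \<xi> - F \<xi>) < \<epsilon>"
  shows "F \<in> band_closure"
  unfolding band_closure_def
proof (intro CollectI conjI allI impI F)
  fix \<epsilon> :: real assume "0 < \<epsilon>"
  then obtain G where G: "G \<in> band_closure" "L2_norm \<nu> (\<lambda>\<xi>. G \<xi> - F \<xi>) < \<epsilon> / 2"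
    using assms(2)[of "\<epsilon> / 2"] by auto
  obtain p where p: "p \<in> trig_span (annihilator \<Lambda>) (\<lambda>x \<xi>. eval_char \<xi> x)"
      "L2_norm \<nu> (\<lambda>\<xi>. p \<xi> * indicator D \<xi> - G \<xi>) < \<epsilon> / 2"
    by (rule band_closureE[OF G(1) half_gt_zero[OF \<open>0 < \<epsilon>\<close>]])
  from L2_norm_dist_triangle[OF trig_indicator_L2[OF p(1)] band_closure_L2[OF G(1)] F] p G(2)
  show "\<exists>p\<in>trig_span (annihilator \<Lambda>) (\<lambda>x \<xi>. eval_char \<xi> x).
      L2_norm \<nu> (\<lambda>\<xi>. p \<xi> * indicator D \<xi> - F \<xi>) < \<epsilon>"
    by (intro bexI[of _ p]) auto
qed

lemma band_closure_add:
  assumes F: "F \<in> band_closure" and G: "G \<in> band_closure"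
  shows "(\<lambda>\<xi>. F \<xi> + G \<xi>) \<in> band_closure"
  unfolding band_closure_def
proof (intro CollectI conjI allI impI)
  note L = band_closure_L2[OF F] band_closure_L2[OF G]
  show "(\<lambda>\<xi>. F \<xi> + G \<xi>) \<in> L2 \<nu>" using L by (rule L2_add)
  fix \<epsilon> :: real assume "0 < \<epsilon>"
  then have e: "0 < \<epsilon> / 2" by simp
  obtain p where p: "p \<in> trig_span (annihilator \<Lambda>) (\<lambda>x \<xi>. eval_char \<xi> x)"
      "L2_norm \<nu> (\<lambda>\<xi>. p \<xi> * indicator D \<xi> - F \<xi>) < \<epsilon> / 2"
    by (rule band_closureE[OF F e])
  obtain q where q: "q \<in> trig_span (annihilator \<Lambda>) (\<lambda>x \<xi>. eval_char \<xi> x)"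
      "L2_norm \<nu> (\<lambda>\<xi>. q \<xi> * indicator D \<xi> - G \<xi>) < \<epsilon> / 2"
    by (rule band_closureE[OF G e])
  have "L2_norm \<nu> (\<lambda>\<xi>. (p \<xi> * indicator D \<xi> - F \<xi>) + (q \<xi> * indicator D \<xi> - G \<xi>)) < \<epsilon>"
    using L2_norm_triangle[OF L2_diff[OF trig_indicator_L2[OF p(1)] L(1)] L2_diff[OF trig_indicator_L2[OF q(1)] L(2)]]
      p(2) q(2) by linarith
  then have "L2_norm \<nu> (\<lambda>\<xi>. (p \<xi> + q \<xi>) * indicator D \<xi> - (F \<xi> + G \<xi>)) < \<epsilon>"
    by (simp add: algebra_simps)
  then show "\<exists>p\<in>trig_span (annihilator \<Lambda>) (\<lambda>x \<xi>. eval_char \<xi> x).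
      L2_norm \<nu> (\<lambda>\<xi>. p \<xi> * indicator D \<xi> - (F \<xi> + G \<xi>)) < \<epsilon>"
    using trig_span_add[OF p(1) q(1)] by (intro bexI[of _ "\<lambda>\<xi>. p \<xi> + q \<xi>"])
qed

lemma band_closure_scale:
  assumes F: "F \<in> band_closure"
  shows "(\<lambda>\<xi>. c * F \<xi>) \<in> band_closure"
  unfolding band_closure_def
proof (intro CollectI conjI allI impI L2_scale[OF band_closure_L2[OF F]])
  fix \<epsilon> :: real assume e: "0 < \<epsilon>"
  have c: "0 < cmod c + 1" by (simp add: add_nonneg_pos)
  have "0 < \<epsilon> / (cmod c + 1)" using e c by simp
  then obtain p where p: "p \<in> trig_span (annihilator \<Lambda>) (\<lambda>x \<xi>. eval_char \<xi> x)"
      "L2_norm \<nu> (\<lambda>\<xi>. p \<xi> * indicator D \<xi> - F \<xi>) < \<epsilon> / (cmod c + 1)"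
    by (rule band_closureE[OF F])
  have "L2_norm \<nu> (\<lambda>\<xi>. c * (p \<xi> * indicator D \<xi> - F \<xi>)) \<le> (cmod c + 1) * L2_norm \<nu> (\<lambda>\<xi>. p \<xi> * indicator D \<xi> - F \<xi>)"
    unfolding L2_norm_scale by (intro mult_right_mono) auto
  also have "\<dots> < \<epsilon>" using p(2) c by (simp add: less_divide_eq mult.commute)
  finally have "L2_norm \<nu> (\<lambda>\<xi>. (c * p \<xi>) * indicator D \<xi> - c * F \<xi>) < \<epsilon>"
    by (simp add: right_diff_distrib mult.assoc)
  then show "\<exists>p\<in>trig_span (annihilator \<Lambda>) (\<lambda>x \<xi>. eval_char \<xi> x).
      L2_norm \<nu> (\<lambda>\<xi>. p \<xi> * indicator D \<xi> - c * F \<xi>) < \<epsilon>"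
    using trig_span_scale[OF p(1)] by (intro bexI[of _ "\<lambda>\<xi>. c * p \<xi>"])
qed

lemma band_closure_sum:
  "(\<And>t. t \<in> T \<Longrightarrow> F t \<in> band_closure) \<Longrightarrow> (\<lambda>\<xi>. \<Sum>t\<in>T. F t \<xi>) \<in> band_closure"
proof (induction T rule: infinite_finite_induct)
  case (insert t T)
  then show ?case using band_closure_add[of "F t" "\<lambda>\<xi>. \<Sum>t\<in>T. F t \<xi>"] by simp
qed (auto simp: band_closure_def L2_norm_def intro!: bexI[OF _ trig_span.zero])

text \<open>Removing from \<open>D\<close> its overlaps with the finitely many nonzero translates
  that meet it leaves \<open>N\<close>, which carries \<open>D\<close> up to a null set and has no
  two distinct points congruent modulo \<Lambda>. By \<open>annihilator_separates\<close> the
  annihilator then separates all points of \<open>N\<close>.\<close>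

lemma indicator_band_closure:
  assumes A: "A \<in> sets \<nu>"
  shows "(\<lambda>\<xi>. indicator A \<xi> * indicator D \<xi>) \<in> band_closure"
  unfolding band_closure_def
proof (intro CollectI conjI allI impI)
  show "(\<lambda>\<xi>. indicator A \<xi> * indicator D \<xi>) \<in> L2 \<nu>"
    using A by (intro L2_mult_bounded[OF indicator_D_L2, where C=1]) (auto simp: indicator_def)
  fix \<epsilon> :: real assume e: "0 < \<epsilon>"
  define S where "S = {l \<in> \<Lambda>. \<exists>\<xi>\<in>D. - l + \<xi> \<in> D}"
  have S: "finite S" unfolding S_def by (rule discrete_subgroup_finite_meeting[OF \<Lambda> D D])
  define N where "N = D - (\<Union>l\<in>S - {0}. (+) l ` D)"
  have Ns: "N \<in> sets \<nu>" unfolding N_def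
    using S compact_sets_haar[OF \<nu>] D
    by (intro sets.Diff Ds sets.finite_UN) (auto intro!: compact_sets_haar[OF \<nu>] compact_continuous_image continuous_intros)
  have "0 \<in> \<Lambda>" using \<Lambda>(1) by (simp add: add_subgroup_def)
  then have "AE \<xi> in \<nu>. \<forall>l\<in>insert 0 S. \<forall>m\<in>insert 0 S. l \<noteq> m \<longrightarrow> \<not> (- l + \<xi> \<in> D \<and> - m + \<xi> \<in> D)"
    using S by (intro AE_disjoint) (auto simp: S_def)
  then have DN: "AE \<xi> in \<nu>. (indicator D \<xi> :: complex) \<noteq> 0 \<longrightarrow> \<xi> \<in> N"
  proof eventually_elim
    case (elim \<xi>)
    have "\<xi> \<notin> (+) l ` D" if "\<xi> \<in> D" "l \<in> S" "l \<noteq> 0" for l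
      using elim that unfolding translate_image_eq_vimage by force
    then show ?case by (auto simp: N_def indicator_def)
  qed
  show "\<exists>p\<in>trig_span (annihilator \<Lambda>) (\<lambda>x \<xi>. eval_char \<xi> x).
      L2_norm \<nu> (\<lambda>\<xi>. p \<xi> * indicator D \<xi> - indicator A \<xi> * indicator D \<xi>) < \<epsilon>"
  proof (rule trig_approx_indicator[OF \<nu> indicator_D_L2 annihilator_family A Ns DN _ e])
    fix \<xi> \<psi> assume \<xi>\<psi>: "\<xi> \<in> A \<inter> N" "\<psi> \<in> N - A"
    have "\<xi> - \<psi> \<notin> \<Lambda>"
    proof
      assume l: "\<xi> - \<psi> \<in> \<Lambda>"
      have "- (\<xi> - \<psi>) + \<xi> \<in> D" "\<xi> \<in> D" using \<xi>\<psi> by (simp_all add: N_def)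
      then have "\<xi> - \<psi> \<in> S" using l unfolding S_def by blast
      moreover have "\<xi> - \<psi> \<noteq> 0" using \<xi>\<psi> by auto
      moreover have "\<xi> \<in> (+) (\<xi> - \<psi>) ` D"
        unfolding translate_image_eq_vimage using \<open>- (\<xi> - \<psi>) + \<xi> \<in> D\<close> by simp
      ultimately show False using \<xi>\<psi> unfolding N_def by blast
    qed
    then obtain x where x: "x \<in> annihilator \<Lambda>" "eval_char (\<xi> - \<psi>) x \<noteq> 1"
      using annihilator_separates by blast
    then have "eval_char \<xi> x \<noteq> eval_char \<psi> x" by (auto simp: eval_char_dual_diff)
    then show "\<exists>x\<in>annihilator \<Lambda>. eval_char \<xi> x \<noteq> eval_char \<psi> x" using x(1) by blast
  qed
qed

lemma band_closure_all:
  assumes F: "F \<in> L2 \<nu>" and FD: "AE \<xi> in \<nu>. \<xi> \<notin> D \<longrightarrow> F \<xi> = 0"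
  shows "F \<in> band_closure"
proof -
  from borel_measurable_implies_sequence_metric[OF L2_measurable[OF F], of 0]
  obtain s where s': "\<forall>i. simple_function \<nu> (s i)" "\<forall>x\<in>space \<nu>. (\<lambda>i. s i x) \<longlonglongrightarrow> F x"
      "\<forall>i. \<forall>x\<in>space \<nu>. dist (s i x) 0 \<le> 2 * dist (F x) 0"
    by blast
  have s: "simple_function \<nu> (s i)" "(\<lambda>i. s i x) \<longlonglongrightarrow> F x" "cmod (s i x) \<le> 2 * cmod (F x)" for i x
    using s' by (simp_all add: haar_space[OF \<nu>])
  note [measurable] = L2_measurable[OF F] borel_measurable_simple_function[OF s(1)]
  define G where "G i \<xi> = s i \<xi> * indicator D \<xi>" for i \<xi>
  have Gc: "G i \<in> band_closure" for i
  proof -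
    have "G i = (\<lambda>\<xi>. \<Sum>y\<in>range (s i). y * (indicator (s i -` {y}) \<xi> * indicator D \<xi>))"
    proof
      fix \<xi>
      have "s i \<xi> = (\<Sum>y\<in>range (s i). indicator (s i -` {y}) \<xi> *\<^sub>R y)"
        using simple_function_indicator_representation_banach[OF s(1), of \<xi> i]
        unfolding haar_space[OF \<nu>] Int_UNIV_right by blast
      also have "\<dots> = (\<Sum>y\<in>range (s i). y * indicator (s i -` {y}) \<xi>)"
        by (intro sum.cong) (auto simp: indicator_def)
      finally have "G i \<xi> = (\<Sum>y\<in>range (s i). y * indicator (s i -` {y}) \<xi>) * indicator D \<xi>"
        unfolding G_def by (rule arg_cong)
      then show "G i \<xi> = (\<Sum>y\<in>range (s i). y * (indicator (s i -` {y}) \<xi> * indicator D \<xi>))"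
        by (simp only: sum_distrib_right mult.assoc)
    qed
    moreover have "s i -` {y} \<in> sets \<nu>" for y
      using simple_functionD(2)[OF s(1), of i "{y}"] by (simp add: haar_space[OF \<nu>])
    ultimately show ?thesis
      by (simp add: band_closure_sum band_closure_scale indicator_band_closure)
  qed
  have "(\<lambda>i. LINT \<xi>|\<nu>. (cmod (G i \<xi> - F \<xi>))\<^sup>2) \<longlonglongrightarrow> (LINT \<xi>|\<nu>. 0)"
  \<comment> \<open>The constant is (2 + 1)^2: the simple functions are bounded by twice the modulus
    of \<open>F\<close>.\<close>
  proof (rule integral_dominated_convergence[where w="\<lambda>\<xi>. 9 * (cmod (F \<xi>))\<^sup>2"])
    show "integrable \<nu> (\<lambda>\<xi>. 9 * (cmod (F \<xi>))\<^sup>2)" using L2_integrable[OF F] by simp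
    show "(\<lambda>\<xi>. (cmod (G i \<xi> - F \<xi>))\<^sup>2) \<in> borel_measurable \<nu>" for i
      unfolding G_def by measurable
    show "AE \<xi> in \<nu>. (\<lambda>i. (cmod (G i \<xi> - F \<xi>))\<^sup>2) \<longlonglongrightarrow> 0"
      using FD
    proof eventually_elim
      case (elim \<xi>)
      have "(\<lambda>i. G i \<xi>) \<longlonglongrightarrow> F \<xi> * indicator D \<xi>"
        unfolding G_def by (intro tendsto_mult s tendsto_const)
      moreover have "F \<xi> * indicator D \<xi> = F \<xi>" using elim by (auto simp: indicator_def)
      ultimately have "(\<lambda>i. (cmod (G i \<xi> - F \<xi>))\<^sup>2) \<longlonglongrightarrow> (cmod (F \<xi> - F \<xi>))\<^sup>2"
        by (intro tendsto_power tendsto_norm tendsto_diff tendsto_const) simp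
      then show ?case by simp
    qed
    show "AE \<xi> in \<nu>. norm ((cmod (G i \<xi> - F \<xi>))\<^sup>2) \<le> 9 * (cmod (F \<xi>))\<^sup>2" for i
    proof (rule AE_I2)
      fix \<xi>
      have "cmod (G i \<xi>) \<le> 2 * cmod (F \<xi>)" using s(3)[of i \<xi>] by (simp add: G_def indicator_def)
      then have "cmod (G i \<xi> - F \<xi>) \<le> 3 * cmod (F \<xi>)" using norm_triangle_ineq4[of "G i \<xi>" "F \<xi>"] by linarith
      then have "(cmod (G i \<xi> - F \<xi>))\<^sup>2 \<le> (3 * cmod (F \<xi>))\<^sup>2" by (intro power_mono) auto
      then show "norm ((cmod (G i \<xi> - F \<xi>))\<^sup>2) \<le> 9 * (cmod (F \<xi>))\<^sup>2" by (simp add: power_mult_distrib)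
    qed
  qed simp
  then have "(\<lambda>i. L2_norm \<nu> (\<lambda>\<xi>. G i \<xi> - F \<xi>)) \<longlonglongrightarrow> 0"
    unfolding L2_norm_def using tendsto_real_sqrt by fastforce
  note lim = this
  show ?thesis
  proof (rule band_closure_closed[OF F])
    fix \<epsilon> :: real assume "0 < \<epsilon>"
    from order_tendstoD(2)[OF lim this] obtain i where "L2_norm \<nu> (\<lambda>\<xi>. G i \<xi> - F \<xi>) < \<epsilon>"
      by (auto simp: eventually_sequentially)
    then show "\<exists>G\<in>band_closure. L2_norm \<nu> (\<lambda>\<xi>. G \<xi> - F \<xi>) < \<epsilon>" using Gc by blast
  qed
qed

subsection \<open>The sampling series\<close>

text \<open>
  On the transform side translation of \<open>g_D\<close> by \<open>y\<close> is \<open>dual_kernel y\<close>, and pairing with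
  \<open>dual_kernel x\<close> is evaluation at \<open>x\<close>.
\<close>

definition dual_kernel :: "'a \<Rightarrow> 'a dual \<Rightarrow> complex" where
  "dual_kernel y \<xi> = indicator D \<xi> * cnj (eval_char \<xi> y)"

lemma dual_kernel_L2: "dual_kernel y \<in> L2 \<nu>"
proof -
  have "(\<lambda>\<xi>. cnj (eval_char \<xi> y) * indicator D \<xi>) \<in> L2 \<nu>"
    by (rule L2_mult_bounded[OF indicator_D_L2, where C=1])
      (simp_all add: borel_measurable_cnj borel_measurable_eval_char_dual[OF \<nu>])
  then show ?thesis unfolding dual_kernel_def[abs_def] by (simp add: mult.commute)
qed

lemma inner_dual_kernel: "L2_inner \<nu> F (dual_kernel x) = (LINT \<xi>:D|\<nu>. F \<xi> * eval_char \<xi> x)"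
  unfolding L2_inner_def set_lebesgue_integral_def
  by (rule Bochner_Integration.integral_cong) (auto simp: dual_kernel_def indicator_def)

lemma inner_dual_kernels: "L2_inner \<nu> (dual_kernel y) (dual_kernel x) = band_kernel \<nu> D (x - y)"
  unfolding inner_dual_kernel band_kernel_def set_lebesgue_integral_def
  by (rule Bochner_Integration.integral_cong) (auto simp: dual_kernel_def indicator_def eval_char_diff)

lemma band_kernel_annihilator:
  assumes "x \<in> annihilator \<Lambda>"
  shows "band_kernel \<nu> D x = (if x = 0 then complex_of_real (measure \<nu> D) else 0)"
proof -
  have eq: "band_kernel \<nu> D x = (LINT \<xi>|\<nu>. indicator D \<xi> * eval_char \<xi> x)"
    unfolding band_kernel_def set_lebesgue_integral_def
    by (rule Bochner_Integration.integral_cong) (auto simp: indicator_def)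
  show ?thesis
  proof (cases "x = 0")
    case True
    then show ?thesis unfolding eq by (simp add: integral_indicator_complex haar_space[OF \<nu>])
  qed (simp add: eq annihilator_orthogonal[OF assms])
qed

lemma inner_dual_kernels_annihilator:
  assumes "l \<in> annihilator \<Lambda>" "m \<in> annihilator \<Lambda>"
  shows "L2_inner \<nu> (dual_kernel l) (dual_kernel m) = (if l = m then complex_of_real (measure \<nu> D) else 0)"
  using band_kernel_annihilator[OF add_subgroup_diff[OF add_subgroup_annihilator assms(2,1)]]
  by (auto simp: inner_dual_kernels)

text \<open>The norm does not depend on \<open>x\<close>: this is why convergence in
  \<open>L2\<close> gives uniform convergence.\<close>

lemma norm_dual_kernel: "L2_norm \<nu> (dual_kernel x) = sqrt (measure \<nu> D)"
proof -
  have "0 \<in> annihilator \<Lambda>" using add_subgroup_annihilator by (simp add: add_subgroup_def)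
  from band_kernel_annihilator[OF this]
  have "complex_of_real ((L2_norm \<nu> (dual_kernel x))\<^sup>2) = complex_of_real (measure \<nu> D)"
    using inner_dual_kernels[of x x] unfolding L2_inner_self by simp
  then have "(L2_norm \<nu> (dual_kernel x))\<^sup>2 = measure \<nu> D" unfolding of_real_eq_iff .
  then show ?thesis by (metis L2_norm_nonneg real_sqrt_unique)
qed

lemma has_fourier_L2_kernel: "has_fourier_L2 \<mu> \<nu> (\<lambda>x. band_kernel \<nu> D (x - y)) (dual_kernel y)"
proof -
  have 1: "dual_kernel y \<in> fourier_closure"
    using fourier_closure_mult_char[OF indicator_compact_in_closure[OF D], of "- y"]
    by (simp add: dual_kernel_def[abs_def] eval_char_uminus mult.commute)
  have "has_fourier_L2 \<mu> \<nu> (\<lambda>x. LINT \<xi>|\<nu>. dual_kernel y \<xi> * eval_char \<xi> x) (dual_kernel y)"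
    by (rule has_fourier_L2_synthesis[OF 1 D]) (simp add: dual_kernel_def)
  moreover have "(LINT \<xi>|\<nu>. dual_kernel y \<xi> * eval_char \<xi> x) = band_kernel \<nu> D (x - y)" for x
    unfolding band_kernel_def set_lebesgue_integral_def
    by (rule Bochner_Integration.integral_cong) (auto simp: dual_kernel_def indicator_def eval_char_diff)
  ultimately show ?thesis by simp
qed

lemma has_fourier_L2_scale:
  assumes "has_fourier_L2 \<mu> \<nu> f F"
  shows "has_fourier_L2 \<mu> \<nu> (\<lambda>x. c * f x) (\<lambda>\<xi>. c * F \<xi>)"
  using has_fourier_L2_add_scale[OF assms assms, of "c - 1"] by (simp add: algebra_simps)

lemma has_fourier_L2_diff_sum:
  assumes f: "has_fourier_L2 \<mu> \<nu> f F" and S: "finite S"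
  shows "has_fourier_L2 \<mu> \<nu> (\<lambda>x. f x - (\<Sum>l\<in>S. c l * band_kernel \<nu> D (x - l)))
    (\<lambda>\<xi>. F \<xi> - (\<Sum>l\<in>S. c l * dual_kernel l \<xi>))"
  using S
proof (induction S rule: finite_induct)
  case (insert l S)
  then show ?case using has_fourier_L2_add_scale[OF insert.IH has_fourier_L2_kernel[of l], of "- c l"]
    by (simp add: algebra_simps)
qed (simp add: f)

lemma band_dense:
  assumes F: "F \<in> L2 \<nu>" and FD: "AE \<xi> in \<nu>. \<xi> \<notin> D \<longrightarrow> F \<xi> = 0" and \<epsilon>: "0 < \<epsilon>"
  shows "\<exists>S c. finite S \<and> S \<subseteq> annihilator \<Lambda> \<and> L2_norm \<nu> (\<lambda>\<xi>. F \<xi> - (\<Sum>l\<in>S. c l * dual_kernel l \<xi>)) < \<epsilon>"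
proof -
  obtain p where p: "p \<in> trig_span (annihilator \<Lambda>) (\<lambda>x \<xi>. eval_char \<xi> x)"
      "L2_norm \<nu> (\<lambda>\<xi>. p \<xi> * indicator D \<xi> - F \<xi>) < \<epsilon>"
    by (rule band_closureE[OF band_closure_all[OF F FD] \<epsilon>])
  obtain S c where S: "finite S" "S \<subseteq> annihilator \<Lambda>" "p = (\<lambda>\<xi>. \<Sum>x\<in>S. c x * eval_char \<xi> x)"
    using trig_span_sum[OF p(1)] by blast
  \<comment> \<open>The kernels contain conjugated characters, so the frequency \<open>x\<close> of
    \<open>p\<close> appears as the kernel at \<open>- x\<close>.\<close>
  have "p \<xi> * indicator D \<xi> = (\<Sum>l\<in>uminus ` S. c (- l) * dual_kernel l \<xi>)" for \<xi>
    by (subst sum.reindex)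
      (simp_all add: S(3) dual_kernel_def eval_char_uminus sum_distrib_right sum_distrib_left mult_ac)
  then have "L2_norm \<nu> (\<lambda>\<xi>. F \<xi> - (\<Sum>l\<in>uminus ` S. c (- l) * dual_kernel l \<xi>)) < \<epsilon>"
    using p(2) by (simp add: L2_norm_minus_commute[of \<nu> F])
  moreover have "uminus ` S \<subseteq> annihilator \<Lambda>"
    using S(2) add_subgroup_annihilator by (auto simp: add_subgroup_def)
  ultimately show ?thesis using S(1) by (intro exI[of _ "uminus ` S"] exI[of _ "\<lambda>l. c (- l)"]) simp
qed

lemma inner_dual_kernel_sum:
  assumes "h \<in> L2 \<nu>"
  shows "L2_inner \<nu> (\<lambda>\<xi>. \<Sum>l\<in>S. b l * dual_kernel l \<xi>) h = (\<Sum>l\<in>S. b l * L2_inner \<nu> (dual_kernel l) h)"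
  using L2_inner_sum_left[of S "\<lambda>l \<xi>. b l * dual_kernel l \<xi>" \<nu> h] assms
  by (simp add: L2_scale dual_kernel_L2 L2_inner_scale_left)

text \<open>The Fourier coefficients give the orthogonal projection to the span over
  \<open>S\<close>, and a combination over \<open>T\<close> is one competitor in that span. So an
  approximation found for one \<open>T\<close> controls the expansion over every larger
  \<open>S\<close>, as convergence along finite subsets requires.\<close>

lemma best_approximation:
  assumes F: "F \<in> L2 \<nu>" and S: "finite S" "S \<subseteq> annihilator \<Lambda>" "T \<subseteq> S"
  shows "L2_norm \<nu> (\<lambda>\<xi>. F \<xi> - (\<Sum>l\<in>S. L2_inner \<nu> F (dual_kernel l) / measure \<nu> D * dual_kernel l \<xi>))
    \<le> L2_norm \<nu> (\<lambda>\<xi>. F \<xi> - (\<Sum>l\<in>T. c l * dual_kernel l \<xi>))"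
proof -
  define a where "a l = L2_inner \<nu> F (dual_kernel l) / measure \<nu> D" for l
  \<comment> \<open>Coefficients of the difference \<open>Q\<close> of the two approximants, with
    \<open>c\<close> extended by 0; \<open>Q\<close> lies in the span orthogonal to the residual
    \<open>R\<close>.\<close>
  define d where "d l = a l - (if l \<in> T then c l else 0)" for l
  define R where "R \<xi> = F \<xi> - (\<Sum>l\<in>S. a l * dual_kernel l \<xi>)" for \<xi>
  define Q where "Q \<xi> = (\<Sum>l\<in>S. d l * dual_kernel l \<xi>)" for \<xi>
  have aL: "(\<lambda>\<xi>. \<Sum>l\<in>S. b l * dual_kernel l \<xi>) \<in> L2 \<nu>" for b
    by (intro L2_sum L2_scale dual_kernel_L2)
  have RL: "R \<in> L2 \<nu>" unfolding R_def[abs_def] by (intro L2_diff F aL)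
  have QL: "Q \<in> L2 \<nu>" unfolding Q_def[abs_def] by (rule aL)
  have Rm: "L2_inner \<nu> R (dual_kernel m) = 0" if m: "m \<in> S" for m
  proof -
    have "L2_inner \<nu> R (dual_kernel m) = L2_inner \<nu> F (dual_kernel m) - (\<Sum>l\<in>S. a l * L2_inner \<nu> (dual_kernel l) (dual_kernel m))"
      unfolding R_def[abs_def] L2_inner_diff_left[OF F aL dual_kernel_L2] inner_dual_kernel_sum[OF dual_kernel_L2] ..
    also have "(\<Sum>l\<in>S. a l * L2_inner \<nu> (dual_kernel l) (dual_kernel m)) = (\<Sum>l\<in>S. if l = m then a l * measure \<nu> D else 0)"
      using S(2) m by (intro sum.cong) (auto simp: inner_dual_kernels_annihilator subset_iff)
    also have "\<dots> = a m * measure \<nu> D" using S(1) m by simp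
    also have "\<dots> = L2_inner \<nu> F (dual_kernel m)" using measure_D_pos by (simp add: a_def)
    finally show ?thesis by simp
  qed
  have "L2_inner \<nu> Q R = 0"
  proof -
    have "L2_inner \<nu> (dual_kernel l) R = 0" if "l \<in> S" for l
      using Rm[OF that] L2_inner_commute[of \<nu> "dual_kernel l" R] by simp
    then show ?thesis unfolding Q_def[abs_def] inner_dual_kernel_sum[OF RL] by simp
  qed
  then have "L2_inner \<nu> R Q = 0" using L2_inner_commute[of \<nu> R Q] by simp
  then have "(L2_norm \<nu> R)\<^sup>2 \<le> (L2_norm \<nu> (\<lambda>\<xi>. R \<xi> + Q \<xi>))\<^sup>2"
    unfolding L2_norm_add_square[OF RL QL] by simp
  then have "L2_norm \<nu> R \<le> L2_norm \<nu> (\<lambda>\<xi>. R \<xi> + Q \<xi>)" by (rule power2_le_imp_le) simp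
  also have "(\<lambda>\<xi>. R \<xi> + Q \<xi>) = (\<lambda>\<xi>. F \<xi> - (\<Sum>l\<in>T. c l * dual_kernel l \<xi>))"
  proof
    fix \<xi>
    have "(\<Sum>l\<in>S. (if l \<in> T then c l else 0) * dual_kernel l \<xi>) = (\<Sum>l\<in>S. if l \<in> T then c l * dual_kernel l \<xi> else 0)"
      by (intro sum.cong) auto
    also have "\<dots> = (\<Sum>l\<in>T. c l * dual_kernel l \<xi>)"
      using S by (simp add: sum.inter_restrict[symmetric] Int_absorb1)
    finally show "R \<xi> + Q \<xi> = F \<xi> - (\<Sum>l\<in>T. c l * dual_kernel l \<xi>)"
      by (simp add: R_def Q_def d_def left_diff_distrib sum_subtractf)
  qed
  finally show ?thesis by (simp add: R_def[abs_def] a_def)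
qed

lemma band_spaceE:
  assumes "f \<in> band_space \<mu> \<nu> D"
  obtains F where "has_fourier_L2 \<mu> \<nu> f F" "F \<in> L2 \<nu>" "AE \<xi> in \<nu>. \<xi> \<notin> D \<longrightarrow> F \<xi> = 0"
    "\<And>x. f x = L2_inner \<nu> F (dual_kernel x)"
  using assms unfolding band_space_def has_fourier_L2_def inner_dual_kernel by blast

text \<open>The Fourier coefficient of \<open>F\<close> at \<open>l\<close> is \<open>f l\<close>
  divided by \<open>V\<close>. The error at \<open>x\<close> is the pairing of the residual with
  \<open>dual_kernel x\<close>, so Cauchy-Schwarz bounds it by the residual norm times a
  constant.\<close>

lemma sampling_uniform_limit:
  assumes "f \<in> band_space \<mu> \<nu> D"
  shows "uniform_limit UNIV (\<lambda>S x. \<Sum>l\<in>S. band_kernel \<nu> D (x - l) * f l)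
    (\<lambda>x. complex_of_real (measure \<nu> D) * f x) (finite_subsets_at_top (annihilator \<Lambda>))"
proof -
  define V where "V = measure \<nu> D"
  have V: "0 < V" using measure_D_pos by (simp add: V_def)
  obtain F where F: "F \<in> L2 \<nu>" "AE \<xi> in \<nu>. \<xi> \<notin> D \<longrightarrow> F \<xi> = 0"
    "\<And>x. f x = L2_inner \<nu> F (dual_kernel x)"
    by (rule band_spaceE[OF assms]) blast
  show ?thesis
    unfolding uniform_limit_iff
  proof (intro allI impI)
    fix e :: real assume e: "0 < e"
    \<comment> \<open>One factor \<open>V\<close> comes from leaving the series undivided by
      \<open>V\<close>, the factor \<open>sqrt V\<close> is the norm of the kernels.\<close>
    define \<delta> where "\<delta> = e / (V * sqrt V)"
    have "0 < \<delta>" using e V by (simp add: \<delta>_def)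
    from band_dense[OF F(1,2) this] obtain T c where T: "finite T" "T \<subseteq> annihilator \<Lambda>"
      "L2_norm \<nu> (\<lambda>\<xi>. F \<xi> - (\<Sum>l\<in>T. c l * dual_kernel l \<xi>)) < \<delta>" by blast
    have "\<forall>\<^sub>F S in finite_subsets_at_top (annihilator \<Lambda>). finite S \<and> T \<subseteq> S \<and> S \<subseteq> annihilator \<Lambda>"
      using T(1,2) by (auto simp: eventually_finite_subsets_at_top)
    then show "\<forall>\<^sub>F S in finite_subsets_at_top (annihilator \<Lambda>).
        \<forall>x\<in>UNIV. dist (\<Sum>l\<in>S. band_kernel \<nu> D (x - l) * f l) (complex_of_real (measure \<nu> D) * f x) < e"
    proof eventually_elim
      case (elim S)
      define R where "R \<xi> = F \<xi> - (\<Sum>l\<in>S. f l / V * dual_kernel l \<xi>)" for \<xi>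
      have sL: "(\<lambda>\<xi>. \<Sum>l\<in>S. f l / V * dual_kernel l \<xi>) \<in> L2 \<nu>"
        by (intro L2_sum L2_scale dual_kernel_L2)
      have RL: "R \<in> L2 \<nu>" unfolding R_def[abs_def] by (intro L2_diff F sL)
      have "L2_norm \<nu> R \<le> L2_norm \<nu> (\<lambda>\<xi>. F \<xi> - (\<Sum>l\<in>T. c l * dual_kernel l \<xi>))"
        using best_approximation[OF F(1), of S T c] elim unfolding R_def[abs_def] F(3) V_def by blast
      then have R\<delta>: "L2_norm \<nu> R < \<delta>" using T(3) by linarith
      show ?case
      proof
        fix x
        have "L2_inner \<nu> R (dual_kernel x) = f x - (\<Sum>l\<in>S. f l / V * band_kernel \<nu> D (x - l))"
          unfolding R_def[abs_def] L2_inner_diff_left[OF F(1) sL dual_kernel_L2]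
            inner_dual_kernel_sum[OF dual_kernel_L2] inner_dual_kernels F(3)[symmetric] ..
        then have "complex_of_real V * f x - (\<Sum>l\<in>S. band_kernel \<nu> D (x - l) * f l) = complex_of_real V * L2_inner \<nu> R (dual_kernel x)"
          using V by (simp add: right_diff_distrib sum_distrib_left mult.commute)
        then have "dist (\<Sum>l\<in>S. band_kernel \<nu> D (x - l) * f l) (complex_of_real V * f x) = V * cmod (L2_inner \<nu> R (dual_kernel x))"
          using V by (simp add: dist_norm norm_minus_commute norm_mult)
        also have "\<dots> \<le> V * (L2_norm \<nu> R * sqrt V)"
          using L2_Cauchy_Schwarz[OF RL dual_kernel_L2, of x] V by (simp add: norm_dual_kernel V_def)
        also have "\<dots> < V * (\<delta> * sqrt V)" using R\<delta> V by simp
        also have "\<dots> = e" using V by (simp add: \<delta>_def)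
        finally show "dist (\<Sum>l\<in>S. band_kernel \<nu> D (x - l) * f l) (complex_of_real (measure \<nu> D) * f x) < e"
          by (simp add: V_def)
      qed
    qed
  qed
qed

lemma sampling_infsum:
  assumes "f \<in> band_space \<mu> \<nu> D"
  shows "(\<Sum>\<^sub>\<infinity>l\<in>annihilator \<Lambda>. band_kernel \<nu> D (x - l) * f l) = complex_of_real (measure \<nu> D) * f x"
proof -
  \<comment> \<open>An infinite sum that does not converge has the default value 0, so convergence
    is secured as \<open>has_sum\<close> before the sum is evaluated.\<close>
  have "((\<lambda>l. band_kernel \<nu> D (x - l) * f l) has_sum complex_of_real (measure \<nu> D) * f x) (annihilator \<Lambda>)"
    unfolding has_sum_def using tendsto_uniform_limitI[OF sampling_uniform_limit[OF assms], of x] by simp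
  then show ?thesis by (rule infsumI)
qed

text \<open>The isometry carries orthogonality and density over from the dual, where each kernel has
  squared norm \<open>measure \<nu> D\<close>; the power -1/2 normalises it.\<close>

lemma kernels_orthonormal_basis:
  "is_orthonormal_basis \<mu> (band_space \<mu> \<nu> D) (annihilator \<Lambda>)
    (\<lambda>l x. complex_of_real (measure \<nu> D powr (- 1 / 2)) * band_kernel \<nu> D (x - l))"
proof -
  define k where "k = complex_of_real (measure \<nu> D powr (- 1 / 2))"
  have k0: "k \<noteq> 0" using measure_D_pos by (simp add: k_def)
  have "k * cnj k = complex_of_real (measure \<nu> D powr (- 1 / 2) * measure \<nu> D powr (- 1 / 2))"
    by (simp add: k_def)
  also have "measure \<nu> D powr (- 1 / 2) * measure \<nu> D powr (- 1 / 2) = inverse (measure \<nu> D)"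
  proof -
    have "measure \<nu> D powr (- 1 / 2) * measure \<nu> D powr (- 1 / 2) = measure \<nu> D powr (- 1)"
      by (subst powr_add[symmetric]) simp
    then show ?thesis using measure_D_pos by (simp add: powr_minus)
  qed
  finally have kk: "k * cnj k = complex_of_real (inverse (measure \<nu> D))" .
  have hf: "has_fourier_L2 \<mu> \<nu> (\<lambda>x. k * band_kernel \<nu> D (x - l)) (\<lambda>\<xi>. k * dual_kernel l \<xi>)" for l
    by (rule has_fourier_L2_scale[OF has_fourier_L2_kernel])
  have mem: "(\<lambda>x. k * band_kernel \<nu> D (x - l)) \<in> band_space \<mu> \<nu> D" for l
    unfolding band_space_def
  proof (intro CollectI exI conjI allI)
    show "has_fourier_L2 \<mu> \<nu> (\<lambda>x. k * band_kernel \<nu> D (x - l)) (\<lambda>\<xi>. k * dual_kernel l \<xi>)" by (rule hf)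
    show "AE \<xi> in \<nu>. \<xi> \<notin> D \<longrightarrow> k * dual_kernel l \<xi> = 0" by (simp add: dual_kernel_def)
    show "k * band_kernel \<nu> D (x - l) = (LINT \<xi>:D|\<nu>. k * dual_kernel l \<xi> * eval_char \<xi> x)" for x
      unfolding inner_dual_kernel[symmetric] L2_inner_scale_left inner_dual_kernels ..
  qed
  have orth: "L2_inner \<mu> (\<lambda>x. k * band_kernel \<nu> D (x - l)) (\<lambda>x. k * band_kernel \<nu> D (x - m))
      = (if l = m then 1 else 0)" if lm: "l \<in> annihilator \<Lambda>" "m \<in> annihilator \<Lambda>" for l m
  proof -
    have "L2_inner \<mu> (\<lambda>x. k * band_kernel \<nu> D (x - l)) (\<lambda>x. k * band_kernel \<nu> D (x - m))
        = (k * cnj k) * L2_inner \<nu> (dual_kernel l) (dual_kernel m)"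
      unfolding L2_inner_scale_left L2_inner_scale_right
        has_fourier_L2_inner[OF has_fourier_L2_kernel has_fourier_L2_kernel] mult.assoc ..
    also have "\<dots> = (if l = m then 1 else 0)"
      unfolding kk inner_dual_kernels_annihilator[OF lm] using measure_D_pos by simp
    finally show ?thesis .
  qed
  have dense: "\<exists>S c. finite S \<and> S \<subseteq> annihilator \<Lambda> \<and>
      L2_norm \<mu> (\<lambda>x. f x - (\<Sum>l\<in>S. c l * (k * band_kernel \<nu> D (x - l)))) < \<epsilon>"
    if f: "f \<in> band_space \<mu> \<nu> D" and \<epsilon>: "0 < \<epsilon>" for f \<epsilon>
  proof -
    obtain F where F: "has_fourier_L2 \<mu> \<nu> f F" "F \<in> L2 \<nu>" "AE \<xi> in \<nu>. \<xi> \<notin> D \<longrightarrow> F \<xi> = 0"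
      by (rule band_spaceE[OF f]) blast
    from band_dense[OF F(2,3) \<epsilon>] obtain S c where S: "finite S" "S \<subseteq> annihilator \<Lambda>"
      "L2_norm \<nu> (\<lambda>\<xi>. F \<xi> - (\<Sum>l\<in>S. c l * dual_kernel l \<xi>)) < \<epsilon>" by blast
    have "L2_norm \<mu> (\<lambda>x. f x - (\<Sum>l\<in>S. c l * band_kernel \<nu> D (x - l))) < \<epsilon>"
      using S(3) has_fourier_L2_norm[OF has_fourier_L2_diff_sum[OF F(1) S(1), of c]] by simp
    \<comment> \<open>Density was obtained for unnormalised kernels; the coefficients absorb the
      factor \<open>k\<close>.\<close>
    then have "L2_norm \<mu> (\<lambda>x. f x - (\<Sum>l\<in>S. (c l / k) * (k * band_kernel \<nu> D (x - l)))) < \<epsilon>"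
      using k0 by simp
    then show ?thesis using S(1,2) by (intro exI[of _ S] exI[of _ "\<lambda>l. c l / k"] conjI)
  qed
  show ?thesis
    unfolding is_orthonormal_basis_def k_def[symmetric]
    by (intro conjI ballI allI impI mem orth dense)
qed

end

theorem theorem6p1:
  fixes \<mu> :: "'a::{topological_ab_group_add, t2_space} measure"
    and \<nu> :: "'a dual measure"
    and \<Lambda> D :: "'a dual set"
  assumes "locally_compact_space (euclidean :: 'a topology)"
    and "sigma_compact (UNIV :: 'a set)"
    and "haar_measure \<mu>" and "haar_measure \<nu>" and "fourier_isometry \<mu> \<nu>"
    and "add_subgroup \<Lambda>" and "discrete \<Lambda>" and "cocompact \<Lambda>"
    and "compact D" and "fundamental_domain \<nu> \<Lambda> D"
  defines "V \<equiv> measure \<nu> D"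
    and "L \<equiv> annihilator \<Lambda>"
    and "g \<equiv> band_kernel \<nu> D"
  shows "is_orthonormal_basis \<mu> (band_space \<mu> \<nu> D) L
           (\<lambda>l x. complex_of_real (V powr (- 1 / 2)) * g (x - l)) \<and>
         (\<forall>f \<in> band_space \<mu> \<nu> D.
           (\<forall>x. f x = complex_of_real (inverse V) * (\<Sum>\<^sub>\<infinity>l\<in>L. g (x - l) * f l)) \<and>
           uniform_limit UNIV (\<lambda>S x. \<Sum>l\<in>S. g (x - l) * f l)
             (\<lambda>x. \<Sum>\<^sub>\<infinity>l\<in>L. g (x - l) * f l) (finite_subsets_at_top L))"
proof -
  interpret sampling_lattice \<mu> \<nu> \<Lambda> D
    using assms(1-7,9,10) by unfold_locales
  show ?thesis
    unfolding V_def L_def g_def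
  proof (intro conjI ballI allI)
    show "is_orthonormal_basis \<mu> (band_space \<mu> \<nu> D) (annihilator \<Lambda>)
        (\<lambda>l x. complex_of_real (measure \<nu> D powr (- 1 / 2)) * band_kernel \<nu> D (x - l))"
      by (rule kernels_orthonormal_basis)
    fix f assume f: "f \<in> band_space \<mu> \<nu> D"
    show "f x = complex_of_real (inverse (measure \<nu> D)) *
        (\<Sum>\<^sub>\<infinity>l\<in>annihilator \<Lambda>. band_kernel \<nu> D (x - l) * f l)" for x
      unfolding sampling_infsum[OF f] using measure_D_pos by simp
    show "uniform_limit UNIV (\<lambda>S x. \<Sum>l\<in>S. band_kernel \<nu> D (x - l) * f l)
        (\<lambda>x. \<Sum>\<^sub>\<infinity>l\<in>annihilator \<Lambda>. band_kernel \<nu> D (x - l) * f l) (finite_subsets_at_top (annihilator \<Lambda>))"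
      unfolding sampling_infsum[OF f] by (rule sampling_uniform_limit[OF f])
  qed
qed

end
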